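(* Let $\Theta$ be a classical-quantum channel mapping each input symbol $x$ of a finite alphabet $\mathcal{X}$ to a quantum state $\theta_x$. For every $\varepsilon>0$ the following hold. (Public communication.) If $\theta_x=\theta_x^Y$ is a state of the receiver's system $Y$, then $$C_{\rm pub}^{\varepsilon}(\Theta)\geq \max_{P_X}\Big[H_{\min}^{\varepsilon/8}(X)-H_{\max}^{\varepsilon/8}(X|Y)-4\log\tfrac{1}{\varepsilon}-16\Big],$$ $$C_{\rm pub}^{\varepsilon}(\Theta)\leq \max_{P_X}\Big[H_{\min}(X)-H_{\max}^{\sqrt{2\varepsilon}}(X|Y)\Big],$$ where the entropies are evaluated on the classical-quantum state $\psi^{XY}=\sum_x P_X(x)\,|x\rangle\langle x|^X\otimes\theta_x^Y$. (Private communication.) If $\theta_x=\theta_x^{YZ}$ is a bipartite state whose $Y$ part goes to the receiver and whose $Z$ part goes to an eavesdropper, then $$C_{\rm prv}^{8\varepsilon}(\Theta)\geq\max_{P_T,\,T\rightarrow X}\Big[H_{\min}^{\varepsilon/8}(T|Z)-H_{\max}^{\varepsilon/8}(T|Y)-4\log\tfrac{1}{\varepsilon}-16\Big],$$ $$C_{\rm prv}^{\varepsilon}(\Theta)\leq \max_{P_T,\,T\rightarrow X}\Big[H_{\min}^{\sqrt{2\varepsilon}}(T|Z)-H_{\max}^{\sqrt{2\varepsilon}}(T|Y)\Big],$$ where the maximizations run over finite random variables $T$ with distribution $P_T$ and stochastic maps $P_{X|T}$ (so that $T\to X\to(Y,Z)$ is a Markov chain), and the entropies are evaluated on the state $\sum_t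 P_T(t)\,|t\rangle\langle t|^T\otimes\sum_x P_{X|T}(x|t)\,\theta_x^{YZ}$ and its reductions.
   Context: All logarithms are base 2. An $(n,\varepsilon)$-coding scheme for $\Theta$ consists of an encoder $\mathsf{Enc}:\mathcal{M}\to\mathcal{X}$ on a finite message set $\mathcal{M}$ with $n=\log_2|\mathcal{M}|$ and a decoder $\mathsf{Dec}$ (a measurement on the output system $Y$ with outcomes in $\mathcal{M}$) such that for every $m\in\mathcal{M}$, $p_{\rm error}(m)=\Pr[m\neq \mathsf{Dec}(\Theta(\mathsf{Enc}(m)))]\leq\varepsilon$. An $(n,\varepsilon)$-private coding scheme additionally satisfies, for every $m$, $p_{\rm secret}(m)=\tfrac12\|\theta^Z_{\mathsf{Enc}(m)}-\theta^Z\|_1\leq\varepsilon$, where $\theta^Z=2^{-n}\sum_m\theta^Z_{\mathsf{Enc}(m)}$ and $\theta^Z_x$ is the $Z$-marginal of $\theta^{YZ}_x$ (the encoder may be randomized, in which case $\theta_{\mathsf{Enc}(m)}$ denotes the averaged output). $C^\varepsilon_{\rm pub}(\Theta)$ (resp. $C^\varepsilon_{\rm prv}(\Theta)$) is the largest $n$ for which an $(n,\varepsilon)$-coding scheme (resp. private coding scheme) exists. Entropies: for a state $\rho^{AB}$, $H_{\max}(A|B)_\rho=\max_{\sigma^B}2\log F(\rho^{AB},\mathbb{1}^A\otimes\sigma^B)$ with $F(\rho,\sigma)=\|\sqrt\rho\sqrt\sigma\|_1$, and $H_{\min}(A|B)_\rho=\max_{\sigma^B}\big(-\log\min\{\lambda:\rho^{AB}\leq\lambda\,\mathbb{1}^A\otimes\sigma^B\}\big)$,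 maximizations over normalized states $\sigma^B$; unconditional entropies $H_{\min}(A)$, $H_{\max}(A)$ are the case of trivial $B$. With purification distance $P(\rho,\sigma)=\sqrt{1-F(\rho,\sigma)^2}$ and $B_\epsilon(\rho)=\{\bar\rho\text{ (possibly subnormalized)}:P(\rho,\bar\rho)\leq\epsilon\}$, the smooth entropies are $H_{\min}^\epsilon(A|B)_\rho=\max_{\bar\rho\in B_\epsilon(\rho)}H_{\min}(A|B)_{\bar\rho}$ and $H_{\max}^\epsilon(A|B)_\rho=\min_{\bar\rho\in B_\epsilon(\rho)}H_{\max}(A|B)_{\bar\rho}$. *)

theory Defs
  imports "Jordan_Normal_Form.Matrix" "HOL-Library.Extended_Real"
begin

text \<open>A system of dimension d is modelled by d x d complex matrices.
 Bipartite systems A B use the Kronecker convention: basis index (a,b) is a*dB + b.\<close>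

definition mtrace :: "complex mat \<Rightarrow> complex" where
  "mtrace A = (\<Sum>i<dim_row A. A $$ (i, i))"

definition adj :: "complex mat \<Rightarrow> complex mat" where
  "adj A = mat (dim_col A) (dim_row A) (\<lambda>(i, j). cnj (A $$ (j, i)))"

definition psd :: "nat \<Rightarrow> complex mat \<Rightarrow> bool" where
  "psd d A \<longleftrightarrow> A \<in> carrier_mat d d \<and>
     (\<forall>v \<in> carrier_vec d. let q = (\<Sum>i<d. cnj (v $ i) * (A *\<^sub>v v) $ i) in Im q = 0 \<and> Re q \<ge> 0)"

definition dens :: "nat \<Rightarrow> complex mat \<Rightarrow> bool" where
  "dens d \<rho> \<longleftrightarrow> psd d \<rho> \<and> mtrace \<rho> = 1"

definition subdens :: "nat \<Rightarrow> complex mat \<Rightarrow> bool" where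
  "subdens d \<rho> \<longleftrightarrow> psd d \<rho> \<and> Re (mtrace \<rho>) \<le> 1"

definition msqrt :: "complex mat \<Rightarrow> complex mat" where
  "msqrt A = (THE B. psd (dim_row A) B \<and> B * B = A)"

definition tnorm :: "complex mat \<Rightarrow> real" where
  "tnorm A = Re (mtrace (msqrt (adj A * A)))"

definition fid :: "complex mat \<Rightarrow> complex mat \<Rightarrow> real" where
  "fid \<rho> \<sigma> = tnorm (msqrt \<rho> * msqrt \<sigma>)"

definition pdist :: "complex mat \<Rightarrow> complex mat \<Rightarrow> real" where
  "pdist \<rho> \<sigma> = sqrt (1 - (fid \<rho> \<sigma>)\<^sup>2)"

definition kron :: "complex mat \<Rightarrow> complex mat \<Rightarrow> complex mat" where
  "kron A B = mat (dim_row A * dim_row B) (dim_col A * dim_col B)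
     (\<lambda>(i, j). A $$ (i div dim_row B, j div dim_col B) * B $$ (i mod dim_row B, j mod dim_col B))"

definition ketbra :: "nat \<Rightarrow> nat \<Rightarrow> complex mat" where
  "ketbra d t = mat d d (\<lambda>(i, j). if i = t \<and> j = t then 1 else 0)"

definition mix :: "nat \<Rightarrow> (nat \<Rightarrow> real) \<Rightarrow> (nat \<Rightarrow> complex mat) \<Rightarrow> nat \<Rightarrow> complex mat" where
  "mix d w M n = mat d d (\<lambda>ij. \<Sum>x<n. complex_of_real (w x) * M x $$ ij)"

text \<open>partial trace over the middle factor of a system A (x) B (x) C of dims a, b, c;
  the result lives on A (x) C.  Tracing out the last factor: c = 1 ... used as ptr a b 1;
  tracing out the first factor: ptr 1 a b.\<close>
definition ptr :: "nat \<Rightarrow> nat \<Rightarrow> nat \<Rightarrow> complex mat \<Rightarrow> complex mat" where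
  "ptr a b c \<rho> = mat (a * c) (a * c)
     (\<lambda>(i, j). \<Sum>k<b. \<rho> $$ ((i div c) * b * c + k * c + i mod c, (j div c) * b * c + k * c + j mod c))"

definition pdistr :: "nat \<Rightarrow> (nat \<Rightarrow> real) \<Rightarrow> bool" where
  "pdistr n P \<longleftrightarrow> (\<forall>x<n. 0 \<le> P x) \<and> (\<Sum>x<n. P x) = 1"

definition elog2 :: "ereal \<Rightarrow> ereal" where
  "elog2 x = (if x = \<infinity> then \<infinity> else if x \<le> 0 then -\<infinity> else ereal (log 2 (real_of_ereal x)))"

definition Hmin :: "nat \<Rightarrow> nat \<Rightarrow> complex mat \<Rightarrow> ereal" where
  "Hmin dA dB \<rho> = (SUP \<sigma> \<in> {\<sigma>. dens dB \<sigma>}.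
     - elog2 (Inf {ereal l | l. psd (dA * dB) (complex_of_real l \<cdot>\<^sub>m kron (1\<^sub>m dA) \<sigma> - \<rho>)}))"

definition Hmax :: "nat \<Rightarrow> nat \<Rightarrow> complex mat \<Rightarrow> ereal" where
  "Hmax dA dB \<rho> = (SUP \<sigma> \<in> {\<sigma>. dens dB \<sigma>}. 2 * elog2 (ereal (fid \<rho> (kron (1\<^sub>m dA) \<sigma>))))"

definition sball :: "real \<Rightarrow> nat \<Rightarrow> complex mat \<Rightarrow> complex mat set" where
  "sball e d \<rho> = {\<rho>'. subdens d \<rho>' \<and> pdist \<rho> \<rho>' \<le> e}"

definition Hmin_s :: "real \<Rightarrow> nat \<Rightarrow> nat \<Rightarrow> complex mat \<Rightarrow> ereal" where
  "Hmin_s e dA dB \<rho> = (SUP \<rho>' \<in> sball e (dA * dB) \<rho>. Hmin dA dB \<rho>')"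

definition Hmax_s :: "real \<Rightarrow> nat \<Rightarrow> nat \<Rightarrow> complex mat \<Rightarrow> ereal" where
  "Hmax_s e dA dB \<rho> = (INF \<rho>' \<in> sball e (dA * dB) \<rho>. Hmax dA dB \<rho>')"

definition povm :: "nat \<Rightarrow> nat \<Rightarrow> (nat \<Rightarrow> complex mat) \<Rightarrow> bool" where
  "povm d N E \<longleftrightarrow> (\<forall>m<N. psd d (E m)) \<and> mix d (\<lambda>_. 1) E N = 1\<^sub>m d"

text \<open>Public (n,eps)-coding scheme with message set {0..<N}, n = log2 N, for the cq channel
  x \<mapsto> \<theta> x (x < nX) with output dimension dY.\<close>
definition pub_code :: "nat \<Rightarrow> nat \<Rightarrow> (nat \<Rightarrow> complex mat) \<Rightarrow> real \<Rightarrow> nat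
    \<Rightarrow> (nat \<Rightarrow> nat) \<Rightarrow> (nat \<Rightarrow> complex mat) \<Rightarrow> bool" where
  "pub_code nX dY \<theta> eps N Enc E \<longleftrightarrow> N \<ge> 1 \<and> (\<forall>m<N. Enc m < nX) \<and> povm dY N E \<and>
     (\<forall>m<N. 1 - Re (mtrace (E m * \<theta> (Enc m))) \<le> eps)"

definition C_pub :: "nat \<Rightarrow> nat \<Rightarrow> (nat \<Rightarrow> complex mat) \<Rightarrow> real \<Rightarrow> ereal" where
  "C_pub nX dY \<theta> eps = Sup {ereal (log 2 (real N)) | N. \<exists>Enc E. pub_code nX dY \<theta> eps N Enc E}"

text \<open>Private coding scheme for x \<mapsto> \<theta> x on Y (x) Z (dims dY, dZ); the encoder may be
  randomized: Enc m is a probability distribution on {0..<nX}.\<close>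
definition avg_out :: "nat \<Rightarrow> nat \<Rightarrow> nat \<Rightarrow> (nat \<Rightarrow> complex mat) \<Rightarrow> (nat \<Rightarrow> nat \<Rightarrow> real) \<Rightarrow> nat \<Rightarrow> complex mat" where
  "avg_out nX dY dZ \<theta> Enc m = mix (dY * dZ) (Enc m) \<theta> nX"

definition prv_code :: "nat \<Rightarrow> nat \<Rightarrow> nat \<Rightarrow> (nat \<Rightarrow> complex mat) \<Rightarrow> real \<Rightarrow> nat
    \<Rightarrow> (nat \<Rightarrow> nat \<Rightarrow> real) \<Rightarrow> (nat \<Rightarrow> complex mat) \<Rightarrow> bool" where
  "prv_code nX dY dZ \<theta> eps N Enc E \<longleftrightarrow> N \<ge> 1 \<and> (\<forall>m<N. pdistr nX (Enc m)) \<and> povm dY N E \<and>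
     (\<forall>m<N. 1 - Re (mtrace (E m * ptr dY dZ 1 (avg_out nX dY dZ \<theta> Enc m))) \<le> eps) \<and>
     (\<forall>m<N. tnorm (ptr 1 dY dZ (avg_out nX dY dZ \<theta> Enc m)
          - mix dZ (\<lambda>_. 1 / real N) (\<lambda>m'. ptr 1 dY dZ (avg_out nX dY dZ \<theta> Enc m')) N) / 2 \<le> eps)"

definition C_prv :: "nat \<Rightarrow> nat \<Rightarrow> nat \<Rightarrow> (nat \<Rightarrow> complex mat) \<Rightarrow> real \<Rightarrow> ereal" where
  "C_prv nX dY dZ \<theta> eps = Sup {ereal (log 2 (real N)) | N. \<exists>Enc E. prv_code nX dY dZ \<theta> eps N Enc E}"

definition cq_state :: "nat \<Rightarrow> nat \<Rightarrow> (nat \<Rightarrow> real) \<Rightarrow> (nat \<Rightarrow> complex mat) \<Rightarrow> complex mat" where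
  "cq_state nX d P \<theta> = mix (nX * d) P (\<lambda>x. kron (ketbra nX x) (\<theta> x)) nX"

definition cqq_state :: "nat \<Rightarrow> nat \<Rightarrow> nat \<Rightarrow> nat \<Rightarrow> (nat \<Rightarrow> real) \<Rightarrow> (nat \<Rightarrow> nat \<Rightarrow> real)
    \<Rightarrow> (nat \<Rightarrow> complex mat) \<Rightarrow> complex mat" where
  "cqq_state nX dY dZ k PT W \<theta> =
     cq_state k (dY * dZ) PT (\<lambda>t. mix (dY * dZ) (W t) \<theta> nX)"

end

theory Submission
  imports Defs "Jordan_Normal_Form.Spectral_Radius" "HOL-Analysis.Convex"
begin

text \<open>
  Both converses measure the receiver with the square roots of the decoding operators. The resulting state is
  close to the channel output in purification distance and, by Cauchy-Schwarz, has
  \<open>H\<^sub>m\<^sub>a\<^sub>x(T|Y) \<le> 0\<close>; in the private case secrecy bounds the fidelity of the \<open>TZ\<close> marginal with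
  a product state, whose min-entropy is \<open>log N\<close>.

  For achievability the inputs are split at random into bins indexed by a syndrome and a message. The
  max-entropy yields a Powers-Stormer test for every input symbol, and the Hayashi-Nagaoka square-root
  decoder built from these tests identifies the symbol within its syndrome class. The min-entropy makes
  almost all bins look alike to the eavesdropper (leftover hashing). Finally a good syndrome is fixed and
  the bad messages are expurgated.
\<close>

text \<open>Two requirements compete for the number of bins. Decoding inside a syndrome class needs
  about 2^Hmax / eps^2 syndromes, while hashing needs the number of all bins to stay below about
  eps^2 * 2^Hmin. What remains for the messages is of order eps^4 * 2^(Hmin - Hmax), hence the 4
  log(1/eps). The numerical losses are collected in the single hypothesis N * l * f^2 <= eps^4 /
  2^15 of \<open>binning\<close>; one more factor 2, from rounding N up, gives the 16.

  The public code needs hashing too, against a one-dimensional eavesdropper: messages are uniform,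
  so the bins must be almost equally likely to reproduce the statistics of the input, and this is
  where the min-entropy of X enters. Both codes thus come from one lemma with a weight
  \<open>w\<close> (0 or 1) on secrecy.

  Entropies are used only through witnesses for numbers strictly below Hmin or above Hmax. Large eps
  is treated apart: for eps >= 1/2 the smoothing radius of the converses reaches 1 and their
  right-hand sides are infinite; an admissible error of at least 1 makes the capacity
  infinite.\<close>

declare index_mult_mat(1) [simp del] index_mult_mat_vec [simp del]

section \<open>Complex matrices\<close>

definition rtr :: "complex mat \<Rightarrow> real" where
  "rtr A = Re (mtrace A)"

definition ip :: "complex vec \<Rightarrow> complex vec \<Rightarrow> complex" where
  "ip v w = (\<Sum>i<dim_vec w. cnj (v $ i) * w $ i)"

definition herm :: "nat \<Rightarrow> complex mat \<Rightarrow> bool" where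
  "herm d A \<longleftrightarrow> A \<in> carrier_mat d d \<and> adj A = A"

lemma adj_carrier [simp]: "A \<in> carrier_mat m n \<Longrightarrow> adj A \<in> carrier_mat n m"
  by (auto simp: adj_def)

lemma adj_dim [simp]: "dim_row (adj A) = dim_col A" "dim_col (adj A) = dim_row A"
  by (auto simp: adj_def)

lemma mult_square_carrier [simp]:
  "A \<in> carrier_mat d d \<Longrightarrow> B \<in> carrier_mat d d \<Longrightarrow> A * B \<in> carrier_mat d d"
  by (rule mult_carrier_mat)

lemma minus_square_carrier [simp]:
  "A \<in> carrier_mat d d \<Longrightarrow> B \<in> carrier_mat d d \<Longrightarrow> A - B \<in> carrier_mat d d"
  by (rule minus_carrier_mat)

lemma add_square_carrier [simp]:
  "A \<in> carrier_mat d d \<Longrightarrow> B \<in> carrier_mat d d \<Longrightarrow> A + B \<in> carrier_mat d d"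
  by (rule add_carrier_mat)

lemma mult_square_vec_carrier [simp]:
  "A \<in> carrier_mat d d \<Longrightarrow> v \<in> carrier_vec d \<Longrightarrow> A *\<^sub>v v \<in> carrier_vec d"
  by (rule mult_mat_vec_carrier)

lemma assoc_square:
  "A \<in> carrier_mat d d \<Longrightarrow> B \<in> carrier_mat d d \<Longrightarrow> C \<in> carrier_mat d d \<Longrightarrow>
   A * B * C = A * (B * C)"
  by (rule assoc_mult_mat)

lemma one_mult_square [simp]:
  fixes A :: "complex mat"
  assumes "A \<in> carrier_mat d d"
  shows "1\<^sub>m d * A = A" "A * 1\<^sub>m d = A"
  using assms by (rule left_mult_one_mat) (rule right_mult_one_mat[OF assms])

lemma mult_minus_square:
  fixes A B C :: "complex mat"
  shows "A \<in> carrier_mat d d \<Longrightarrow> B \<in> carrier_mat d d \<Longrightarrow> C \<in> carrier_mat d d \<Longrightarrow> A * (B - C) = A * B - A * C"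
    "A \<in> carrier_mat d d \<Longrightarrow> B \<in> carrier_mat d d \<Longrightarrow> C \<in> carrier_mat d d \<Longrightarrow> (A - B) * C = A * C - B * C"
  by (auto intro: mult_minus_distrib_mat minus_mult_distrib_mat)

lemma mult_add_square:
  fixes A B C :: "complex mat"
  shows "A \<in> carrier_mat d d \<Longrightarrow> B \<in> carrier_mat d d \<Longrightarrow> C \<in> carrier_mat d d \<Longrightarrow> A * (B + C) = A * B + A * C"
    "A \<in> carrier_mat d d \<Longrightarrow> B \<in> carrier_mat d d \<Longrightarrow> C \<in> carrier_mat d d \<Longrightarrow> (A + B) * C = A * C + B * C"
  by (auto intro: mult_add_distrib_mat add_mult_distrib_mat)

lemma adj_index: "A \<in> carrier_mat m n \<Longrightarrow> i < n \<Longrightarrow> j < m \<Longrightarrow> adj A $$ (i, j) = cnj (A $$ (j, i))"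
  by (auto simp: adj_def)

lemma mult_index:
  "A \<in> carrier_mat m n \<Longrightarrow> B \<in> carrier_mat n l \<Longrightarrow> i < m \<Longrightarrow> j < l \<Longrightarrow>
   (A * B) $$ (i, j) = (\<Sum>k<n. A $$ (i, k) * B $$ (k, j))"
  by (auto simp: scalar_prod_def atLeast0LessThan index_mult_mat index_mult_mat_vec intro!: sum.cong)

lemma mult_vec_index:
  "A \<in> carrier_mat m n \<Longrightarrow> v \<in> carrier_vec n \<Longrightarrow> i < m \<Longrightarrow>
   (A *\<^sub>v v) $ i = (\<Sum>k<n. A $$ (i, k) * v $ k)"
  by (auto simp: scalar_prod_def atLeast0LessThan index_mult_mat index_mult_mat_vec intro!: sum.cong)

lemma adj_adj [simp]: "adj (adj A) = A"
  by (rule eq_matI) (auto simp: adj_def)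

lemma adj_mult:
  assumes "A \<in> carrier_mat m n" "B \<in> carrier_mat n l"
  shows "adj (A * B) = adj B * adj A"
proof (rule eq_matI)
  fix i j assume "i < dim_row (adj B * adj A)" "j < dim_col (adj B * adj A)"
  then have ij: "i < l" "j < m" using assms by (auto simp: adj_def)
  have "adj (A * B) $$ (i, j) = cnj ((A * B) $$ (j, i))"
    using ij assms by (auto simp: adj_index[of _ m l])
  also have "\<dots> = (\<Sum>k<n. cnj (A $$ (j, k)) * cnj (B $$ (k, i)))"
    using ij assms by (simp add: mult_index[of _ m n])
  also have "\<dots> = (adj B * adj A) $$ (i, j)"
    using ij assms by (subst mult_index[of _ l n _ m]) (auto simp: adj_index[of A m n] adj_index[of B n l] intro!: sum.cong)
  finally show "adj (A * B) $$ (i, j) = (adj B * adj A) $$ (i, j)" .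
qed (use assms in \<open>auto simp: adj_def\<close>)

lemma adj_add: "A \<in> carrier_mat m n \<Longrightarrow> B \<in> carrier_mat m n \<Longrightarrow> adj (A + B) = adj A + adj B"
  by (rule eq_matI) (auto simp: adj_def)

lemma adj_minus: "A \<in> carrier_mat m n \<Longrightarrow> B \<in> carrier_mat m n \<Longrightarrow> adj (A - B) = adj A - adj B"
  by (rule eq_matI) (auto simp: adj_def)

lemma adj_smult [simp]: "adj (c \<cdot>\<^sub>m A) = cnj c \<cdot>\<^sub>m adj A"
  by (rule eq_matI) (auto simp: adj_def)

lemma adj_one [simp]: "adj (1\<^sub>m d) = 1\<^sub>m d"
  by (rule eq_matI) (auto simp: adj_def)

lemma adj_zero [simp]: "adj (0\<^sub>m m n) = 0\<^sub>m n m"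
  by (rule eq_matI) (auto simp: adj_def)

lemma adj_diag [simp]: "adj (mat_diag d (\<lambda>i. complex_of_real (f i))) = mat_diag d (\<lambda>i. complex_of_real (f i))"
  by (rule eq_matI) (auto simp: adj_def mat_diag_def)

lemma mtrace_eq: "A \<in> carrier_mat d n \<Longrightarrow> mtrace A = (\<Sum>i<d. A $$ (i, i))"
  by (auto simp: mtrace_def)

lemma mtrace_mult_comm:
  assumes "A \<in> carrier_mat m n" "B \<in> carrier_mat n m"
  shows "mtrace (A * B) = mtrace (B * A)"
proof -
  have "mtrace (A * B) = (\<Sum>i<m. \<Sum>k<n. A $$ (i, k) * B $$ (k, i))"
    using assms by (simp add: mtrace_eq[of _ m m] mult_index[of _ m n])
  also have "\<dots> = (\<Sum>k<n. \<Sum>i<m. B $$ (k, i) * A $$ (i, k))"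
    by (subst sum.swap) (simp add: mult.commute)
  also have "\<dots> = mtrace (B * A)"
    using assms by (simp add: mtrace_eq[of _ n n] mult_index[of _ n m])
  finally show ?thesis .
qed

lemma rtr_mult_comm:
  "A \<in> carrier_mat d d \<Longrightarrow> B \<in> carrier_mat d d \<Longrightarrow> rtr (A * B) = rtr (B * A)"
  unfolding rtr_def by (simp add: mtrace_mult_comm)

lemma rtr_add: "A \<in> carrier_mat d d \<Longrightarrow> B \<in> carrier_mat d d \<Longrightarrow> rtr (A + B) = rtr A + rtr B"
  by (simp add: rtr_def mtrace_eq[of _ d d] sum.distrib)

lemma rtr_minus: "A \<in> carrier_mat d d \<Longrightarrow> B \<in> carrier_mat d d \<Longrightarrow> rtr (A - B) = rtr A - rtr B"
  using minus_carrier_mat[of B d d A] by (simp add: rtr_def mtrace_eq[of _ d d] sum_subtractf)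

lemma rtr_smult: "A \<in> carrier_mat d d \<Longrightarrow> rtr (complex_of_real c \<cdot>\<^sub>m A) = c * rtr A"
  by (simp add: rtr_def mtrace_eq[of _ d d] sum_distrib_left)

lemma rtr_adj: "A \<in> carrier_mat d d \<Longrightarrow> rtr (adj A) = rtr A"
  by (simp add: rtr_def mtrace_eq[of _ d d] adj_index[of _ d d])

lemma rtr_one [simp]: "rtr (1\<^sub>m d) = real d"
  by (simp add: rtr_def mtrace_eq[of _ d d])

lemma rtr_zero [simp]: "rtr (0\<^sub>m d d) = 0"
  by (simp add: rtr_def mtrace_eq[of _ d d])

section \<open>Inner products and quadratic forms\<close>

lemma ip_adj:
  assumes "A \<in> carrier_mat m n" "v \<in> carrier_vec m" "w \<in> carrier_vec n"
  shows "ip v (A *\<^sub>v w) = ip (adj A *\<^sub>v v) w"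
proof -
  have "ip v (A *\<^sub>v w) = (\<Sum>i<m. \<Sum>k<n. cnj (v $ i) * (A $$ (i, k) * w $ k))"
    using assms by (simp add: ip_def mult_vec_index[of _ m n] sum_distrib_left)
  also have "\<dots> = (\<Sum>k<n. \<Sum>i<m. cnj (v $ i) * (A $$ (i, k) * w $ k))"
    by (rule sum.swap)
  also have "\<dots> = ip (adj A *\<^sub>v v) w"
  proof -
    have "(\<Sum>i<m. cnj (v $ i) * (A $$ (i, k) * w $ k)) = cnj ((adj A *\<^sub>v v) $ k) * w $ k" if "k < n" for k
      using assms that by (simp add: mult_vec_index[of _ n m] adj_index[of _ m n] sum_distrib_right mult.assoc mult.left_commute)
    then show ?thesis using assms by (simp add: ip_def)
  qed
  finally show ?thesis .
qed

lemma ip_cnj: "dim_vec v = dim_vec w \<Longrightarrow> cnj (ip v w) = ip w v"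
  by (simp add: ip_def mult.commute)

lemma ip_self: "ip v v = complex_of_real (\<Sum>i<dim_vec v. (cmod (v $ i))\<^sup>2)"
  unfolding ip_def of_real_sum by (intro sum.cong) (simp_all add: complex_norm_square mult.commute del: of_real_power)

lemma ip_add_right: "v \<in> carrier_vec d \<Longrightarrow> w \<in> carrier_vec d \<Longrightarrow> u \<in> carrier_vec d \<Longrightarrow>
   ip u (v + w) = ip u v + ip u w"
  by (simp add: ip_def algebra_simps sum.distrib)

lemma ip_add_left: "v \<in> carrier_vec d \<Longrightarrow> w \<in> carrier_vec d \<Longrightarrow> u \<in> carrier_vec d \<Longrightarrow>
   ip (v + w) u = ip v u + ip w u"
  by (simp add: ip_def algebra_simps sum.distrib)

lemma ip_smult_right: "v \<in> carrier_vec d \<Longrightarrow> ip u (c \<cdot>\<^sub>v v) = c * ip u v"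
  by (simp add: ip_def algebra_simps sum_distrib_left)

lemma ip_smult_left: "v \<in> carrier_vec d \<Longrightarrow> u \<in> carrier_vec d \<Longrightarrow> ip (c \<cdot>\<^sub>v u) v = cnj c * ip u v"
  by (simp add: ip_def algebra_simps sum_distrib_left)

lemma psd_def': "psd d A \<longleftrightarrow> A \<in> carrier_mat d d \<and>
     (\<forall>v \<in> carrier_vec d. Im (ip v (A *\<^sub>v v)) = 0 \<and> Re (ip v (A *\<^sub>v v)) \<ge> 0)"
  unfolding psd_def ip_def Let_def by auto

lemma psd_carrier [simp]: "psd d A \<Longrightarrow> A \<in> carrier_mat d d"
  by (simp add: psd_def)

lemma herm_carrier [simp]: "herm d A \<Longrightarrow> A \<in> carrier_mat d d"
  by (simp add: herm_def)

lemma ip_unit_vec: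
  assumes "i < d" "w \<in> carrier_vec d"
  shows "ip (unit_vec d i) w = w $ i"
proof -
  have "ip (unit_vec d i) w = (\<Sum>k<d. if k = i then w $ i else 0)"
    using assms unfolding ip_def by (intro sum.cong) auto
  then show ?thesis using assms by simp
qed

lemma mult_unit_vec_index:
  fixes A :: "complex mat"
  assumes "A \<in> carrier_mat d d" "i < d" "j < d"
  shows "(A *\<^sub>v unit_vec d j) $ i = A $$ (i, j)"
proof -
  have "A $$ (i, k) * unit_vec d j $ k = (if k = j then A $$ (i, j) else 0)" if "k < d" for k
    using assms that by (cases "k = j") simp_all
  then have "(A *\<^sub>v unit_vec d j) $ i = (\<Sum>k<d. if k = j then A $$ (i, j) else 0)"
    unfolding mult_vec_index[OF assms(1) unit_vec_carrier assms(2)] by (intro sum.cong) simp_all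
  then show ?thesis using assms by simp
qed

lemma ip_unit_mult_unit:
  assumes "A \<in> carrier_mat d d" "i < d" "j < d"
  shows "ip (unit_vec d i) (A *\<^sub>v unit_vec d j) = A $$ (i, j)"
  using mult_mat_vec_carrier[OF assms(1), of "unit_vec d j"] by (simp add: ip_unit_vec[OF assms(2)] mult_unit_vec_index[OF assms])

text \<open>Polarization: the quadratic form is real at every vector \<open>u + c w\<close>. The
  choices c = 1 and c = i then determine the imaginary and the real parts of the off-diagonal
  entries.\<close>

lemma psd_herm:
  assumes "psd d A"
  shows "herm d A"
proof -
  have A: "A \<in> carrier_mat d d" using assms by simp
  have im: "Im (ip v (A *\<^sub>v v)) = 0" if "v \<in> carrier_vec d" for v
    using assms that by (simp add: psd_def')
  have "adj A = A"
  proof (rule eq_matI)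
    fix i j assume "i < dim_row A" "j < dim_col A"
    then have ij: "i < d" "j < d" using A by auto
    let ?u = "unit_vec d i" and ?w = "unit_vec d j"
    have polar: "Im (c * A $$ (i, j) + cnj c * A $$ (j, i)) = 0" for c
    proof -
      let ?v = "?u + c \<cdot>\<^sub>v ?w"
      have "ip ?v (A *\<^sub>v ?v) = ip ?u (A *\<^sub>v ?u) + c * A $$ (i, j) + cnj c * A $$ (j, i)
          + cnj c * c * ip ?w (A *\<^sub>v ?w)"
      proof -
        have "A *\<^sub>v ?v = A *\<^sub>v ?u + c \<cdot>\<^sub>v (A *\<^sub>v ?w)"
          using A by (simp add: mult_add_distrib_mat_vec[OF A] mult_mat_vec[OF A])
        then show ?thesis
          using A ij
          by (simp add: ip_add_right[of _ d] ip_add_left[of _ d]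
            ip_smult_right[of _ d] ip_smult_left[of _ d] ip_unit_mult_unit[OF A] distrib_left mult.assoc)
      qed
      moreover have "cnj c * c = complex_of_real ((cmod c)\<^sup>2)"
        by (simp add: complex_norm_square mult.commute del: of_real_power)
      ultimately have "Im (ip ?v (A *\<^sub>v ?v)) = Im (ip ?u (A *\<^sub>v ?u)) + Im (c * A $$ (i, j) + cnj c * A $$ (j, i))
          + (cmod c)\<^sup>2 * Im (ip ?w (A *\<^sub>v ?w))"
        by (simp del: of_real_power)
      then show ?thesis using im[of ?u] im[of ?v] im[of ?w] by simp
    qed
    have "Im (A $$ (i, j)) = - Im (A $$ (j, i))" using polar[of 1] by simp
    moreover have "Re (A $$ (i, j)) = Re (A $$ (j, i))" using polar[of \<i>] by simp
    ultimately have "cnj (A $$ (j, i)) = A $$ (i, j)" by (simp add: complex_eq_iff)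
    then show "adj A $$ (i, j) = A $$ (i, j)" using A ij by (simp add: adj_index[of _ d d])
  qed (use A in \<open>auto simp: adj_def\<close>)
  then show ?thesis using A by (simp add: herm_def)
qed

lemma herm_ip_real: "herm d A \<Longrightarrow> v \<in> carrier_vec d \<Longrightarrow> Im (ip v (A *\<^sub>v v)) = 0"
proof -
  assume h: "herm d A" and v: "v \<in> carrier_vec d"
  then have A: "A \<in> carrier_mat d d" "adj A = A" by (auto simp: herm_def)
  have "cnj (ip v (A *\<^sub>v v)) = ip (A *\<^sub>v v) v" using A v by (intro ip_cnj) auto
  also have "\<dots> = ip v (A *\<^sub>v v)" using ip_adj[OF A(1) v v] A by simp
  finally show ?thesis by (simp add: complex_eq_iff)
qed

lemma psd_iff: "psd d A \<longleftrightarrow> herm d A \<and> (\<forall>v \<in> carrier_vec d. Re (ip v (A *\<^sub>v v)) \<ge> 0)"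
proof
  assume a: "psd d A"
  show "herm d A \<and> (\<forall>v \<in> carrier_vec d. Re (ip v (A *\<^sub>v v)) \<ge> 0)"
    using psd_herm[OF a] a[unfolded psd_def'] by blast
next
  assume a: "herm d A \<and> (\<forall>v \<in> carrier_vec d. Re (ip v (A *\<^sub>v v)) \<ge> 0)"
  then show "psd d A" unfolding psd_def' using herm_ip_real[of d A] by (auto intro: herm_carrier)
qed

section \<open>Spectral theorem and functional calculus\<close>

definition unitary_mat :: "nat \<Rightarrow> complex mat \<Rightarrow> bool" where
  "unitary_mat d U \<longleftrightarrow> U \<in> carrier_mat d d \<and> adj U * U = 1\<^sub>m d \<and> U * adj U = 1\<^sub>m d"

lemma unitary_matI: "U \<in> carrier_mat d d \<Longrightarrow> adj U * U = 1\<^sub>m d \<Longrightarrow> unitary_mat d U"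
  using mat_mult_left_right_inverse[of "adj U" d U] by (simp add: unitary_mat_def)

lemma unitary_mat_mult:
  assumes "unitary_mat d U" "unitary_mat d V"
  shows "unitary_mat d (U * V)"
proof -
  have c: "U \<in> carrier_mat d d" "V \<in> carrier_mat d d" and "adj U * U = 1\<^sub>m d" "adj V * V = 1\<^sub>m d"
    using assms by (auto simp: unitary_mat_def)
  have "adj (U * V) * (U * V) = adj V * ((adj U * U) * V)"
    using c by (simp add: adj_mult[of _ d d] assoc_square[of _ d])
  then have "adj (U * V) * (U * V) = 1\<^sub>m d"
    using c \<open>adj U * U = 1\<^sub>m d\<close> \<open>adj V * V = 1\<^sub>m d\<close> by simp
  then show ?thesis using c by (intro unitary_matI) auto
qed

text \<open>Gram-Schmidt, normalized, on a basis that begins with \<open>v\<close>. This is the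
  change of basis by which the spectral theorem splits off an eigenvector.\<close>

lemma unitary_with_first_column:
  fixes v :: "complex vec"
  assumes v: "v \<in> carrier_vec n" and v0: "v \<noteq> 0\<^sub>v n" and n: "0 < n"
  shows "\<exists>U c. unitary_mat n U \<and> U *\<^sub>v unit_vec n 0 = c \<cdot>\<^sub>v v"
proof -
  interpret cof_vec_space n "TYPE(complex)" .
  define b where "b = basis_completion v"
  define ws where "ws = gram_schmidt n b"
  from basis_completion[OF v v0, folded b_def]
  have span_b: "span (set b) = carrier_vec n" and dist_b: "distinct b"
    and indep: "\<not> lin_dep (set b)" and b: "set b \<subseteq> carrier_vec n" and hdb: "hd b = v"
    and len_b: "length b = n" by auto
  from hdb len_b n obtain vs where bv: "b = v # vs" by (cases b, auto)
  from gram_schmidt_result[OF b dist_b indep refl, folded ws_def]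
  have ws: "set ws \<subseteq> carrier_vec n" "corthogonal ws" "length ws = n"
    by (auto simp: len_b)
  from gram_schmidt_hd[OF v, of vs, folded bv] have "hd ws = v" unfolding ws_def .
  then have ws0: "ws ! 0 = v" using ws(3) n by (metis hd_conv_nth length_greater_0_conv)
  have wc: "ws ! j \<in> carrier_vec n" if "j < n" for j using ws that by (metis nth_mem subset_code(1))
  define r where "r j = sqrt (\<Sum>i<n. (cmod (ws ! j $ i))\<^sup>2)" for j
  have orth: "(\<Sum>k<n. cnj (ws ! i $ k) * ws ! j $ k) = (if i = j then complex_of_real ((r j)\<^sup>2) else 0)"
    if "i < n" "j < n" for i j
  proof (cases "i = j")
    case True
    have "(\<Sum>k<n. cnj (ws ! j $ k) * ws ! j $ k) = complex_of_real (\<Sum>k<n. (cmod (ws ! j $ k))\<^sup>2)"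
      using ip_self[of "ws ! j"] wc[OF that(2)] by (simp add: ip_def)
    then show ?thesis using True by (simp add: r_def sum_nonneg)
  next
    case False
    have "ws ! j \<bullet>c ws ! i = 0" using corthogonalD[OF ws(2)] that ws(3) False by metis
    then show ?thesis using False wc[OF that(1)] wc[OF that(2)]
      by (simp add: scalar_prod_def atLeast0LessThan mult.commute)
  qed
  have rpos: "r j \<noteq> 0" if "j < n" for j
  proof
    assume "r j = 0"
    then have "(\<Sum>k<n. cnj (ws ! j $ k) * ws ! j $ k) = 0" using orth[OF that that] by simp
    then have "ws ! j \<bullet>c ws ! j = 0" using wc[OF that]
      by (simp add: scalar_prod_def atLeast0LessThan mult.commute)
    then show False using corthogonalD[OF ws(2), of j j] that ws(3) by auto
  qed
  define U where "U = mat n n (\<lambda>(i, j). ws ! j $ i / complex_of_real (r j))"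
  have U: "U \<in> carrier_mat n n" by (simp add: U_def)
  have "adj U * U = 1\<^sub>m n"
  proof (rule eq_matI)
    fix i j assume "i < dim_row (1\<^sub>m n :: complex mat)" "j < dim_col (1\<^sub>m n :: complex mat)"
    then have ij: "i < n" "j < n" by auto
    have "(adj U * U) $$ (i, j) = (\<Sum>k<n. cnj (U $$ (k, i)) * U $$ (k, j))"
      using U ij by (subst mult_index[of _ n n _ n]) (auto simp: adj_index[of U n n])
    also have "\<dots> = (\<Sum>k<n. cnj (ws ! i $ k) * ws ! j $ k) / complex_of_real (r i * r j)"
      unfolding sum_divide_distrib using ij by (intro sum.cong) (auto simp: U_def)
    also have "\<dots> = 1\<^sub>m n $$ (i, j)"
      using ij rpos[of i] orth[OF ij] by (auto simp: power2_eq_square)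
    finally show "(adj U * U) $$ (i, j) = 1\<^sub>m n $$ (i, j)" .
  qed (use U in auto)
  then have "unitary_mat n U" using U by (intro unitary_matI)
  moreover have "U *\<^sub>v unit_vec n 0 = complex_of_real (1 / r 0) \<cdot>\<^sub>v v"
  proof (rule eq_vecI)
    fix i assume "i < dim_vec (complex_of_real (1 / r 0) \<cdot>\<^sub>v v)"
    then have i: "i < n" using v by simp
    show "(U *\<^sub>v unit_vec n 0) $ i = (complex_of_real (1 / r 0) \<cdot>\<^sub>v v) $ i"
      using i n v by (simp add: mult_unit_vec_index[OF U]) (simp add: U_def ws0)
  qed (use U v in simp)
  ultimately show ?thesis by blast
qed

text \<open>The direct sum of the scalar \<open>a\<close> and the block \<open>X\<close>; the
  induction of the spectral theorem passes through it from size m to size m + 1.\<close>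

definition bordered :: "nat \<Rightarrow> complex \<Rightarrow> complex mat \<Rightarrow> complex mat" where
  "bordered m a X = mat (Suc m) (Suc m) (\<lambda>(i, j). if i = 0 \<and> j = 0 then a
     else if i = 0 \<or> j = 0 then 0 else X $$ (i - 1, j - 1))"

lemma bordered_carrier [simp]: "bordered m a X \<in> carrier_mat (Suc m) (Suc m)"
  by (simp add: bordered_def)

lemma bordered_mult:
  assumes "X \<in> carrier_mat m m" "Y \<in> carrier_mat m m"
  shows "bordered m a X * bordered m b Y = bordered m (a * b) (X * Y)"
proof (rule eq_matI)
  fix i j assume "i < dim_row (bordered m (a * b) (X * Y))" "j < dim_col (bordered m (a * b) (X * Y))"
  then have ij: "i < Suc m" "j < Suc m" by (auto simp: bordered_def)
  show "(bordered m a X * bordered m b Y) $$ (i, j) = bordered m (a * b) (X * Y) $$ (i, j)"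
    using ij assms
    by (cases i; cases j) (auto simp: mult_index[of _ "Suc m" "Suc m" _ "Suc m"] sum.lessThan_Suc_shift
        mult_index[of X m m Y m] bordered_def simp del: sum.lessThan_Suc)
qed (auto simp: bordered_def)

lemma bordered_adj: "X \<in> carrier_mat m m \<Longrightarrow> adj (bordered m a X) = bordered m (cnj a) (adj X)"
  by (rule eq_matI) (auto simp: adj_def bordered_def)

lemma bordered_one: "bordered m 1 (1\<^sub>m m) = 1\<^sub>m (Suc m)"
  by (rule eq_matI) (auto simp: bordered_def)

lemma bordered_diag:
  "bordered m a (mat_diag m f) = mat_diag (Suc m) (\<lambda>i. if i = 0 then a else f (i - 1))"
  by (rule eq_matI) (auto simp: bordered_def mat_diag_def)

text \<open>Deflation: in an orthonormal basis that starts with an eigenvector the first column is a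
  multiple of the first unit vector. By hermiticity so is the first row, and the eigenvalue is real;
  the matrix is a direct sum and the induction hypothesis diagonalizes the other block.\<close>

lemma spectral_theorem:
  "herm d A \<Longrightarrow> \<exists>U l. unitary_mat d U \<and> A = U * mat_diag d (\<lambda>i. complex_of_real (l i)) * adj U"
proof (induction d arbitrary: A)
  case 0
  have "A = 1\<^sub>m 0 * mat_diag 0 (\<lambda>i. complex_of_real (l i)) * adj (1\<^sub>m 0)" for l
    using herm_carrier[OF 0] by (intro eq_matI) (auto simp: mat_diag_def)
  moreover have "unitary_mat 0 (1\<^sub>m 0)" by (intro unitary_matI) auto
  ultimately show ?case by blast
next
  case (Suc m)
  let ?n = "Suc m"
  have A: "A \<in> carrier_mat ?n ?n" "adj A = A" using Suc.prems by (auto simp: herm_def)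
  from spectrum_non_empty[OF A(1)] obtain e where "eigenvalue A e" by (auto simp: spectrum_def)
  then obtain v where v: "v \<in> carrier_vec ?n" "v \<noteq> 0\<^sub>v ?n" "A *\<^sub>v v = e \<cdot>\<^sub>v v"
    using A by (auto simp: eigenvalue_def eigenvector_def)
  obtain U c where U: "unitary_mat ?n U" "U *\<^sub>v unit_vec ?n 0 = c \<cdot>\<^sub>v v"
    using unitary_with_first_column[OF v(1,2)] by auto
  have Uc: "U \<in> carrier_mat ?n ?n" "adj U * U = 1\<^sub>m ?n" "U * adj U = 1\<^sub>m ?n"
    using U(1) by (auto simp: unitary_mat_def)
  define A' where "A' = adj U * A * U"
  have A'c: "A' \<in> carrier_mat ?n ?n" using A Uc by (simp add: A'_def)
  have A'h: "adj A' = A'"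
    using A Uc by (simp add: A'_def adj_mult[of _ ?n ?n _ ?n] assoc_square[of _ ?n])
  have A'0: "A' *\<^sub>v unit_vec ?n 0 = e \<cdot>\<^sub>v unit_vec ?n 0"
  proof -
    have "A' *\<^sub>v unit_vec ?n 0 = adj U *\<^sub>v (A *\<^sub>v (U *\<^sub>v unit_vec ?n 0))"
      using A Uc by (simp add: A'_def assoc_mult_mat_vec[of _ ?n ?n _ ?n])
    also have "\<dots> = adj U *\<^sub>v (e \<cdot>\<^sub>v (U *\<^sub>v unit_vec ?n 0))"
      using v A by (simp add: U(2) mult_mat_vec[OF A(1)] smult_smult_assoc mult.commute)
    also have "\<dots> = e \<cdot>\<^sub>v ((adj U * U) *\<^sub>v unit_vec ?n 0)"
      using Uc(1) by (simp add: mult_mat_vec[of _ ?n ?n] assoc_mult_mat_vec[of _ ?n ?n _ ?n] del: Uc(2))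
    finally show ?thesis using Uc by simp
  qed
  have col0: "A' $$ (i, 0) = (if i = 0 then e else 0)" if "i < ?n" for i
  proof -
    have "A' $$ (i, 0) = (e \<cdot>\<^sub>v unit_vec ?n 0) $ i"
      using that mult_unit_vec_index[OF A'c that, of 0] A'0 by simp
    then show ?thesis using that by simp
  qed
  have row0: "A' $$ (0, j) = (if j = 0 then cnj e else 0)" if "j < ?n" for j
  proof -
    have "A' $$ (0, j) = adj A' $$ (0, j)" by (simp add: A'h)
    also have "\<dots> = cnj (A' $$ (j, 0))" using A'c that by (simp add: adj_index[of A' ?n ?n])
    finally show ?thesis using col0[OF that] by simp
  qed
  have ereal: "e = complex_of_real (Re e)" using row0[of 0] col0[of 0] by (simp add: complex_eq_iff)
  define X where "X = mat m m (\<lambda>(i, j). A' $$ (Suc i, Suc j))"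
  have X: "X \<in> carrier_mat m m" by (simp add: X_def)
  have A'X: "A' = bordered m e X"
    using A'c col0 row0[unfolded] ereal
    by (intro eq_matI) (auto simp: bordered_def X_def)
  have "herm m X"
  proof -
    have "adj X $$ (i, j) = X $$ (i, j)" if "i < m" "j < m" for i j
    proof -
      have "adj X $$ (i, j) = adj A' $$ (Suc i, Suc j)"
        using that A'c X by (simp add: adj_index[of A' ?n ?n] adj_index[of X m m]) (simp add: X_def)
      then show ?thesis using that by (simp add: A'h X_def)
    qed
    then have "adj X = X" using X by (intro eq_matI) (auto simp: adj_def)
    then show ?thesis using X by (simp add: herm_def)
  qed
  from Suc.IH[OF this] obtain W l where W: "unitary_mat m W"
    and XW: "X = W * mat_diag m (\<lambda>i. complex_of_real (l i)) * adj W" by blast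
  have Wc: "W \<in> carrier_mat m m" "adj W * W = 1\<^sub>m m" using W by (auto simp: unitary_mat_def)
  define V where "V = bordered m 1 W"
  define l' where "l' i = (if i = 0 then Re e else l (i - 1))" for i
  have Vc: "V \<in> carrier_mat ?n ?n" by (simp add: V_def)
  have V: "unitary_mat ?n V"
    using Wc by (intro unitary_matI) (auto simp: V_def bordered_adj bordered_mult bordered_one)
  let ?D = "mat_diag ?n (\<lambda>i. complex_of_real (l' i))"
  have D: "?D = bordered m e (mat_diag m (\<lambda>i. complex_of_real (l i)))"
    unfolding bordered_diag using ereal by (intro eq_matI) (auto simp: mat_diag_def l'_def)
  have "A' = V * ?D * adj V"
    unfolding A'X XW D V_def using Wc by (simp add: bordered_adj bordered_mult)
  moreover have "A = U * A' * adj U"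
  proof -
    have "U * A' * adj U = (U * adj U) * A * (U * adj U)"
      using A Uc(1) by (simp add: A'_def assoc_square[of _ ?n])
    then show ?thesis using A Uc by simp
  qed
  ultimately have "A = (U * V) * ?D * adj (U * V)"
    using Uc(1) Vc by (simp add: adj_mult[of _ ?n ?n _ ?n] assoc_square[of _ ?n])
  then show ?case using unitary_mat_mult[OF U(1) V] by blast
qed

text \<open>One eigendecomposition is chosen per matrix, so that all functions
  \<open>fc d A f\<close> of the same \<open>A\<close> are diagonal in one basis. Their algebra then
  reduces to that of real functions on the eigenvalues; every root, projection and inverse below is
  such a function.\<close>

definition eigsys :: "nat \<Rightarrow> complex mat \<Rightarrow> complex mat \<times> (nat \<Rightarrow> real)" where
  "eigsys d A = (SOME (U, l). unitary_mat d U \<and> A = U * mat_diag d (\<lambda>i. complex_of_real (l i)) * adj U)"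

definition eigs :: "nat \<Rightarrow> complex mat \<Rightarrow> nat \<Rightarrow> real" where
  "eigs d A = snd (eigsys d A)"

definition fc :: "nat \<Rightarrow> complex mat \<Rightarrow> (real \<Rightarrow> real) \<Rightarrow> complex mat" where
  "fc d A f = fst (eigsys d A) * mat_diag d (\<lambda>i. complex_of_real (f (eigs d A i))) * adj (fst (eigsys d A))"

lemma eigsys:
  assumes "herm d A"
  shows "unitary_mat d (fst (eigsys d A))" "fc d A (\<lambda>x. x) = A"
proof -
  have "\<exists>p. (\<lambda>(U, l). unitary_mat d U \<and> A = U * mat_diag d (\<lambda>i. complex_of_real (l i)) * adj U) p"
    using spectral_theorem[OF assms] by simp
  from someI_ex[OF this]
  have "case eigsys d A of (U, l) \<Rightarrow> unitary_mat d U \<and> A = U * mat_diag d (\<lambda>i. complex_of_real (l i)) * adj U"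
    by (simp add: eigsys_def)
  then show "unitary_mat d (fst (eigsys d A))" "fc d A (\<lambda>x. x) = A"
    by (auto simp: fc_def eigs_def split: prod.splits)
qed

lemma fc_facts:
  assumes "herm d A"
  shows fc_carrier: "fc d A f \<in> carrier_mat d d"
    and fc_adj: "adj (fc d A f) = fc d A f"
    and fc_mult: "fc d A f * fc d A g = fc d A (\<lambda>x. f x * g x)"
    and fc_add: "fc d A f + fc d A g = fc d A (\<lambda>x. f x + g x)"
    and fc_minus: "fc d A f - fc d A g = fc d A (\<lambda>x. f x - g x)"
    and fc_one: "fc d A (\<lambda>x. 1) = 1\<^sub>m d"
    and fc_zero: "fc d A (\<lambda>x. 0) = 0\<^sub>m d d"
    and fc_rtr: "rtr (fc d A f) = (\<Sum>i<d. f (eigs d A i))"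
proof -
  define U where "U = fst (eigsys d A)"
  have U: "U \<in> carrier_mat d d" "adj U * U = 1\<^sub>m d" "U * adj U = 1\<^sub>m d"
    using eigsys(1)[OF assms] by (auto simp: unitary_mat_def U_def)
  define D where "D f = mat_diag d (\<lambda>i. complex_of_real (f (eigs d A i)))" for f
  have D: "D f \<in> carrier_mat d d" for f by (simp add: D_def)
  have fc: "fc d A f = U * D f * adj U" for f by (simp add: fc_def U_def D_def)
  show c: "fc d A f \<in> carrier_mat d d" for f using U by (simp add: fc D_def)
  show "adj (fc d A f) = fc d A f"
    using U(1) D by (simp add: fc adj_mult[of _ d d _ d] assoc_square[of _ d]) (simp add: D_def)
  have "fc d A f * fc d A g = U * D f * ((adj U * U) * D g * adj U)"
    using U(1) D by (simp add: fc assoc_square[of _ d])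
  also have "\<dots> = U * (D f * D g) * adj U"
    using U D by (simp add: assoc_square[of _ d])
  also have "D f * D g = D (\<lambda>x. f x * g x)" by (simp add: D_def)
  finally show "fc d A f * fc d A g = fc d A (\<lambda>x. f x * g x)" by (simp add: fc)
  have "D (\<lambda>x. f x + g x) = D f + D g" by (rule eq_matI) (auto simp: D_def mat_diag_def)
  then show "fc d A f + fc d A g = fc d A (\<lambda>x. f x + g x)"
    using U(1) D by (simp add: fc mult_add_distrib_mat[of _ d d _ d] add_mult_distrib_mat[of _ d d _ _ d])
  have "D (\<lambda>x. f x - g x) = D f - D g" by (rule eq_matI) (auto simp: D_def mat_diag_def)
  then show "fc d A f - fc d A g = fc d A (\<lambda>x. f x - g x)"
    using U(1) D by (simp add: fc mult_minus_distrib_mat[of _ d d _ d] minus_mult_distrib_mat[of _ d d _ _ d])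
  show "fc d A (\<lambda>x. 1) = 1\<^sub>m d" using U by (simp add: fc D_def)
  have "D (\<lambda>x. 0) = 0\<^sub>m d d" by (rule eq_matI) (auto simp: D_def mat_diag_def)
  then show "fc d A (\<lambda>x. 0) = 0\<^sub>m d d" using U by (simp add: fc left_mult_zero_mat[of _ d d])
  have "rtr (fc d A f) = rtr (adj U * (U * D f))"
    using U(1) D by (simp add: fc rtr_mult_comm[of "U * D f" d "adj U"])
  also have "adj U * (U * D f) = (adj U * U) * D f"
    using U(1) D by (simp add: assoc_square[of _ d])
  also have "rtr \<dots> = (\<Sum>i<d. f (eigs d A i))"
    using U D[of f] by (simp add: rtr_def mtrace_eq[OF D]) (simp add: D_def mat_diag_def)
  finally show "rtr (fc d A f) = (\<Sum>i<d. f (eigs d A i))" .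
qed

lemma fc_cong: "(\<And>i. i < d \<Longrightarrow> f (eigs d A i) = g (eigs d A i)) \<Longrightarrow> fc d A f = fc d A g"
proof -
  assume "\<And>i. i < d \<Longrightarrow> f (eigs d A i) = g (eigs d A i)"
  then have "mat_diag d (\<lambda>i. complex_of_real (f (eigs d A i))) = mat_diag d (\<lambda>i. complex_of_real (g (eigs d A i)))"
    by (intro eq_matI) (auto simp: mat_diag_def)
  then show ?thesis by (simp add: fc_def)
qed

section \<open>Positive semidefinite matrices\<close>

lemma herm_diff: "herm d A \<Longrightarrow> herm d B \<Longrightarrow> herm d (A - B)"
  by (auto simp: herm_def adj_minus[of _ d d])

lemma herm_add: "herm d A \<Longrightarrow> herm d B \<Longrightarrow> herm d (A + B)"
  by (auto simp: herm_def adj_add[of _ d d])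

lemma herm_one [simp]: "herm d (1\<^sub>m d)"
  by (simp add: herm_def)

lemma psd_adj [simp]: "psd d A \<Longrightarrow> adj A = A"
  using psd_herm[of d A] by (simp add: herm_def)

lemma psd_one [simp]: "psd d (1\<^sub>m d)"
  by (simp add: psd_iff) (simp add: ip_self sum_nonneg)

lemma psd_zero [simp]: "psd d (0\<^sub>m d d)"
proof -
  have "0\<^sub>m d d *\<^sub>v v = 0\<^sub>v d" if "v \<in> carrier_vec d" for v :: "complex vec"
    using that by (intro eq_vecI) (auto simp: mult_vec_index[of _ d d])
  then show ?thesis by (simp add: psd_iff herm_def) (simp add: ip_def)
qed

lemma ip_mult_add:
  "A \<in> carrier_mat d d \<Longrightarrow> B \<in> carrier_mat d d \<Longrightarrow> v \<in> carrier_vec d \<Longrightarrow> w \<in> carrier_vec d \<Longrightarrow>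
   ip w ((A + B) *\<^sub>v v) = ip w (A *\<^sub>v v) + ip w (B *\<^sub>v v)"
  by (simp add: add_mult_distrib_mat_vec[of _ d d] ip_add_right[of _ d])

lemma psd_add: "psd d A \<Longrightarrow> psd d B \<Longrightarrow> psd d (A + B)"
  using herm_add[of d A B] by (auto simp: psd_iff ip_mult_add[of _ d])

lemma psd_smult:
  assumes "psd d A" "0 \<le> c" shows "psd d (complex_of_real c \<cdot>\<^sub>m A)"
proof -
  have A: "A \<in> carrier_mat d d" "adj A = A" using assms by auto
  have "(complex_of_real c \<cdot>\<^sub>m A) *\<^sub>v v = complex_of_real c \<cdot>\<^sub>v (A *\<^sub>v v)" if "v \<in> carrier_vec d" for v
    using A that by (intro eq_vecI) (auto simp: mult_vec_index[of _ d d] sum_distrib_left mult.assoc)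
  then have "Re (ip v ((complex_of_real c \<cdot>\<^sub>m A) *\<^sub>v v)) = c * Re (ip v (A *\<^sub>v v))"
    if "v \<in> carrier_vec d" for v
    using A that by (simp add: ip_smult_right[of _ d])
  moreover have "herm d (complex_of_real c \<cdot>\<^sub>m A)" using A by (simp add: herm_def)
  ultimately show ?thesis
    using assms unfolding psd_iff by simp
qed

lemma psd_conj:
  assumes "psd d X" "C \<in> carrier_mat d d"
  shows "psd d (adj C * X * C)"
proof -
  have X: "X \<in> carrier_mat d d" "adj X = X" using assms by auto
  have h: "herm d (adj C * X * C)"
    using X assms by (simp add: herm_def adj_mult[of _ d d _ d] assoc_square[of _ d])
  have "ip v ((adj C * X * C) *\<^sub>v v) = ip (C *\<^sub>v v) (X *\<^sub>v (C *\<^sub>v v))" if "v \<in> carrier_vec d" for v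
    using X assms that by (simp add: assoc_mult_mat_vec[of _ d d _ d] ip_adj[of "adj C" d d])
  then show ?thesis using h assms by (simp add: psd_iff)
qed

lemma psd_adj_mult: "C \<in> carrier_mat d d \<Longrightarrow> psd d (adj C * C)"
  using psd_conj[OF psd_one, of C d] by simp

lemma psd_mult_adj: "C \<in> carrier_mat d d \<Longrightarrow> psd d (C * adj C)"
  using psd_adj_mult[of "adj C" d] by simp

lemma psd_diag_nonneg: "psd d A \<Longrightarrow> i < d \<Longrightarrow> 0 \<le> Re (A $$ (i, i))"
  using ip_unit_mult_unit[of A d i i] unit_vec_carrier[of d i] unfolding psd_def' by metis

lemma psd_rtr_nonneg: "psd d A \<Longrightarrow> 0 \<le> rtr A"
  by (auto simp: rtr_def mtrace_eq[of _ d d] intro!: sum_nonneg psd_diag_nonneg)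

lemma fc_psd_iff:
  assumes "herm d A"
  shows "psd d (fc d A f) \<longleftrightarrow> (\<forall>i<d. 0 \<le> f (eigs d A i))"
proof
  define U where "U = fst (eigsys d A)"
  have U: "U \<in> carrier_mat d d" "adj U * U = 1\<^sub>m d" "U * adj U = 1\<^sub>m d"
    using eigsys(1)[OF assms] by (auto simp: unitary_mat_def U_def)
  define D where "D = mat_diag d (\<lambda>i. complex_of_real (f (eigs d A i)))"
  have D: "D \<in> carrier_mat d d" by (simp add: D_def)
  have fc: "fc d A f = U * D * adj U" by (simp add: fc_def U_def D_def)
  assume "psd d (fc d A f)"
  from psd_conj[OF this U(1)] have "psd d (adj U * (U * D * adj U) * U)" by (simp add: fc)
  also have "adj U * (U * D * adj U) * U = (adj U * U) * D * (adj U * U)"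
    using U(1) D by (simp add: assoc_square[of _ d])
  also have "\<dots> = D" using U D by simp
  finally have "psd d D" .
  show "\<forall>i<d. 0 \<le> f (eigs d A i)"
  proof (intro allI impI)
    fix i assume i: "i < d"
    show "0 \<le> f (eigs d A i)" using psd_diag_nonneg[OF \<open>psd d D\<close> i] i by (simp add: D_def mat_diag_def)
  qed
next
  assume *: "\<forall>i<d. 0 \<le> f (eigs d A i)"
  let ?G = "fc d A (\<lambda>x. sqrt (f x))"
  have "fc d A f = adj ?G * ?G"
    using * by (simp add: fc_facts[OF assms]) (intro fc_cong, simp)
  then show "psd d (fc d A f)" using psd_adj_mult[of ?G d] by (simp add: fc_facts[OF assms])
qed

lemma eigs_nonneg: "psd d A \<Longrightarrow> i < d \<Longrightarrow> 0 \<le> eigs d A i"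
  using fc_psd_iff[of d A "\<lambda>x. x"] eigsys(2)[of d A] psd_herm by auto

lemma psd_root:
  assumes "psd d A"
  shows "psd d (fc d A sqrt)" "fc d A sqrt * fc d A sqrt = A"
proof -
  have h: "herm d A" using assms by (rule psd_herm)
  show "psd d (fc d A sqrt)" using eigs_nonneg[OF assms] by (simp add: fc_psd_iff[OF h])
  have "fc d A sqrt * fc d A sqrt = fc d A (\<lambda>x. x)"
    using eigs_nonneg[OF assms] by (simp add: fc_facts[OF h]) (intro fc_cong, simp)
  then show "fc d A sqrt * fc d A sqrt = A" using eigsys(2)[OF h] by simp
qed

text \<open>By cyclicity this is the trace of the positive matrix obtained by conjugating
  \<open>B\<close> with the root of \<open>A\<close>.\<close>

lemma psd_mult_rtr_nonneg:
  assumes "psd d A" "psd d B" shows "0 \<le> rtr (A * B)"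
proof -
  define X where "X = fc d A sqrt"
  have X: "psd d X" "X * X = A" using psd_root[OF assms(1)] by (auto simp: X_def)
  then have c: "X \<in> carrier_mat d d" "B \<in> carrier_mat d d" using assms by auto
  have "rtr (A * B) = rtr (X * (X * B))" using c by (simp add: X(2)[symmetric] assoc_square[of _ d])
  also have "\<dots> = rtr (adj X * B * X)"
    using c X by (subst rtr_mult_comm[of _ d]) (auto simp: assoc_square[of _ d])
  finally show ?thesis using psd_rtr_nonneg[OF psd_conj[OF assms(2) c(1)]] by simp
qed

lemma rtr_mult_mono:
  assumes "psd d (B - A)" "psd d C" "A \<in> carrier_mat d d" "B \<in> carrier_mat d d"
  shows "rtr (A * C) \<le> rtr (B * C)"
  using psd_mult_rtr_nonneg[OF assms(1,2)] assms
  by (simp add: mult_minus_square[of _ d] rtr_minus[of _ d])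

lemma rtr_adj_mult_eq:
  assumes "A \<in> carrier_mat d d" "B \<in> carrier_mat d d"
  shows "rtr (adj A * B) = (\<Sum>p\<in>{..<d}\<times>{..<d}. Re (cnj (A $$ p) * B $$ p))"
proof -
  have "rtr (adj A * B) = (\<Sum>i<d. \<Sum>k<d. Re (cnj (A $$ (k, i)) * B $$ (k, i)))"
    using assms by (simp add: rtr_def mtrace_eq[of _ d d] mult_index[of _ d d _ d] adj_index[of _ d d])
  also have "\<dots> = (\<Sum>k<d. \<Sum>i<d. Re (cnj (A $$ (k, i)) * B $$ (k, i)))"
    by (rule sum.swap)
  finally show ?thesis by (simp add: sum.cartesian_product)
qed

lemma rtr_adj_mult_self:
  assumes "A \<in> carrier_mat d d"
  shows "rtr (adj A * A) = (\<Sum>p\<in>{..<d}\<times>{..<d}. (cmod (A $$ p))\<^sup>2)"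
  unfolding rtr_adj_mult_eq[OF assms assms] by (intro sum.cong refl) (simp only: cmod_power2, simp add: power2_eq_square)

lemma rtr_adj_mult_self_nonneg: "A \<in> carrier_mat d d \<Longrightarrow> 0 \<le> rtr (adj A * A)"
  by (simp add: rtr_adj_mult_self sum_nonneg)

lemma rtr_adj_mult_self_zero:
  assumes "A \<in> carrier_mat d d" "rtr (adj A * A) = 0"
  shows "A = 0\<^sub>m d d"
proof (rule eq_matI)
  fix i j assume "i < dim_row (0\<^sub>m d d)" "j < dim_col (0\<^sub>m d d)"
  then have "(i, j) \<in> {..<d} \<times> {..<d}" "i < d" "j < d" by auto
  moreover have "\<forall>p\<in>{..<d}\<times>{..<d}. (cmod (A $$ p))\<^sup>2 = 0"
    using assms(2) unfolding rtr_adj_mult_self[OF assms(1)]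
    by (subst (asm) sum_nonneg_eq_0_iff) auto
  ultimately show "A $$ (i, j) = 0\<^sub>m d d $$ (i, j)" by auto
qed (use assms in auto)

text \<open>Matrices are read as vectors of their entries, which leaves the Cauchy-Schwarz
  inequality for finite sums.\<close>

lemma hilbert_schmidt_Cauchy_Schwarz:
  assumes "A \<in> carrier_mat d d" "B \<in> carrier_mat d d"
  shows "rtr (adj A * B) \<le> sqrt (rtr (adj A * A)) * sqrt (rtr (adj B * B))"
proof -
  let ?I = "{..<d}\<times>{..<d}"
  have "rtr (adj A * B) \<le> (\<Sum>p\<in>?I. cmod (A $$ p) * cmod (B $$ p))"
    unfolding rtr_adj_mult_eq[OF assms]
    by (intro sum_mono order.trans[OF complex_Re_le_cmod]) (simp add: norm_mult)
  also have "\<dots> \<le> sqrt ((\<Sum>p\<in>?I. (cmod (A $$ p))\<^sup>2) * (\<Sum>p\<in>?I. (cmod (B $$ p))\<^sup>2))"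
    by (rule real_le_rsqrt) (rule Cauchy_Schwarz_ineq_sum)
  finally show ?thesis by (simp add: rtr_adj_mult_self[OF assms(1)] rtr_adj_mult_self[OF assms(2)] real_sqrt_mult)
qed

text \<open>The positive matrix \<open>X - Y\<close> has trace zero, hence only zero
  eigenvalues.\<close>

lemma psd_antisym:
  assumes "psd d (X - Y)" "psd d (Y - X)" "X \<in> carrier_mat d d" "Y \<in> carrier_mat d d"
  shows "X = Y"
proof -
  let ?D = "X - Y"
  have h: "herm d ?D" using assms(1) by (rule psd_herm)
  have "rtr ?D = 0" using psd_rtr_nonneg[OF assms(1)] psd_rtr_nonneg[OF assms(2)] assms(3,4)
    by (simp add: rtr_minus[of _ d])
  then have "(\<Sum>i<d. eigs d ?D i) = 0" using fc_rtr[OF h, of "\<lambda>x. x"] eigsys(2)[OF h] by simp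
  then have "\<forall>i\<in>{..<d}. eigs d ?D i = 0"
    using eigs_nonneg[OF assms(1)] by (subst (asm) sum_nonneg_eq_0_iff) auto
  then have "fc d ?D (\<lambda>x. x) = fc d ?D (\<lambda>x. 0)" by (intro fc_cong) auto
  then have D: "?D = 0\<^sub>m d d" using eigsys(2)[OF h] fc_zero[OF h] by simp
  show ?thesis
  proof (rule eq_matI)
    fix i j assume ij: "i < dim_row Y" "j < dim_col Y"
    then have "(X - Y) $$ (i, j) = 0" using D assms(3,4) by simp
    then show "X $$ (i, j) = Y $$ (i, j)" using ij by simp
  qed (use assms in auto)
qed

text \<open>Operator monotonicity of the square root. Let N be the negative part of D = X - Y. By
  cyclicity tr N (X^2 - Y^2) = tr D N X + tr N D Y = - tr N^2 X - tr N^2 Y. The left side is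
  nonnegative, so both traces on the right vanish, and with them tr N^2 D, which is minus the sum of
  the cubes of the negative parts of the eigenvalues.\<close>

lemma psd_diff_of_squares:
  assumes X: "psd d X" and Y: "psd d Y" and "psd d (X * X - Y * Y)"
  shows "psd d (X - Y)"
proof -
  let ?D = "X - Y"
  have h: "herm d ?D" using X Y by (intro herm_diff psd_herm)
  define N where "N = fc d ?D (\<lambda>x. max (- x) 0)"
  define S where "S = fc d ?D (\<lambda>x. (max (- x) 0)\<^sup>2)"
  have N: "psd d N" and S: "psd d S" by (simp_all add: N_def S_def fc_psd_iff[OF h])
  have c: "X \<in> carrier_mat d d" "Y \<in> carrier_mat d d" "N \<in> carrier_mat d d" "S \<in> carrier_mat d d"
    using X Y N S by auto
  have fD: "fc d ?D (\<lambda>x. x) = ?D" by (rule eigsys(2)[OF h])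
  have ND: "N * ?D + S = 0\<^sub>m d d" "?D * N + S = 0\<^sub>m d d"
  proof -
    have "N * fc d ?D (\<lambda>x. x) + S = fc d ?D (\<lambda>x. 0)" "fc d ?D (\<lambda>x. x) * N + S = fc d ?D (\<lambda>x. 0)"
      unfolding N_def S_def fc_mult[OF h] fc_add[OF h] by (intro fc_cong, simp add: max_def power2_eq_square)+
    then show "N * ?D + S = 0\<^sub>m d d" "?D * N + S = 0\<^sub>m d d" unfolding fD fc_zero[OF h] by auto
  qed
  have 1: "rtr (N * ?D * Y) = - rtr (S * Y)"
  proof -
    have "rtr ((N * ?D + S) * Y) = 0" using ND c by (simp add: left_mult_zero_mat[of _ d d])
    then show ?thesis using c by (simp add: mult_add_square[of _ d] rtr_add[of _ d])
  qed
  have 2: "rtr (?D * N * X) = - rtr (S * X)"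
  proof -
    have "rtr ((?D * N + S) * X) = 0" using ND c by (simp add: left_mult_zero_mat[of _ d d])
    then show ?thesis using c by (simp add: mult_add_square[of _ d] rtr_add[of _ d])
  qed
  have 3: "rtr (S * ?D) = - (\<Sum>i<d. (max (- eigs d ?D i) 0)^3)"
  proof -
    have "rtr (S * fc d ?D (\<lambda>x. x)) = (\<Sum>i<d. - ((max (- eigs d ?D i) 0)^3))"
      unfolding S_def fc_mult[OF h] fc_rtr[OF h]
      by (intro sum.cong) (auto simp: max_def power2_eq_square power3_eq_cube)
    then show ?thesis using fD by (simp add: sum_negf)
  qed
  have "0 \<le> rtr (N * (X * X - Y * Y))" using N assms(3) by (rule psd_mult_rtr_nonneg)
  also have "\<dots> = rtr (?D * N * X) + rtr (N * ?D * Y)"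
  proof -
    have "rtr (N * X * Y) = rtr (Y * N * X)" using c
      by (subst rtr_mult_comm[of _ d]) (auto simp: assoc_square[of _ d])
    moreover have "rtr (N * X * X) = rtr (X * N * X)" using c
      by (subst rtr_mult_comm[of _ d]) (auto simp: assoc_square[of _ d])
    ultimately show ?thesis using c
      by (simp add: mult_minus_square[of _ d] rtr_minus[of _ d] assoc_square[of _ d])
  qed
  finally have "rtr (S * X) = 0" "rtr (S * Y) = 0"
    using 1 2 psd_mult_rtr_nonneg[OF S X] psd_mult_rtr_nonneg[OF S Y] by auto
  then have "(\<Sum>i<d. (max (- eigs d ?D i) 0)^3) = 0"
    using 3 c by (simp add: mult_minus_square[of _ d] rtr_minus[of _ d])
  then have "\<forall>i\<in>{..<d}. (max (- eigs d ?D i) 0)^3 = 0"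
    by (subst (asm) sum_nonneg_eq_0_iff) auto
  then have "\<forall>i<d. 0 \<le> eigs d ?D i" by (auto simp: max_def split: if_splits)
  then show ?thesis using fc_psd_iff[OF h, of "\<lambda>x. x"] fD by simp
qed

text \<open>Operator monotonicity, used in both directions, shows that a positive root is unique.
  This is what gives the definite description in \<open>msqrt\<close> its meaning.\<close>

lemma msqrt_unique:
  assumes "psd d X" "X * X = A"
  shows "msqrt A = X"
proof -
  have d: "dim_row A = d" using assms(2) carrier_matD[OF psd_carrier[OF assms(1)]] by auto
  show ?thesis unfolding msqrt_def d
  proof (rule the_equality)
    show "psd d X \<and> X * X = A" using assms by simp
    fix Y assume Y: "psd d Y \<and> Y * Y = A"
    have "psd d (A - A)" if "A \<in> carrier_mat d d"
      using that psd_zero[of d] minus_r_inv_mat[OF that] by simp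
    moreover have "A \<in> carrier_mat d d" using assms by auto
    ultimately have z: "psd d (A - A)" by simp
    have "psd d (X - Y)" "psd d (Y - X)"
      by (rule psd_diff_of_squares; use assms Y z in simp)+
    then show "Y = X" using psd_antisym[of d Y X] psd_carrier assms(1) Y by blast
  qed
qed

lemma msqrt_eq_fc: "psd d A \<Longrightarrow> msqrt A = fc d A sqrt"
  using psd_root by (intro msqrt_unique)

lemma msqrt_psd: "psd d A \<Longrightarrow> psd d (msqrt A)"
  using psd_root msqrt_eq_fc by metis

lemma msqrt_square: "psd d A \<Longrightarrow> msqrt A * msqrt A = A"
  using psd_root msqrt_eq_fc by metis

text \<open>Effects are the possible elements of a measurement. They act as tests that accept \<rho>
  with probability \<open>rtr (T * \<rho>)\<close>.\<close>

definition eff :: "nat \<Rightarrow> complex mat \<Rightarrow> bool" where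
  "eff d T \<longleftrightarrow> psd d T \<and> psd d (1\<^sub>m d - T)"

lemma eff_carrier [simp]: "eff d T \<Longrightarrow> T \<in> carrier_mat d d"
  by (simp add: eff_def)

lemma effD: "eff d T \<Longrightarrow> psd d T" "eff d T \<Longrightarrow> psd d (1\<^sub>m d - T)"
  unfolding eff_def by blast+

lemma fc_eff:
  assumes "herm d A" "\<And>x. 0 \<le> f x \<and> f x \<le> 1"
  shows "eff d (fc d A f)"
proof -
  have "1\<^sub>m d - fc d A f = fc d A (\<lambda>x. 1 - f x)"
    using fc_minus[OF assms(1), of "\<lambda>x. 1" f] fc_one[OF assms(1)] by simp
  then show ?thesis using assms by (simp add: eff_def fc_psd_iff)
qed

lemma eff_square: "eff d T \<Longrightarrow> psd d (T - T * T)"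
proof -
  assume T: "eff d T"
  then have h: "herm d T" by (auto simp: eff_def intro: psd_herm)
  note fT = eigsys(2)[OF h]
  have "psd d (fc d T (\<lambda>x. 1 - x))"
    using T unfolding fc_minus[OF h, symmetric] fT fc_one[OF h] by (simp add: eff_def)
  then have "\<forall>i<d. eigs d T i \<le> 1" by (simp add: fc_psd_iff[OF h])
  moreover have "\<forall>i<d. 0 \<le> eigs d T i" using T eigs_nonneg by (auto simp: eff_def)
  ultimately have "psd d (fc d T (\<lambda>x. x - x * x))"
    by (simp add: fc_psd_iff[OF h] mult_left_le)
  then show ?thesis unfolding fc_minus[OF h, symmetric] fc_mult[OF h, symmetric] fT .
qed

text \<open>The test is the spectral projection of \<open>X - Y\<close> onto its positive part (Powers and Stormer).\<close>
lemma powers_stormer_test: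
  assumes X: "psd d X" and Y: "psd d Y"
  shows "\<exists>T. eff d T \<and> rtr (X * X) - rtr (T * (X * X)) + rtr (T * (Y * Y)) \<le> rtr (X * Y)"
proof -
  let ?D = "X - Y"
  have h: "herm d ?D" using X Y by (intro herm_diff psd_herm)
  define T where "T = fc d ?D (\<lambda>x. if 0 < x then 1 else 0)"
  define P where "P = fc d ?D (\<lambda>x. max x 0)"
  define N where "N = fc d ?D (\<lambda>x. max (- x) 0)"
  have T: "eff d T" unfolding T_def by (rule fc_eff[OF h]) auto
  have P: "psd d P" and N: "psd d N" by (simp_all add: P_def N_def fc_psd_iff[OF h])
  have c: "X \<in> carrier_mat d d" "Y \<in> carrier_mat d d" "N \<in> carrier_mat d d" "P \<in> carrier_mat d d"
     "T \<in> carrier_mat d d"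
    using X Y N P T by auto
  have fD: "fc d ?D (\<lambda>x. x) = ?D" by (rule eigsys(2)[OF h])
  have TD: "T * ?D = P" "?D * T = P" "P - N = ?D"
  proof -
    have "T * fc d ?D (\<lambda>x. x) = P" "fc d ?D (\<lambda>x. x) * T = P" "P - N = fc d ?D (\<lambda>x. x)"
      unfolding T_def N_def P_def fc_mult[OF h] fc_minus[OF h] by (intro fc_cong, simp add: max_def)+
    then show "T * ?D = P" "?D * T = P" "P - N = ?D" unfolding fD by auto
  qed
  \<comment> \<open>The three identities combine to tr X^2 - tr T (X^2 - Y^2) = tr X Y - tr N X - tr
    P Y, and the last two traces are nonnegative.\<close>
  have a: "rtr (T * (X * X)) - rtr (T * (X * Y)) = rtr (P * X)"
  proof -
    have "rtr (T * (X * ?D)) = rtr (T * X * ?D)" using c by (simp add: assoc_square[of _ d])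
    also have "\<dots> = rtr (?D * (T * X))" using c by (intro rtr_mult_comm[of _ d]) auto
    also have "\<dots> = rtr (?D * T * X)" using c by (simp add: assoc_square[of _ d])
    also have "\<dots> = rtr (P * X)" by (simp add: TD)
    finally show ?thesis using c by (simp add: mult_minus_square[of _ d] rtr_minus[of _ d])
  qed
  have b: "rtr (T * (X * Y)) - rtr (T * (Y * Y)) = rtr (P * Y)"
  proof -
    have "rtr (T * ?D * Y) = rtr (P * Y)" by (simp add: TD)
    then show ?thesis using c by (simp add: mult_minus_square[of _ d] rtr_minus[of _ d] assoc_square[of _ d])
  qed
  have d: "rtr (P * X) - rtr (N * X) = rtr (X * X) - rtr (X * Y)"
  proof -
    have "rtr ((P - N) * X) = rtr (?D * X)" by (simp add: TD)
    then show ?thesis using c by (simp add: mult_minus_square[of _ d] rtr_minus[of _ d] rtr_mult_comm[of Y d X])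
  qed
  have "0 \<le> rtr (P * Y)" "0 \<le> rtr (N * X)" using P N X Y by (auto intro: psd_mult_rtr_nonneg)
  then have "rtr (X * X) - rtr (T * (X * X)) + rtr (T * (Y * Y)) \<le> rtr (X * Y)"
    using a b d by linarith
  then show ?thesis using T by blast
qed

section \<open>Trace norm and fidelity\<close>

text \<open>The unit ball of the operator norm, written as an operator inequality. The trace norm is
  its dual norm: see \<open>rtr_contr_le_tnorm\<close> and \<open>tnorm_attained\<close>.\<close>

definition contr :: "nat \<Rightarrow> complex mat \<Rightarrow> bool" where
  "contr d Y \<longleftrightarrow> Y \<in> carrier_mat d d \<and> psd d (1\<^sub>m d - adj Y * Y)"

lemma contr_carrier [simp]: "contr d Y \<Longrightarrow> Y \<in> carrier_mat d d"
  by (simp add: contr_def)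

lemma contr_one [simp]: "contr d (1\<^sub>m d)"
proof -
  have "1\<^sub>m d - 1\<^sub>m d = (0\<^sub>m d d :: complex mat)" by (rule minus_r_inv_mat) simp
  then have "psd d (1\<^sub>m d - 1\<^sub>m d)" by (simp only: psd_zero)
  then show ?thesis by (simp add: contr_def)
qed

text \<open>Conjugating the hypothesis turns it into B - B^2 >= 0 for B = Y \<open>adj Y\<close>,
  which excludes eigenvalues of B above 1.\<close>

lemma contr_adj:
  assumes "contr d Y"
  shows "contr d (adj Y)"
proof -
  define B where "B = Y * adj Y"
  have Y: "Y \<in> carrier_mat d d" and p: "psd d (1\<^sub>m d - adj Y * Y)" using assms by (auto simp: contr_def)
  have B: "psd d B" using psd_mult_adj[OF Y] by (simp add: B_def)
  then have h: "herm d B" by (rule psd_herm)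
  note fB = eigsys(2)[OF h]
  have "psd d (B - B * B)"
    using psd_conj[OF p, of "adj Y"] Y
    by (simp add: B_def mult_minus_square[of _ d] assoc_square[of _ d])
  then have "psd d (fc d B (\<lambda>x. x - x * x))"
    unfolding fc_minus[OF h, symmetric] fc_mult[OF h, symmetric] fB .
  then have *: "\<forall>i<d. 0 \<le> eigs d B i - eigs d B i * eigs d B i" by (simp add: fc_psd_iff[OF h])
  have "0 \<le> 1 - eigs d B i" if "i < d" for i
  proof (rule ccontr)
    assume "\<not> ?thesis"
    then have "1 * eigs d B i < eigs d B i * eigs d B i" by (intro mult_strict_right_mono) auto
    then show False using * that by force
  qed
  then have "psd d (fc d B (\<lambda>x. 1 - x))" by (simp add: fc_psd_iff[OF h])
  then have "psd d (1\<^sub>m d - B)"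
    unfolding fc_minus[OF h, symmetric] fB fc_one[OF h] .
  then show ?thesis using Y by (simp add: contr_def B_def)
qed

lemma contr_rtr_le:
  assumes "contr d Y" "psd d A"
  shows "rtr (adj Y * Y * A) \<le> rtr A"
proof -
  have Y: "Y \<in> carrier_mat d d" "psd d (1\<^sub>m d - adj Y * Y)" using assms unfolding contr_def by blast+
  show ?thesis using rtr_mult_mono[OF Y(2) assms(2)] Y(1) psd_carrier[OF assms(2)] by simp
qed

lemma tnorm_cong: "adj X * X = adj Y * Y \<Longrightarrow> tnorm X = tnorm Y"
  by (simp add: tnorm_def)

lemma tnorm_nonneg: "X \<in> carrier_mat d d \<Longrightarrow> 0 \<le> tnorm X"
  using psd_rtr_nonneg[OF msqrt_psd[OF psd_adj_mult[of X d]]] by (simp add: tnorm_def rtr_def)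

text \<open>\<open>P\<close> is the absolute value of \<open>X\<close> and \<open>adj Y\<close> its
  partial isometry. \<open>Y\<close> is obtained from a pseudo-inverse of \<open>P\<close>, so it is
  only a contraction when \<open>X\<close> is singular.\<close>

lemma polar_decomposition:
  assumes X: "X \<in> carrier_mat d d"
  shows "\<exists>Y P. contr d Y \<and> psd d P \<and> X = adj Y * P \<and> Y * X = P \<and> rtr P = tnorm X"
proof -
  define A where "A = adj X * X"
  have A: "psd d A" using psd_adj_mult[OF X] by (simp add: A_def)
  have h: "herm d A" using A by (rule psd_herm)
  note fA = eigsys(2)[OF h]
  note pos = eigs_nonneg[OF A]
  define P where "P = fc d A sqrt"
  define R where "R = fc d A (\<lambda>x. if x \<le> 0 then 0 else 1 / sqrt x)"
  define Q where "Q = fc d A (\<lambda>x. if x \<le> 0 then 0 else 1)"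
  have c: "P \<in> carrier_mat d d" "R \<in> carrier_mat d d" "Q \<in> carrier_mat d d" "A \<in> carrier_mat d d"
    by (simp_all add: P_def R_def Q_def fc_carrier[OF h] A)
  have ad: "adj P = P" "adj R = R" "adj Q = Q" by (simp_all add: P_def R_def Q_def fc_adj[OF h])
  have P: "psd d P" using psd_root[OF A] by (simp add: P_def)
  have RA: "R * A = P"
  proof -
    have "R * fc d A (\<lambda>x. x) = P"
      unfolding R_def P_def fc_mult[OF h] using pos
      by (intro fc_cong) (auto simp: real_div_sqrt not_le intro: antisym)
    then show ?thesis unfolding fA .
  qed
  have RAR: "P * R = Q" and RP: "R * P = Q"
    unfolding R_def P_def Q_def fc_mult[OF h] using pos by (intro fc_cong; force)+
  have QA: "Q * A = A" "A * Q = A"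
  proof -
    have "Q * fc d A (\<lambda>x. x) = fc d A (\<lambda>x. x)" "fc d A (\<lambda>x. x) * Q = fc d A (\<lambda>x. x)"
      unfolding Q_def fc_mult[OF h] using pos by (intro fc_cong; force)+
    then show "Q * A = A" "A * Q = A" unfolding fA .
  qed
  define Y where "Y = R * adj X"
  have Y: "Y \<in> carrier_mat d d" using X c by (simp add: Y_def)
  have YX: "Y * X = P" using X c RA by (simp add: Y_def A_def assoc_square[of _ d])
  have "Y * adj Y = R * A * R"
    using X c by (simp add: Y_def A_def ad adj_mult[of _ d d _ d] assoc_square[of _ d])
  then have YY: "Y * adj Y = Q" by (simp add: RA RAR)
  have "psd d (1\<^sub>m d - Q)"
  proof -
    have "1\<^sub>m d - Q = fc d A (\<lambda>x. 1 - (if x \<le> 0 then 0 else 1))"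
      unfolding Q_def fc_minus[OF h, symmetric] fc_one[OF h] by simp
    then show ?thesis by (simp add: fc_psd_iff[OF h])
  qed
  then have "contr d (adj Y)" using Y by (simp add: contr_def YY)
  from contr_adj[OF this] have con: "contr d Y" by simp
  \<comment> \<open>\<open>Q\<close> projects onto the support of \<open>adj X * X\<close>. The part
    of \<open>X\<close> that \<open>Q\<close> removes has Hilbert-Schmidt norm zero, so nothing is
    lost by the pseudo-inverse.\<close>
  define Z where "Z = X - X * Q"
  have Z: "Z \<in> carrier_mat d d" using X c by (simp add: Z_def)
  have "adj Z * Z = (A - Q * A) - (A * Q - Q * (A * Q))"
    using X c by (simp add: Z_def A_def adj_minus[of _ d d] adj_mult[of _ d d _ d] ad mult_minus_square[of _ d] assoc_square[of _ d])
  also have "\<dots> = 0\<^sub>m d d" using c by (simp add: QA minus_r_inv_mat[of _ d d])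
  finally have "Z = 0\<^sub>m d d" using rtr_adj_mult_self_zero[OF Z] by simp
  have XQ: "X = X * Q"
  proof (rule eq_matI)
    fix i j assume ij: "i < dim_row (X * Q)" "j < dim_col (X * Q)"
    then have "Z $$ (i, j) = 0" using \<open>Z = 0\<^sub>m d d\<close> X c by simp
    then show "X $$ (i, j) = (X * Q) $$ (i, j)" using ij by (simp add: Z_def)
  qed (use X c in auto)
  have "adj Y * P = X * (R * P)"
    using X c by (simp add: Y_def ad adj_mult[of _ d d _ d] assoc_square[of _ d])
  then have "X = adj Y * P" using XQ RP by simp
  moreover have "rtr P = tnorm X"
    by (simp add: tnorm_def rtr_def P_def msqrt_eq_fc[OF A[unfolded A_def]] A_def)
  ultimately show ?thesis using con P YX by blast
qed

lemma tnorm_attained: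
  assumes "X \<in> carrier_mat d d"
  obtains Y where "contr d Y" "rtr (Y * X) = tnorm X"
proof -
  from polar_decomposition[OF assms] obtain Y P where "contr d Y" "Y * X = P" "rtr P = tnorm X" by metis
  then show thesis using that[of Y] by simp
qed

text \<open>Hoelder's inequality for the operator and the trace norm. By the polar decomposition and
  a root of \<open>P\<close> the trace becomes a Hilbert-Schmidt product of two factors, and
  contractions keep both squared norms below tr P.\<close>

lemma rtr_contr_le_tnorm:
  assumes X: "X \<in> carrier_mat d d" and Y: "contr d Y"
  shows "rtr (Y * X) \<le> tnorm X"
proof -
  obtain Z P where Z: "contr d Z" and P: "psd d P" and XZ: "X = adj Z * P" and tr: "rtr P = tnorm X"
    using polar_decomposition[OF X] by blast
  define Q where "Q = fc d P sqrt"
  have Q: "psd d Q" "Q * Q = P" using psd_root[OF P] by (auto simp: Q_def)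
  have c: "Y \<in> carrier_mat d d" "Z \<in> carrier_mat d d" "Q \<in> carrier_mat d d" "P \<in> carrier_mat d d"
    using Y Z Q P by auto
  have "rtr (Y * X) = rtr (Y * adj Z * Q * Q)"
    using c by (simp add: XZ Q(2)[symmetric] assoc_square[of _ d])
  also have "\<dots> = rtr (Q * (Y * adj Z * Q))" using c by (intro rtr_mult_comm[of _ d]) auto
  also have "\<dots> = rtr (adj (adj Y * Q) * (adj Z * Q))"
    using c Q by (simp add: adj_mult[of _ d d _ d] assoc_square[of _ d])
  also have "\<dots> \<le> sqrt (rtr (adj (adj Y * Q) * (adj Y * Q))) * sqrt (rtr (adj (adj Z * Q) * (adj Z * Q)))"
    using c by (intro hilbert_schmidt_Cauchy_Schwarz) auto
  also have "\<dots> \<le> sqrt (rtr P) * sqrt (rtr P)"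
  proof -
    have *: "rtr (adj (adj W * Q) * (adj W * Q)) \<le> rtr P" if W: "contr d W" for W
    proof -
      have Wc: "W \<in> carrier_mat d d" using W by simp
      have "rtr (adj (adj W * Q) * (adj W * Q)) = rtr (Q * (W * adj W * Q))"
        using c Wc Q by (simp add: adj_mult[of _ d d _ d] assoc_square[of _ d])
      also have "\<dots> = rtr (W * adj W * Q * Q)" using c Wc by (intro rtr_mult_comm[of _ d]) auto
      also have "\<dots> = rtr (adj (adj W) * adj W * P)"
        using c Wc by (simp add: Q(2)[symmetric] assoc_square[of _ d])
      also have "\<dots> \<le> rtr P" using contr_rtr_le[OF contr_adj[OF W] P] .
      finally show ?thesis .
    qed
    show ?thesis using psd_rtr_nonneg[OF P] rtr_adj_mult_self_nonneg[of "adj Z * Q" d] c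
        rtr_adj_mult_self_nonneg[of "adj Y * Q" d]
      by (intro mult_mono real_sqrt_le_mono * Y Z) auto
  qed
  also have "\<dots> = tnorm X" using psd_rtr_nonneg[OF P] tr by simp
  finally show ?thesis .
qed

lemma rtr_le_tnorm: "X \<in> carrier_mat d d \<Longrightarrow> rtr X \<le> tnorm X"
  using rtr_contr_le_tnorm[of X d "1\<^sub>m d"] by simp

lemma tnorm_adj:
  assumes "X \<in> carrier_mat d d"
  shows "tnorm (adj X) = tnorm X"
proof -
  have *: "tnorm (adj X) \<le> tnorm X" if X: "X \<in> carrier_mat d d" for X
  proof -
    obtain Y where Y: "contr d Y" "rtr (Y * adj X) = tnorm (adj X)"
      using tnorm_attained[of "adj X" d] X by auto
    have "rtr (Y * adj X) = rtr (adj (Y * adj X))" using X Y by (simp add: rtr_adj[of _ d])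
    also have "\<dots> = rtr (X * adj Y)" using X Y by (simp add: adj_mult[of _ d d _ d])
    also have "\<dots> = rtr (adj Y * X)" using X Y by (intro rtr_mult_comm[of _ d]) auto
    finally show ?thesis using rtr_contr_le_tnorm[OF X contr_adj[OF Y(1)]] Y(2) by simp
  qed
  show ?thesis using *[of X] *[of "adj X"] assms by simp
qed

text \<open>A contraction that attains the trace norm is absorbed into the factor \<open>A\<close>
  without increasing its Hilbert-Schmidt norm.\<close>

lemma tnorm_adj_mult_le:
  assumes A: "A \<in> carrier_mat d d" and B: "B \<in> carrier_mat d d"
  shows "tnorm (adj A * B) \<le> sqrt (rtr (adj A * A)) * sqrt (rtr (adj B * B))"
proof -
  obtain Y where Y: "contr d Y" "rtr (Y * (adj A * B)) = tnorm (adj A * B)"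
    using tnorm_attained[of "adj A * B" d] A B by auto
  have Yc: "Y \<in> carrier_mat d d" using Y by simp
  have "rtr (Y * (adj A * B)) = rtr (adj (A * adj Y) * B)"
    using A B Yc by (simp add: adj_mult[of _ d d _ d] assoc_square[of _ d])
  also have "\<dots> \<le> sqrt (rtr (adj (A * adj Y) * (A * adj Y))) * sqrt (rtr (adj B * B))"
    using A B Yc by (intro hilbert_schmidt_Cauchy_Schwarz) auto
  finally have 1: "tnorm (adj A * B) \<le> sqrt (rtr (adj (A * adj Y) * (A * adj Y))) * sqrt (rtr (adj B * B))"
    using Y(2) by simp
  have "rtr (adj (A * adj Y) * (A * adj Y)) = rtr (adj Y * Y * (adj A * A))"
  proof -
    have "rtr (adj (A * adj Y) * (A * adj Y)) = rtr (Y * (adj A * A * adj Y))"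
      using A Yc by (simp add: adj_mult[of _ d d _ d] assoc_square[of _ d])
    also have "\<dots> = rtr (adj A * A * adj Y * Y)" using A Yc by (intro rtr_mult_comm[of _ d]) auto
    also have "\<dots> = rtr (adj A * A * (adj Y * Y))" using A Yc by (simp add: assoc_square[of _ d])
    also have "\<dots> = rtr (adj Y * Y * (adj A * A))" using A Yc by (intro rtr_mult_comm[of _ d]) auto
    finally show ?thesis .
  qed
  then have 2: "rtr (adj (A * adj Y) * (A * adj Y)) \<le> rtr (adj A * A)"
    using contr_rtr_le[OF Y(1) psd_adj_mult[OF A]] by simp
  have "0 \<le> sqrt (rtr (adj B * B))" using rtr_adj_mult_self_nonneg[OF B] by simp
  from order.trans[OF 1 mult_right_mono[OF real_sqrt_le_mono[OF 2] this]] show ?thesis .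
qed

text \<open>2 T - 1 is a contraction, because 1 - (2 T - 1)^2 = 4 (T - T^2) is positive. For
  differences of states this bounds the advantage of a test by half of the trace norm.\<close>

lemma tnorm_eff_ge:
  assumes A: "A \<in> carrier_mat d d" and T: "eff d T"
  shows "2 * rtr (T * A) - rtr A \<le> tnorm A"
proof -
  define W where "W = complex_of_real 2 \<cdot>\<^sub>m T - 1\<^sub>m d"
  have Tp: "psd d T" and Tc: "T \<in> carrier_mat d d" using T by (auto simp: eff_def)
  have Wc: "W \<in> carrier_mat d d" using Tc by (simp add: W_def)
  have "1\<^sub>m d - adj W * W = complex_of_real 4 \<cdot>\<^sub>m (T - T * T)"
  proof (rule eq_matI)
    fix i j assume "i < dim_row (complex_of_real 4 \<cdot>\<^sub>m (T - T * T))" "j < dim_col (complex_of_real 4 \<cdot>\<^sub>m (T - T * T))"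
    then have ij: "i < d" "j < d" using Tc by auto
    have "adj W = W" using Tp Tc by (simp add: W_def adj_minus[of _ d d])
    then have "adj W * W = complex_of_real 2 \<cdot>\<^sub>m (complex_of_real 2 \<cdot>\<^sub>m (T * T) - T) - (complex_of_real 2 \<cdot>\<^sub>m T - 1\<^sub>m d)"
      using Tc by (simp add: W_def mult_minus_square[of _ d] mult_smult_distrib[of _ d d _ d] mult_smult_assoc_mat[of _ d d _ d])
    then show "(1\<^sub>m d - adj W * W) $$ (i, j) = (complex_of_real 4 \<cdot>\<^sub>m (T - T * T)) $$ (i, j)"
      using ij Tc by (simp add: algebra_simps)
  qed (use Tc Wc in auto)
  then have "contr d W" using Wc psd_smult[OF eff_square[OF T], of 4] by (simp add: contr_def)
  from rtr_contr_le_tnorm[OF A this] show ?thesis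
    using A Tc by (simp add: W_def mult_minus_square[of _ d] rtr_minus[of _ d] mult_smult_assoc_mat[of _ d d _ d] rtr_smult[of _ d, of _ 2, simplified])
qed

text \<open>The test is the projection onto the positive eigenvalues. Through it a trace norm is
  replaced by the value of a single test, which is linear; the triangle-type estimates below rest on
  this.\<close>

lemma tnorm_herm_attained:
  assumes h: "herm d A"
  obtains T where "eff d T" "tnorm A = 2 * rtr (T * A) - rtr A"
proof -
  note fA = eigsys(2)[OF h]
  have ad: "adj A = A" "A \<in> carrier_mat d d" using h by (auto simp: herm_def)
  define T where "T = fc d A (\<lambda>x. if 0 < x then 1 else 0)"
  have T: "eff d T" unfolding T_def by (rule fc_eff[OF h]) auto
  have "fc d A abs * fc d A abs = fc d A (\<lambda>x. x) * fc d A (\<lambda>x. x)"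
    by (simp add: fc_mult[OF h])
  then have "fc d A abs * fc d A abs = adj A * A" by (simp add: fA ad)
  moreover have "psd d (fc d A abs)" by (simp add: fc_psd_iff[OF h])
  ultimately have "msqrt (adj A * A) = fc d A abs" by (intro msqrt_unique)
  then have 1: "tnorm A = (\<Sum>i<d. \<bar>eigs d A i\<bar>)" by (simp add: tnorm_def rtr_def[symmetric] fc_rtr[OF h])
  have "T * fc d A (\<lambda>x. x) = fc d A (\<lambda>x. (if 0 < x then 1 else 0) * x)"
    by (simp add: T_def fc_mult[OF h])
  then have 2: "rtr (T * A) = (\<Sum>i<d. (if 0 < eigs d A i then 1 else 0) * eigs d A i)"
    by (simp add: fA fc_rtr[OF h])
  have 3: "rtr A = (\<Sum>i<d. eigs d A i)" using fc_rtr[OF h, of "\<lambda>x. x"] by (simp add: fA)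
  have "(\<Sum>i<d. \<bar>eigs d A i\<bar>) = (\<Sum>i<d. 2 * ((if 0 < eigs d A i then 1 else 0) * eigs d A i) - eigs d A i)"
    by (intro sum.cong) auto
  also have "\<dots> = 2 * rtr (T * A) - rtr A"
    by (simp only: 2 3 sum_subtractf sum_distrib_left)
  finally show ?thesis using that[OF T] 1 by simp
qed

text \<open>The trace norm of a matrix depends only on the adjoint times the matrix. This allows the
  root of the first state to be replaced by \<open>adj A\<close> and, after taking adjoints, the
  root of the second by \<open>B\<close>. Any factorizations of two states thus compute their
  fidelity, and roots of smoothed states never have to be found.\<close>

lemma fid_eq_tnorm:
  assumes A: "A \<in> carrier_mat d d" and B: "B \<in> carrier_mat d d"
  shows "fid (A * adj A) (B * adj B) = tnorm (adj A * B)"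
proof -
  define \<rho> \<sigma> where "\<rho> = A * adj A" and "\<sigma> = B * adj B"
  have \<rho>: "psd d \<rho>" and \<sigma>: "psd d \<sigma>" using A B by (auto simp: \<rho>_def \<sigma>_def psd_mult_adj)
  define r s where "r = msqrt \<rho>" and "s = msqrt \<sigma>"
  have r: "psd d r" "r * r = \<rho>" and s: "psd d s" "s * s = \<sigma>"
    using msqrt_psd[OF \<rho>] msqrt_square[OF \<rho>] msqrt_psd[OF \<sigma>] msqrt_square[OF \<sigma>] by (auto simp: r_def s_def)
  have c: "r \<in> carrier_mat d d" "s \<in> carrier_mat d d" using r s by auto
  have "adj (r * s) * (r * s) = s * (r * r) * s"
    using c r(1) s(1) by (simp add: adj_mult[of _ d d _ d] assoc_square[of _ d])
  also have "\<dots> = adj (adj A * s) * (adj A * s)"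
    using A c r(1) s(1) by (simp add: r(2) \<rho>_def adj_mult[of _ d d _ d] assoc_square[of _ d])
  finally have "tnorm (r * s) = tnorm (adj A * s)" by (rule tnorm_cong)
  also have "\<dots> = tnorm (adj (adj A * s))" using A c by (simp add: tnorm_adj[of _ d])
  also have "\<dots> = tnorm (adj B * A)"
  proof (rule tnorm_cong)
    have "adj (adj (adj A * s)) * adj (adj A * s) = adj A * (s * s) * A"
      using A c s(1) by (simp add: adj_mult[of _ d d _ d] assoc_square[of _ d])
    also have "\<dots> = adj (adj B * A) * (adj B * A)"
      using A B by (simp add: s(2) \<sigma>_def adj_mult[of _ d d _ d] assoc_square[of _ d])
    finally show "adj (adj (adj A * s)) * adj (adj A * s) = adj (adj B * A) * (adj B * A)" .
  qed
  also have "\<dots> = tnorm (adj A * B)"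
    using A B tnorm_adj[of "adj B * A" d] by (simp add: adj_mult[of _ d d _ d])
  finally show ?thesis by (simp add: fid_def r_def s_def \<rho>_def \<sigma>_def)
qed

lemma fid_nonneg: "psd d \<rho> \<Longrightarrow> psd d \<sigma> \<Longrightarrow> 0 \<le> fid \<rho> \<sigma>"
  by (simp add: fid_def) (intro tnorm_nonneg[of _ d], simp add: msqrt_psd)

lemma rtr_roots_le_fid:
  assumes "psd d X" "psd d Y"
  shows "rtr (X * Y) \<le> fid (X * X) (Y * Y)"
  using fid_eq_tnorm[of X d Y] rtr_le_tnorm[of "X * Y" d] assms by simp

lemma fid_le_sqrt_rtr:
  assumes A: "A \<in> carrier_mat d d" and B: "B \<in> carrier_mat d d"
  shows "fid (A * adj A) (B * adj B) \<le> sqrt (rtr (A * adj A)) * sqrt (rtr (B * adj B))"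
  using tnorm_adj_mult_le[OF A B] A B
  by (simp add: fid_eq_tnorm rtr_mult_comm[of "adj A" d A] rtr_mult_comm[of "adj B" d B])

text \<open>Monotonicity of the fidelity under the measurement of \<open>T\<close> and its
  complement. The contraction that attains the trace norm is fixed, the identity is inserted as T +
  (1 - T), and each of the two terms is bounded by Cauchy-Schwarz.\<close>

lemma fid_test_le:
  assumes \<rho>: "psd d \<rho>" and \<sigma>: "psd d \<sigma>" and T: "eff d T"
  shows "fid \<rho> \<sigma> \<le> sqrt (rtr (T * \<rho>) * rtr (T * \<sigma>))
    + sqrt ((rtr \<rho> - rtr (T * \<rho>)) * (rtr \<sigma> - rtr (T * \<sigma>)))"
proof -
  define r s where "r = msqrt \<rho>" and "s = msqrt \<sigma>"
  have r: "psd d r" "r * r = \<rho>" and s: "psd d s" "s * s = \<sigma>"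
    using msqrt_psd[OF \<rho>] msqrt_square[OF \<rho>] msqrt_psd[OF \<sigma>] msqrt_square[OF \<sigma>] by (auto simp: r_def s_def)
  have c: "r \<in> carrier_mat d d" "s \<in> carrier_mat d d" using r s by auto
  obtain Y where Y: "contr d Y" "rtr (Y * (r * s)) = tnorm (r * s)"
    using tnorm_attained[of "r * s" d] c by auto
  have Yc: "Y \<in> carrier_mat d d" using Y by simp
  have *: "rtr (Y * (r * (E * s))) \<le> sqrt (rtr (E * \<rho>) * rtr (E * \<sigma>))" if E: "psd d E" for E
  proof -
    define R where "R = fc d E sqrt"
    have R: "psd d R" "R * R = E" using psd_root[OF E] by (auto simp: R_def)
    have Rc: "R \<in> carrier_mat d d" "E \<in> carrier_mat d d" using R E by auto
    have "rtr (Y * (r * (E * s))) = rtr (adj (R * r * adj Y) * (R * s))"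
      using c Rc Yc r(1) R(1) by (simp add: R(2)[symmetric] adj_mult[of _ d d _ d] assoc_square[of _ d])
    also have "\<dots> \<le> sqrt (rtr (adj (R * r * adj Y) * (R * r * adj Y))) * sqrt (rtr (adj (R * s) * (R * s)))"
      using c Rc Yc by (intro hilbert_schmidt_Cauchy_Schwarz) auto
    finally have 1: "rtr (Y * (r * (E * s))) \<le> \<dots>" .
    have "rtr (adj (R * s) * (R * s)) = rtr (s * (E * s))"
      using c Rc R(1) s(1) by (simp add: R(2)[symmetric] adj_mult[of _ d d _ d] assoc_square[of _ d])
    also have "\<dots> = rtr (E * s * s)" using c Rc by (intro rtr_mult_comm[of _ d]) auto
    also have "\<dots> = rtr (E * \<sigma>)" using c Rc by (simp add: s(2)[symmetric] assoc_square[of _ d])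
    finally have 2: "rtr (adj (R * s) * (R * s)) = rtr (E * \<sigma>)" .
    have 3: "rtr (adj (R * r * adj Y) * (R * r * adj Y)) \<le> rtr (E * \<rho>)"
    proof -
      have p: "psd d (r * E * r)" using psd_conj[OF E c(1)] r(1) by simp
      have "rtr (adj (R * r * adj Y) * (R * r * adj Y)) = rtr (Y * (r * E * r * adj Y))"
        using c Rc Yc r(1) R(1) by (simp add: R(2)[symmetric] adj_mult[of _ d d _ d] assoc_square[of _ d])
      also have "\<dots> = rtr (r * E * r * adj Y * Y)" using c Rc Yc by (intro rtr_mult_comm[of _ d]) auto
      also have "\<dots> = rtr (r * E * r * (adj Y * Y))" using c Rc Yc by (simp add: assoc_square[of _ d])
      also have "\<dots> = rtr (adj Y * Y * (r * E * r))" using c Rc Yc by (intro rtr_mult_comm[of _ d]) auto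
      finally have 4: "rtr (adj (R * r * adj Y) * (R * r * adj Y)) = rtr (adj Y * Y * (r * E * r))" .
      have "rtr (r * E * r) = rtr (r * (E * r))" using c Rc by (simp add: assoc_square[of _ d])
      also have "\<dots> = rtr (E * r * r)" using c Rc by (intro rtr_mult_comm[of _ d]) auto
      also have "\<dots> = rtr (E * \<rho>)" using c Rc by (simp add: r(2)[symmetric] assoc_square[of _ d])
      finally show ?thesis unfolding 4 using contr_rtr_le[OF Y(1) p] by (simp only:)
    qed
    have "0 \<le> sqrt (rtr (E * \<sigma>))" using psd_mult_rtr_nonneg[OF E \<sigma>] by simp
    from order.trans[OF 1[unfolded 2] mult_right_mono[OF real_sqrt_le_mono[OF 3] this]]
    show ?thesis by (simp add: real_sqrt_mult)
  qed
  have T1: "psd d T" "psd d (1\<^sub>m d - T)" "T \<in> carrier_mat d d"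
    using effD[OF T] eff_carrier[OF T] by blast+
  have 1: "fid \<rho> \<sigma> = rtr (Y * (r * (T * s))) + rtr (Y * (r * ((1\<^sub>m d - T) * s)))"
    using c Yc T1(3) Y by (simp add: mult_minus_square[of _ d] rtr_minus[of _ d] fid_def r_def s_def)
  have 2: "rtr ((1\<^sub>m d - T) * \<tau>) = rtr \<tau> - rtr (T * \<tau>)" if "\<tau> \<in> carrier_mat d d" for \<tau>
    using T1(3) that by (simp add: mult_minus_square[of _ d] rtr_minus[of _ d])
  show ?thesis using *[OF T1(1)] *[OF T1(2)]
    unfolding 1 2[OF psd_carrier[OF \<rho>]] 2[OF psd_carrier[OF \<sigma>]] by (rule add_mono)
qed

text \<open>The Fuchs-van de Graaf inequality for two outcomes: the squares of a, b and of a', b'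
  are the outcome probabilities, and the second distribution may lack a mass \<open>u\<close>.
  Lagrange's identity gives c^2 <= e^2 - u and g^2 <= 1 - u, so that |c g| <= e - u. The difference
  of the probabilities is c g plus at most u, and the two contributions add up to e.\<close>

lemma trace_distance_le_of_root_overlap:
  fixes a b a' b' e F :: real
  assumes "a\<^sup>2 + b\<^sup>2 = 1" "a'\<^sup>2 + b'\<^sup>2 \<le> 1" "0 \<le> F" "F \<le> a * a' + b * b'" "1 - F\<^sup>2 \<le> e\<^sup>2" "0 \<le> e"
  shows "\<bar>a\<^sup>2 - a'\<^sup>2\<bar> \<le> e"
proof (cases "e < 1")
  case True
  define u where "u = 1 - (a'\<^sup>2 + b'\<^sup>2)"
  define c where "c = a * b' - b * a'"
  define g where "g = a * b' + b * a'"
  have u0: "0 \<le> u" using assms by (simp add: u_def)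
  have "F\<^sup>2 \<le> (a * a' + b * b')\<^sup>2" using assms by (intro power_mono) auto
  also have "\<dots> = (a\<^sup>2 + b\<^sup>2) * (a'\<^sup>2 + b'\<^sup>2) - c\<^sup>2" by (simp add: c_def power2_eq_square algebra_simps)
  finally have c2: "c\<^sup>2 \<le> e\<^sup>2 - u" using assms by (simp add: u_def)
  have "g\<^sup>2 \<le> g\<^sup>2 + (a * a' - b * b')\<^sup>2" by simp
  also have "\<dots> = (a\<^sup>2 + b\<^sup>2) * (a'\<^sup>2 + b'\<^sup>2)" by (simp add: g_def power2_eq_square algebra_simps)
  finally have g2: "g\<^sup>2 \<le> 1 - u" using assms by (simp add: u_def)
  have "u \<le> e\<^sup>2" using c2 zero_le_power2[of c] by linarith
  also have "\<dots> \<le> e" using True assms by (simp add: power2_eq_square mult_left_le)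
  finally have ue: "u \<le> e" .
  have "\<bar>c * g\<bar> \<le> e - u"
  proof (rule power2_le_imp_le)
    have "\<bar>c * g\<bar>\<^sup>2 = c\<^sup>2 * g\<^sup>2" by (simp add: power_mult_distrib)
    also have "\<dots> \<le> (e\<^sup>2 - u) * (1 - u)"
    proof (rule mult_mono[OF c2 g2])
      show "0 \<le> e\<^sup>2 - u" using c2 zero_le_power2[of c] by linarith
    qed simp
    also have "\<dots> = (e - u)\<^sup>2 - u * (1 - e)\<^sup>2" by (simp add: power2_eq_square algebra_simps)
    also have "\<dots> \<le> (e - u)\<^sup>2" using u0 by simp
    finally show "\<bar>c * g\<bar>\<^sup>2 \<le> (e - u)\<^sup>2" .
  qed (use ue in simp)
  moreover have "a\<^sup>2 - a'\<^sup>2 = c * g + a\<^sup>2 * u"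
  proof -
    have "a\<^sup>2 - a'\<^sup>2 = a\<^sup>2 * (a'\<^sup>2 + b'\<^sup>2 + u) - a'\<^sup>2 * (a\<^sup>2 + b\<^sup>2)" using assms by (simp add: u_def)
    then show ?thesis by (simp add: c_def g_def power2_eq_square algebra_simps)
  qed
  moreover have "a\<^sup>2 \<le> 1" using assms(1) zero_le_power2[of b] by linarith
  then have "0 \<le> a\<^sup>2 * u" "a\<^sup>2 * u \<le> u" using u0 by (auto simp: mult_left_le_one_le)
  ultimately show ?thesis using u0 by linarith
next
  case False
  have "a\<^sup>2 \<le> 1" "a'\<^sup>2 \<le> 1" using assms(1,2) zero_le_power2[of b] zero_le_power2[of b'] by linarith+
  then have "\<bar>a\<^sup>2 - a'\<^sup>2\<bar> \<le> 1" using zero_le_power2[of a] zero_le_power2[of a'] by linarith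
  then show ?thesis using False by linarith
qed

lemma pdist_fid: "pdist \<rho> \<sigma> \<le> e \<Longrightarrow> 0 \<le> e \<Longrightarrow> 1 - (fid \<rho> \<sigma>)\<^sup>2 \<le> e\<^sup>2"
  unfolding pdist_def by (rule sqrt_le_D)

lemma eff_rtr_bounds:
  assumes "eff d T" "psd d \<rho>"
  shows "0 \<le> rtr (T * \<rho>)" "rtr (T * \<rho>) \<le> rtr \<rho>"
  using psd_mult_rtr_nonneg[OF effD(1)[OF assms(1)] assms(2)] rtr_mult_mono[OF effD(2)[OF assms(1)] assms(2)]
    eff_carrier[OF assms(1)] psd_carrier[OF assms(2)] by simp_all

text \<open>Smoothing enters the achievability proof only through this estimate: the passage between
  a state and its smoothed version costs \<open>e\<close> for each test.\<close>

lemma pdist_test: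
  assumes "dens d \<rho>" "subdens d \<sigma>" "pdist \<rho> \<sigma> \<le> e" "0 \<le> e" "eff d T"
  shows "\<bar>rtr (T * \<rho>) - rtr (T * \<sigma>)\<bar> \<le> e"
proof -
  have \<rho>: "psd d \<rho>" "rtr \<rho> = 1" and \<sigma>: "psd d \<sigma>" "rtr \<sigma> \<le> 1"
    using assms by (auto simp: dens_def subdens_def rtr_def)
  define a b a' b' where "a = sqrt (rtr (T * \<rho>))" and "b = sqrt (rtr \<rho> - rtr (T * \<rho>))"
    and "a' = sqrt (rtr (T * \<sigma>))" and "b' = sqrt (rtr \<sigma> - rtr (T * \<sigma>))"
  note bd = eff_rtr_bounds[OF assms(5) \<rho>(1)] eff_rtr_bounds[OF assms(5) \<sigma>(1)]
  have sq: "a\<^sup>2 = rtr (T * \<rho>)" "b\<^sup>2 = rtr \<rho> - rtr (T * \<rho>)" "a'\<^sup>2 = rtr (T * \<sigma>)" "b'\<^sup>2 = rtr \<sigma> - rtr (T * \<sigma>)"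
    using bd by (auto simp: a_def b_def a'_def b'_def)
  have "\<bar>a\<^sup>2 - a'\<^sup>2\<bar> \<le> e"
  proof (rule trace_distance_le_of_root_overlap)
    show "a\<^sup>2 + b\<^sup>2 = 1" "a'\<^sup>2 + b'\<^sup>2 \<le> 1" using \<rho> \<sigma> by (auto simp: sq)
    show "0 \<le> fid \<rho> \<sigma>" by (rule fid_nonneg[OF \<rho>(1) \<sigma>(1)])
    show "fid \<rho> \<sigma> \<le> a * a' + b * b'"
      using fid_test_le[OF \<rho>(1) \<sigma>(1) assms(5)] by (simp add: a_def b_def a'_def b'_def real_sqrt_mult)
    show "1 - (fid \<rho> \<sigma>)\<^sup>2 \<le> e\<^sup>2" using pdist_fid[OF assms(3,4)] .
    show "0 \<le> e" by fact
  qed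
  then show ?thesis by (simp add: sq)
qed

lemma fid_le_psd:
  assumes "psd d \<rho>" "psd d \<sigma>"
  shows "fid \<rho> \<sigma> \<le> sqrt (rtr \<rho>) * sqrt (rtr \<sigma>)"
  using fid_le_sqrt_rtr[of "msqrt \<rho>" d "msqrt \<sigma>"] assms msqrt_psd[of d \<rho>] msqrt_psd[of d \<sigma>]
  by (simp add: msqrt_square)

section \<open>Mixtures, block-diagonal matrices and partial traces\<close>

lemma mix_carrier [simp]: "mix d w M n \<in> carrier_mat d d"
  by (simp add: mix_def)

lemma mix_index: "i < d \<Longrightarrow> j < d \<Longrightarrow> mix d w M n $$ (i, j) = (\<Sum>x<n. complex_of_real (w x) * M x $$ (i, j))"
  by (simp add: mix_def)

lemma mix_0 [simp]: "mix d w M 0 = 0\<^sub>m d d"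
  by (rule eq_matI) (auto simp: mix_def)

lemma mix_Suc: "M n \<in> carrier_mat d d \<Longrightarrow> mix d w M (Suc n) = mix d w M n + complex_of_real (w n) \<cdot>\<^sub>m M n"
  by (rule eq_matI) (auto simp: mix_def)

lemma mix_psd:
  "(\<And>x. x < n \<Longrightarrow> psd d (M x)) \<Longrightarrow> (\<And>x. x < n \<Longrightarrow> 0 \<le> w x) \<Longrightarrow> psd d (mix d w M n)"
proof (induction n)
  case (Suc n)
  have "psd d (mix d w M n)" by (rule Suc.IH) (use Suc.prems in auto)
  moreover have "psd d (complex_of_real (w n) \<cdot>\<^sub>m M n)" using Suc.prems by (intro psd_smult) auto
  ultimately have "psd d (mix d w M n + complex_of_real (w n) \<cdot>\<^sub>m M n)" by (rule psd_add)
  then show ?case using mix_Suc[of M n d w] psd_carrier[OF Suc.prems(1)[of n]] by simp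
qed simp

lemma rtr_mult_mix:
  assumes "A \<in> carrier_mat d d"
  shows "(\<And>x. x < n \<Longrightarrow> M x \<in> carrier_mat d d) \<Longrightarrow>
    rtr (A * mix d w M n) = (\<Sum>x<n. w x * rtr (A * M x))"
proof (induction n)
  case 0
  then show ?case using assms by (simp add: right_mult_zero_mat[of _ d d])
next
  case (Suc n)
  have c: "M n \<in> carrier_mat d d" using Suc.prems by simp
  have IH: "rtr (A * mix d w M n) = (\<Sum>x<n. w x * rtr (A * M x))" using Suc by simp
  have "A * mix d w M (Suc n) = A * mix d w M n + complex_of_real (w n) \<cdot>\<^sub>m (A * M n)"
    unfolding mix_Suc[of M, OF c] using assms c
    by (simp add: mult_add_square[of _ d] mult_smult_distrib[of _ d d _ d])
  then show ?case using IH assms c by (simp add: rtr_add[of _ d] rtr_smult[of _ d])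
qed

lemma rtr_mix: "(\<And>x. x < n \<Longrightarrow> M x \<in> carrier_mat d d) \<Longrightarrow> rtr (mix d w M n) = (\<Sum>x<n. w x * rtr (M x))"
  using rtr_mult_mix[of "1\<^sub>m d" d n M w] by simp

lemma mix_herm:
  assumes "\<And>x. x < n \<Longrightarrow> herm d (M x)" shows "herm d (mix d w M n)"
proof -
  have "adj (mix d w M n) = mix d w M n"
  proof (rule eq_matI)
    fix i j assume "i < dim_row (mix d w M n)" "j < dim_col (mix d w M n)"
    then have ij: "i < d" "j < d" by (auto simp: mix_def)
    have "cnj (M x $$ (j, i)) = M x $$ (i, j)" if "x < n" for x
    proof -
      have "adj (M x) = M x" "M x \<in> carrier_mat d d" using assms[OF that] by (auto simp: herm_def)
      then show ?thesis using ij adj_index[of "M x" d d i j] by simp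
    qed
    then show "adj (mix d w M n) $$ (i, j) = mix d w M n $$ (i, j)"
      using ij by (simp add: adj_index[of _ d d] mix_index)
  qed (auto simp: mix_def)
  then show ?thesis by (simp add: herm_def)
qed

lemma densD: assumes "dens d \<rho>" shows "psd d \<rho>" "rtr \<rho> = 1" "\<rho> \<in> carrier_mat d d"
  using assms by (auto simp: dens_def rtr_def)

lemma mtrace_psd:
  assumes "psd d A" shows "mtrace A = complex_of_real (rtr A)"
proof -
  have "cnj (A $$ (i, i)) = A $$ (i, i)" if "i < d" for i
    using adj_index[of A d d i i] psd_adj[OF assms] psd_carrier[OF assms] that by simp
  then have "Im (A $$ (i, i)) = 0" if "i < d" for i
    using that by (metis complex_cnj_cancel_iff complex_eq_iff cnj.sel(2) neg_equal_zero)
  then show ?thesis using psd_carrier[OF assms] by (simp add: rtr_def mtrace_eq[of _ d d] complex_eq_iff)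
qed

lemma densI: "psd d \<rho> \<Longrightarrow> rtr \<rho> = 1 \<Longrightarrow> dens d \<rho>"
  using mtrace_psd[of d \<rho>] by (simp add: dens_def)

lemma mix_dens:
  assumes "pdistr n w" "\<And>x. x < n \<Longrightarrow> dens d (M x)"
  shows "dens d (mix d w M n)"
proof (rule densI)
  show "psd d (mix d w M n)" using assms densD(1) by (intro mix_psd) (auto simp: pdistr_def)
  have "rtr (mix d w M n) = (\<Sum>x<n. w x * rtr (M x))" using assms(2) densD(3) by (intro rtr_mix) blast
  also have "\<dots> = (\<Sum>x<n. w x)" using assms(2) densD(2) by (intro sum.cong) auto
  finally show "rtr (mix d w M n) = 1" using assms(1) by (simp add: pdistr_def)
qed

lemma mix_mult_left:
  assumes "A \<in> carrier_mat d d"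
  shows "(\<And>x. x < n \<Longrightarrow> M x \<in> carrier_mat d d) \<Longrightarrow> A * mix d w M n = mix d w (\<lambda>x. A * M x) n"
proof (induction n)
  case 0
  then show ?case using assms by (simp add: right_mult_zero_mat[of _ d d])
next
  case (Suc n)
  have c: "M n \<in> carrier_mat d d" using Suc.prems by simp
  have IH: "A * mix d w M n = mix d w (\<lambda>x. A * M x) n" using Suc by simp
  show ?case
    using assms c by (simp add: mix_Suc[of M, OF c] mix_Suc[of "\<lambda>x. A * M x"] IH[symmetric]
        mult_add_square[of _ d] mult_smult_distrib[of _ d d _ d])
qed

lemma mix_mult_right:
  assumes "A \<in> carrier_mat d d"
  shows "(\<And>x. x < n \<Longrightarrow> M x \<in> carrier_mat d d) \<Longrightarrow> mix d w M n * A = mix d w (\<lambda>x. M x * A) n"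
proof (induction n)
  case 0
  then show ?case using assms by (simp add: left_mult_zero_mat[of _ d d])
next
  case (Suc n)
  have c: "M n \<in> carrier_mat d d" using Suc.prems by simp
  have IH: "mix d w M n * A = mix d w (\<lambda>x. M x * A) n" using Suc by simp
  show ?case
    using assms c by (simp add: mix_Suc[of M, OF c] mix_Suc[of "\<lambda>x. M x * A"] IH[symmetric]
        mult_add_square[of _ d] mult_smult_assoc_mat[of _ d d _ d])
qed

section \<open>Principal submatrices and block-diagonal matrices\<close>

definition submat :: "nat \<Rightarrow> (nat \<Rightarrow> nat) \<Rightarrow> complex mat \<Rightarrow> complex mat" where
  "submat d \<phi> A = mat d d (\<lambda>(i, j). A $$ (\<phi> i, \<phi> j))"

lemma submat_carrier [simp]: "submat d \<phi> A \<in> carrier_mat d d"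
  by (simp add: submat_def)

text \<open>Vectors are extended by zero outside the range of \<phi>. Diagonal blocks and the
  summands of both partial traces are such submatrices, so their positivity comes from here.\<close>

lemma psd_submat:
  assumes A: "psd n A" and inj: "inj_on \<phi> {..<d}" and lt: "\<And>i. i < d \<Longrightarrow> \<phi> i < n"
  shows "psd d (submat d \<phi> A)"
proof -
  have Ac: "A \<in> carrier_mat n n" using A by simp
  have *: "ip v (submat d \<phi> A *\<^sub>v v) \<in> {ip w (A *\<^sub>v w) | w. w \<in> carrier_vec n}" if v: "v \<in> carrier_vec d" for v
  proof -
    define w where "w = vec n (\<lambda>p. if p \<in> \<phi> ` {..<d} then v $ (the_inv_into {..<d} \<phi> p) else 0)"
    have w: "w \<in> carrier_vec n" by (simp add: w_def)
    have w1: "w $ (\<phi> i) = v $ i" if "i < d" for i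
      using that lt inj by (simp add: w_def the_inv_into_f_f)
    have w0: "w $ p = 0" if "p < n" "p \<notin> \<phi> ` {..<d}" for p using that by (simp add: w_def)
    have img: "\<phi> ` {..<d} \<subseteq> {..<n}" using lt by auto
    have red: "(\<Sum>p<n. f p) = (\<Sum>i<d. f (\<phi> i))" if "\<And>p. p < n \<Longrightarrow> p \<notin> \<phi> ` {..<d} \<Longrightarrow> f p = 0" for f :: "nat \<Rightarrow> complex"
    proof -
      have "(\<Sum>p<n. f p) = (\<Sum>p\<in>\<phi> ` {..<d}. f p)"
        using img that by (intro sum.mono_neutral_right) auto
      then show ?thesis using inj by (simp add: sum.reindex)
    qed
    have Aw: "(A *\<^sub>v w) $ (\<phi> i) = (submat d \<phi> A *\<^sub>v v) $ i" if "i < d" for i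
    proof -
      have "(A *\<^sub>v w) $ (\<phi> i) = (\<Sum>q<n. A $$ (\<phi> i, q) * w $ q)"
        using mult_vec_index[OF Ac w lt[OF that]] .
      also have "\<dots> = (\<Sum>j<d. A $$ (\<phi> i, \<phi> j) * w $ (\<phi> j))" by (rule red) (simp add: w0)
      also have "\<dots> = (\<Sum>j<d. submat d \<phi> A $$ (i, j) * v $ j)"
        using that w1 by (intro sum.cong) (auto simp: submat_def)
      also have "\<dots> = (submat d \<phi> A *\<^sub>v v) $ i" using mult_vec_index[OF submat_carrier v that] by simp
      finally show ?thesis .
    qed
    have "ip w (A *\<^sub>v w) = (\<Sum>p<n. cnj (w $ p) * (A *\<^sub>v w) $ p)" using Ac by (simp add: ip_def)
    also have "\<dots> = (\<Sum>i<d. cnj (w $ (\<phi> i)) * (A *\<^sub>v w) $ (\<phi> i))" by (rule red) (simp add: w0)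
    also have "\<dots> = ip v (submat d \<phi> A *\<^sub>v v)"
      unfolding ip_def using w1 Aw by (intro sum.cong) (auto simp: submat_def)
    finally show ?thesis using w by (intro CollectI exI[of _ w]) simp
  qed
  show ?thesis unfolding psd_def'
  proof (intro conjI ballI submat_carrier)
    fix v :: "complex vec" assume "v \<in> carrier_vec d"
    then obtain w where "w \<in> carrier_vec n" "ip v (submat d \<phi> A *\<^sub>v v) = ip w (A *\<^sub>v w)" using * by auto
    then show "Im (ip v (submat d \<phi> A *\<^sub>v v)) = 0" "0 \<le> Re (ip v (submat d \<phi> A *\<^sub>v v))"
      using A unfolding psd_def' by auto
  qed
qed

abbreviation blk :: "nat \<Rightarrow> nat \<Rightarrow> complex mat \<Rightarrow> complex mat" where
  "blk d t A \<equiv> submat d (\<lambda>i. t * d + i) A"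

lemma block_index_less: "t < k \<Longrightarrow> i < d \<Longrightarrow> t * d + i < k * (d::nat)"
proof -
  assume "t < k" "i < d"
  then have "t * d + i < t * d + d" "(t + 1) * d \<le> k * d" by (simp, intro mult_le_mono1, simp)
  then show ?thesis by simp
qed

lemma sum_blocks: "(\<Sum>p<k * d. f p) = (\<Sum>t<k. \<Sum>i<(d::nat). f (t * d + i))"
proof -
  have "sum f {t * d..<t * d + d} = (\<Sum>i<d. f (t * d + i))" for t
    using sum.shift_bounds_nat_ivl[of f 0 "t * d" d] by (simp add: atLeast0LessThan add.commute)
  then show ?thesis by (simp add: sum.nat_group[symmetric])
qed

lemma psd_blk: "psd (k * d) A \<Longrightarrow> t < k \<Longrightarrow> psd d (blk d t A)"
  by (rule psd_submat) (auto simp: inj_on_def block_index_less)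

lemma blk_diff: "A \<in> carrier_mat (k * d) (k * d) \<Longrightarrow> B \<in> carrier_mat (k * d) (k * d) \<Longrightarrow> t < k \<Longrightarrow>
   blk d t (A - B) = blk d t A - blk d t B"
  by (rule eq_matI) (auto simp: submat_def block_index_less)

lemma blk_one: "t < k \<Longrightarrow> blk d t (1\<^sub>m (k * d)) = 1\<^sub>m d"
  by (rule eq_matI) (auto simp: submat_def block_index_less)

lemma eff_blk:
  assumes "eff (k * d) T" "t < k" shows "eff d (blk d t T)"
proof -
  have "psd d (blk d t (1\<^sub>m (k * d) - T))" using psd_blk[OF effD(2)[OF assms(1)] assms(2)] .
  also have "blk d t (1\<^sub>m (k * d) - T) = 1\<^sub>m d - blk d t T"
    using blk_diff[of "1\<^sub>m (k * d)" k d T t] eff_carrier[OF assms(1)] assms(2) by (simp add: blk_one)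
  finally show ?thesis unfolding eff_def using psd_blk[OF effD(1)[OF assms(1)] assms(2)] by simp
qed

text \<open>The general classical-quantum operator, with the classical register as block index. Cq
  states and operators of the form identity tensor \<sigma> are both rewritten into it, after which
  products, adjoints and traces are computed block by block.\<close>

definition bdiag :: "nat \<Rightarrow> nat \<Rightarrow> (nat \<Rightarrow> complex mat) \<Rightarrow> complex mat" where
  "bdiag k d M = mat (k * d) (k * d) (\<lambda>(p, q).
     if p div d = q div d then M (p div d) $$ (p mod d, q mod d) else 0)"

lemma bdiag_carrier [simp]: "bdiag k d M \<in> carrier_mat (k * d) (k * d)"
  by (simp add: bdiag_def)

lemma bdiag_index:
  "t < k \<Longrightarrow> i < d \<Longrightarrow> s < k \<Longrightarrow> j < d \<Longrightarrow>
   bdiag k d M $$ (t * d + i, s * d + j) = (if t = s then M t $$ (i, j) else 0)"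
  by (auto simp: bdiag_def block_index_less)

lemma eq_blocksI:
  assumes "A \<in> carrier_mat (k * d) (k * d)" "B \<in> carrier_mat (k * d) (k * d)"
    "\<And>t s i j. t < k \<Longrightarrow> s < k \<Longrightarrow> i < d \<Longrightarrow> j < d \<Longrightarrow> A $$ (t * d + i, s * d + j) = B $$ (t * d + i, s * d + j)"
  shows "A = B"
proof (rule eq_matI)
  fix p q assume "p < dim_row B" "q < dim_col B"
  then have pq: "p < k * d" "q < k * d" using assms(2) by auto
  then have d: "0 < d" by (cases d) auto
  have "A $$ (p div d * d + p mod d, q div d * d + q mod d) = B $$ (p div d * d + p mod d, q div d * d + q mod d)"
    using pq d by (intro assms(3)) (auto simp: less_mult_imp_div_less)
  then show "A $$ (p, q) = B $$ (p, q)" by simp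
qed (use assms in auto)

lemma bdiag_mult:
  assumes "\<And>t. t < k \<Longrightarrow> M t \<in> carrier_mat d d" "\<And>t. t < k \<Longrightarrow> N t \<in> carrier_mat d d"
  shows "bdiag k d M * bdiag k d N = bdiag k d (\<lambda>t. M t * N t)"
proof (rule eq_blocksI[of _ k d])
  fix t s i j assume h: "t < k" "s < k" "i < d" "j < d"
  have "(bdiag k d M * bdiag k d N) $$ (t * d + i, s * d + j)
    = (\<Sum>u<k. \<Sum>l<d. bdiag k d M $$ (t * d + i, u * d + l) * bdiag k d N $$ (u * d + l, s * d + j))"
    using h by (subst mult_index[of _ "k * d" "k * d" _ "k * d"]) (auto simp: sum_blocks block_index_less)
  also have "\<dots> = (\<Sum>u<k. if u = t then (\<Sum>l<d. M t $$ (i, l) * (if t = s then N t $$ (l, j) else 0)) else 0)"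
    using h by (intro sum.cong) (auto simp: bdiag_index)
  also have "\<dots> = (if t = s then (M t * N t) $$ (i, j) else 0)"
    using h assms by (auto simp: mult_index[of _ d d _ d])
  finally show "(bdiag k d M * bdiag k d N) $$ (t * d + i, s * d + j) = bdiag k d (\<lambda>t. M t * N t) $$ (t * d + i, s * d + j)"
    using h by (simp add: bdiag_index)
qed auto

lemma bdiag_adj:
  assumes "\<And>t. t < k \<Longrightarrow> M t \<in> carrier_mat d d"
  shows "adj (bdiag k d M) = bdiag k d (\<lambda>t. adj (M t))"
proof (rule eq_blocksI[of _ k d])
  fix t s i j assume h: "t < k" "s < k" "i < d" "j < d"
  then show "adj (bdiag k d M) $$ (t * d + i, s * d + j) = bdiag k d (\<lambda>t. adj (M t)) $$ (t * d + i, s * d + j)"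
    using assms by (simp add: adj_index[of _ "k * d" "k * d"] block_index_less bdiag_index adj_index[of _ d d])
qed auto

lemma bdiag_cong: "(\<And>t. t < k \<Longrightarrow> M t = N t) \<Longrightarrow> bdiag k d M = bdiag k d N"
  by (rule eq_blocksI[of _ k d]) (auto simp: bdiag_index)

lemma bdiag_diff:
  assumes "\<And>t. t < k \<Longrightarrow> M t \<in> carrier_mat d d" "\<And>t. t < k \<Longrightarrow> N t \<in> carrier_mat d d"
  shows "bdiag k d M - bdiag k d N = bdiag k d (\<lambda>t. M t - N t)"
proof (rule eq_blocksI[of _ k d])
  fix t s i j assume h: "t < k" "s < k" "i < d" "j < d"
  then show "(bdiag k d M - bdiag k d N) $$ (t * d + i, s * d + j) = bdiag k d (\<lambda>t. M t - N t) $$ (t * d + i, s * d + j)"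
    using carrier_matD[OF assms(2)[OF h(1)]]
    by (cases "t = s") (simp_all add: block_index_less bdiag_index carrier_matD[OF bdiag_carrier])
qed auto

lemma bdiag_smult:
  assumes "\<And>t. t < k \<Longrightarrow> M t \<in> carrier_mat d d"
  shows "c \<cdot>\<^sub>m bdiag k d M = bdiag k d (\<lambda>t. c \<cdot>\<^sub>m M t)"
proof (rule eq_blocksI[of _ k d])
  fix t s i j assume h: "t < k" "s < k" "i < d" "j < d"
  then show "(c \<cdot>\<^sub>m bdiag k d M) $$ (t * d + i, s * d + j) = bdiag k d (\<lambda>t. c \<cdot>\<^sub>m M t) $$ (t * d + i, s * d + j)"
    using carrier_matD[OF assms[OF h(1)]]
    by (cases "t = s") (simp_all add: block_index_less bdiag_index carrier_matD[OF bdiag_carrier])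
qed auto

lemma psd_bdiag:
  assumes "\<And>t. t < k \<Longrightarrow> psd d (M t)"
  shows "psd (k * d) (bdiag k d M)"
proof -
  define R where "R t = fc d (M t) sqrt" for t
  have R: "adj (R t) = R t" "R t * R t = M t" "R t \<in> carrier_mat d d" if "t < k" for t
    using psd_root[OF assms[OF that]] by (auto simp: R_def)
  have "adj (bdiag k d R) * bdiag k d R = bdiag k d (\<lambda>t. adj (R t) * R t)"
    using R(3) by (simp add: bdiag_adj bdiag_mult)
  also have "\<dots> = bdiag k d M" using R by (intro bdiag_cong) simp
  finally show ?thesis using psd_adj_mult[of "bdiag k d R" "k * d"] by simp
qed

text \<open>Against a block-diagonal operator an arbitrary \<open>A\<close> counts only through its
  diagonal blocks. Hence a joint test of the register and the quantum system splits into one test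
  per symbol.\<close>

lemma rtr_mult_bdiag:
  assumes "A \<in> carrier_mat (k * d) (k * d)" "\<And>t. t < k \<Longrightarrow> M t \<in> carrier_mat d d"
  shows "rtr (A * bdiag k d M) = (\<Sum>t<k. rtr (blk d t A * M t))"
proof -
  have e: "(A * bdiag k d M) $$ (t * d + i, t * d + i) = (blk d t A * M t) $$ (i, i)" if h: "t < k" "i < d" for t i
  proof -
    have "(A * bdiag k d M) $$ (t * d + i, t * d + i)
      = (\<Sum>u<k. \<Sum>l<d. A $$ (t * d + i, u * d + l) * bdiag k d M $$ (u * d + l, t * d + i))"
      using h assms(1) by (subst mult_index[of _ "k * d" "k * d" _ "k * d"]) (auto simp: sum_blocks block_index_less)
    also have "\<dots> = (\<Sum>u<k. if u = t then (\<Sum>l<d. A $$ (t * d + i, t * d + l) * M t $$ (l, i)) else 0)"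
      using h by (intro sum.cong) (auto simp: bdiag_index)
    also have "\<dots> = (\<Sum>l<d. blk d t A $$ (i, l) * M t $$ (l, i))"
      using h by (simp add: submat_def)
    also have "\<dots> = (blk d t A * M t) $$ (i, i)"
      using h assms(2) by (simp add: mult_index[of _ d d _ d])
    finally show ?thesis .
  qed
  have "rtr (A * bdiag k d M) = (\<Sum>p<k * d. Re ((A * bdiag k d M) $$ (p, p)))"
    using assms(1) by (simp add: rtr_def mtrace_eq[of _ "k * d" "k * d"])
  also have "\<dots> = (\<Sum>t<k. \<Sum>i<d. Re ((blk d t A * M t) $$ (i, i)))"
    unfolding sum_blocks using e by (intro sum.cong refl) simp
  also have "\<dots> = (\<Sum>t<k. rtr (blk d t A * M t))"
    using assms(2) by (intro sum.cong) (auto simp: rtr_def mtrace_eq[of _ d d])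
  finally show ?thesis .
qed

lemma rtr_bdiag:
  assumes "\<And>t. t < k \<Longrightarrow> M t \<in> carrier_mat d d"
  shows "rtr (bdiag k d M) = (\<Sum>t<k. rtr (M t))"
  using rtr_mult_bdiag[of "1\<^sub>m (k * d)" k d M] assms by (simp add: blk_one)

lemma kron_one_eq_bdiag:
  assumes "\<sigma> \<in> carrier_mat d d" "0 < d"
  shows "kron (1\<^sub>m k) \<sigma> = bdiag k d (\<lambda>_. \<sigma>)"
  using assms by (intro eq_blocksI[of _ k d]) (auto simp: kron_def bdiag_index block_index_less)

lemma cq_state_eq_bdiag:
  assumes "\<And>t. t < k \<Longrightarrow> \<theta> t \<in> carrier_mat d d" "0 < d"
  shows "cq_state k d P \<theta> = bdiag k d (\<lambda>t. complex_of_real (P t) \<cdot>\<^sub>m \<theta> t)"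
proof (rule eq_blocksI[of _ k d])
  fix t s i j assume h: "t < k" "s < k" "i < d" "j < d"
  have "cq_state k d P \<theta> $$ (t * d + i, s * d + j)
    = (\<Sum>x<k. complex_of_real (P x) * kron (ketbra k x) (\<theta> x) $$ (t * d + i, s * d + j))"
    using h by (simp add: cq_state_def mix_index block_index_less)
  also have "\<dots> = (\<Sum>x<k. if x = t then (if t = s then complex_of_real (P t) * \<theta> t $$ (i, j) else 0) else 0)"
  proof (rule sum.cong[OF refl])
    fix x assume "x \<in> {..<k}"
    then have x: "x < k" by simp
    have c: "dim_row (\<theta> x) = d" "dim_col (\<theta> x) = d" using assms(1)[OF x] by auto
    show "complex_of_real (P x) * kron (ketbra k x) (\<theta> x) $$ (t * d + i, s * d + j) =
      (if x = t then (if t = s then complex_of_real (P t) * \<theta> t $$ (i, j) else 0) else 0)"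
      using h x c assms(2) by (auto simp: kron_def ketbra_def block_index_less)
  qed
  also have "\<dots> = bdiag k d (\<lambda>t. complex_of_real (P t) \<cdot>\<^sub>m \<theta> t) $$ (t * d + i, s * d + j)"
    using h carrier_matD[OF assms(1)[OF h(1)]] by (cases "t = s") (simp_all add: bdiag_index)
  finally show "cq_state k d P \<theta> $$ (t * d + i, s * d + j) = \<dots>" .
qed (auto simp: cq_state_def)

lemma rtr_mult_cq_state:
  assumes "T \<in> carrier_mat (k * d) (k * d)" "\<And>t. t < k \<Longrightarrow> X t \<in> carrier_mat d d" "0 < d"
  shows "rtr (T * cq_state k d P X) = (\<Sum>t<k. P t * rtr (blk d t T * X t))"
proof -
  have "rtr (T * cq_state k d P X) = (\<Sum>t<k. rtr (blk d t T * (complex_of_real (P t) \<cdot>\<^sub>m X t)))"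
    using assms by (subst cq_state_eq_bdiag) (auto intro!: rtr_mult_bdiag)
  also have "\<dots> = (\<Sum>t<k. P t * rtr (blk d t T * X t))"
  proof (intro sum.cong refl)
    fix t assume "t \<in> {..<k}"
    then have "X t \<in> carrier_mat d d" using assms by simp
    then show "rtr (blk d t T * (complex_of_real (P t) \<cdot>\<^sub>m X t)) = P t * rtr (blk d t T * X t)"
      by (simp add: mult_smult_distrib[of _ d d _ d] rtr_smult[of _ d])
  qed
  finally show ?thesis .
qed

lemma cq_state_dens:
  assumes "\<And>t. t < k \<Longrightarrow> dens d (\<theta> t)" "pdistr k P" "0 < d"
  shows "dens (k * d) (cq_state k d P \<theta>)"
proof (rule densI)
  have c: "\<theta> t \<in> carrier_mat d d" "psd d (\<theta> t)" "rtr (\<theta> t) = 1" if "t < k" for t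
    using densD[OF assms(1)[OF that]] by auto
  have eq: "cq_state k d P \<theta> = bdiag k d (\<lambda>t. complex_of_real (P t) \<cdot>\<^sub>m \<theta> t)"
    using c assms(3) by (intro cq_state_eq_bdiag) auto
  show "psd (k * d) (cq_state k d P \<theta>)"
    unfolding eq using c assms(2) by (intro psd_bdiag psd_smult) (auto simp: pdistr_def)
  have "rtr (cq_state k d P \<theta>) = (\<Sum>t<k. rtr (complex_of_real (P t) \<cdot>\<^sub>m \<theta> t))"
    unfolding eq using c by (intro rtr_bdiag) auto
  also have "\<dots> = (\<Sum>t<k. P t)" using c by (intro sum.cong) (auto simp: rtr_smult[of _ d])
  finally show "rtr (cq_state k d P \<theta>) = 1" using assms(2) by (simp add: pdistr_def)
qed

section \<open>Partial traces\<close>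

lemma ptr_last_eq: "ptr a b 1 \<rho> = mix a (\<lambda>_. 1) (\<lambda>k. submat a (\<lambda>i. i * b + k) \<rho>) b"
  by (rule eq_matI) (auto simp: ptr_def mix_def submat_def intro!: sum.cong)

lemma ptr_first_eq: "ptr 1 a b \<rho> = mix b (\<lambda>_. 1) (\<lambda>k. blk b k \<rho>) a"
  by (rule eq_matI) (auto simp: ptr_def mix_def submat_def intro!: sum.cong)

lemma ptr_last_index: "i < a \<Longrightarrow> j < a \<Longrightarrow> ptr a b 1 \<rho> $$ (i, j) = (\<Sum>k<b. \<rho> $$ (i * b + k, j * b + k))"
  unfolding ptr_last_eq by (simp add: mix_index submat_def)

lemma ptr_first_index: "i < b \<Longrightarrow> j < b \<Longrightarrow> ptr 1 a b \<rho> $$ (i, j) = (\<Sum>k<a. \<rho> $$ (k * b + i, k * b + j))"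
  unfolding ptr_first_eq by (simp add: mix_index submat_def)

lemma dens_ptr_last:
  assumes "dens (a * b) \<rho>"
  shows "dens a (ptr a b 1 \<rho>)"
proof (rule densI)
  have "psd a (submat a (\<lambda>i. i * b + k) \<rho>)" if "k < b" for k
    using that by (intro psd_submat[OF densD(1)[OF assms]]) (auto simp: inj_on_def block_index_less)
  then show "psd a (ptr a b 1 \<rho>)" unfolding ptr_last_eq by (intro mix_psd) auto
  have "rtr (ptr a b 1 \<rho>) = (\<Sum>i<a. Re (ptr a b 1 \<rho> $$ (i, i)))"
    by (simp add: rtr_def mtrace_def ptr_def)
  also have "\<dots> = (\<Sum>i<a. \<Sum>k<b. Re (\<rho> $$ (i * b + k, i * b + k)))"
    by (intro sum.cong) (simp_all add: ptr_last_index[unfolded One_nat_def])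
  also have "\<dots> = rtr \<rho>" using densD(3)[OF assms]
    by (simp add: rtr_def mtrace_eq[of _ "a * b" "a * b"] sum_blocks)
  finally show "rtr (ptr a b 1 \<rho>) = 1" using densD(2)[OF assms] by simp
qed

lemma dens_ptr_first:
  assumes "dens (a * b) \<rho>"
  shows "dens b (ptr 1 a b \<rho>)"
proof (rule densI)
  show "psd b (ptr 1 a b \<rho>)" unfolding ptr_first_eq
    using psd_blk[OF densD(1)[OF assms]] by (intro mix_psd) auto
  have "rtr (ptr 1 a b \<rho>) = (\<Sum>i<b. Re (ptr 1 a b \<rho> $$ (i, i)))"
    by (simp add: rtr_def mtrace_def ptr_def)
  also have "\<dots> = (\<Sum>i<b. \<Sum>k<a. Re (\<rho> $$ (k * b + i, k * b + i)))"
    by (intro sum.cong) (simp_all add: ptr_first_index[unfolded One_nat_def])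
  also have "\<dots> = (\<Sum>k<a. \<Sum>i<b. Re (\<rho> $$ (k * b + i, k * b + i)))" by (rule sum.swap)
  also have "\<dots> = rtr \<rho>" using densD(3)[OF assms]
    by (simp add: rtr_def mtrace_eq[of _ "a * b" "a * b"] sum_blocks)
  finally show "rtr (ptr 1 a b \<rho>) = 1" using densD(2)[OF assms] by simp
qed

lemma ptr_cq_state_classical:
  assumes "\<And>t. t < k \<Longrightarrow> dens d (\<theta> t)" "0 < d"
  shows "ptr k d 1 (cq_state k d P \<theta>) = cq_state k 1 P (\<lambda>_. 1\<^sub>m 1)"
proof -
  have c: "\<theta> t \<in> carrier_mat d d" if "t < k" for t using densD(3)[OF assms(1)[OF that]] .
  have eq: "cq_state k d P \<theta> = bdiag k d (\<lambda>t. complex_of_real (P t) \<cdot>\<^sub>m \<theta> t)"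
    using c assms(2) by (rule cq_state_eq_bdiag)
  have eq1: "cq_state k 1 P (\<lambda>_. 1\<^sub>m 1) = bdiag k 1 (\<lambda>t. complex_of_real (P t) \<cdot>\<^sub>m 1\<^sub>m 1)"
    by (rule cq_state_eq_bdiag) auto
  show ?thesis
  proof (rule eq_matI)
    fix i j assume "i < dim_row (cq_state k 1 P (\<lambda>_. 1\<^sub>m 1))" "j < dim_col (cq_state k 1 P (\<lambda>_. 1\<^sub>m 1))"
    then have ij: "i < k" "j < k" by (auto simp: cq_state_def mix_def)
    have "ptr k d 1 (cq_state k d P \<theta>) $$ (i, j) = (\<Sum>l<d. if i = j then complex_of_real (P i) * \<theta> i $$ (l, l) else 0)"
      unfolding ptr_last_index[OF ij] eq using ij carrier_matD[OF c[OF ij(1)]]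
      by (cases "i = j") (simp_all add: bdiag_index)
    also have "\<dots> = (if i = j then complex_of_real (P i) else 0)"
    proof (cases "i = j")
      case True
      have "mtrace (\<theta> i) = 1" using assms(1)[OF ij(1)] by (simp add: dens_def)
      then have "(\<Sum>l<d. \<theta> i $$ (l, l)) = 1" using mtrace_eq[OF c[OF ij(1)]] by simp
      then show ?thesis using True by (simp add: sum_distrib_left[symmetric])
    qed simp
    also have "\<dots> = cq_state k 1 P (\<lambda>_. 1\<^sub>m 1) $$ (i, j)"
      unfolding eq1 using ij bdiag_index[of i k 0 1 j 0] by simp
    finally show "ptr k d 1 (cq_state k d P \<theta>) $$ (i, j) = cq_state k 1 P (\<lambda>_. 1\<^sub>m 1) $$ (i, j)" .
  qed (auto simp: ptr_def cq_state_def mix_def)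
qed

lemma ptr_cq_state_middle:
  assumes "\<And>t. t < k \<Longrightarrow> M t \<in> carrier_mat (a * b) (a * b)" "0 < a" "0 < b"
  shows "ptr k a b (cq_state k (a * b) P M) = cq_state k b P (\<lambda>t. ptr 1 a b (M t))"
proof -
  have eq: "cq_state k (a * b) P M = bdiag k (a * b) (\<lambda>t. complex_of_real (P t) \<cdot>\<^sub>m M t)"
    using assms by (intro cq_state_eq_bdiag) auto
  have eq1: "cq_state k b P (\<lambda>t. ptr 1 a b (M t)) = bdiag k b (\<lambda>t. complex_of_real (P t) \<cdot>\<^sub>m ptr 1 a b (M t))"
    using assms(3) by (intro cq_state_eq_bdiag) (auto simp: ptr_def)
  show ?thesis
  proof (rule eq_blocksI[of _ k b])
    fix t s i j assume h: "t < k" "s < k" "i < b" "j < b"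
    have "ptr k a b (cq_state k (a * b) P M) $$ (t * b + i, s * b + j) =
      (\<Sum>l<a. cq_state k (a * b) P M $$ (t * (a * b) + (l * b + i), s * (a * b) + (l * b + j)))"
      using h by (simp add: ptr_def block_index_less mult.assoc add.assoc)
    also have "\<dots> = (\<Sum>l<a. if t = s then complex_of_real (P t) * M t $$ (l * b + i, l * b + j) else 0)"
      unfolding eq
    proof (intro sum.cong refl)
      fix l assume "l \<in> {..<a}"
      then have l: "l * b + i < a * b" "l * b + j < a * b" using h block_index_less[of l a] by auto
      show "bdiag k (a * b) (\<lambda>t. complex_of_real (P t) \<cdot>\<^sub>m M t) $$ (t * (a * b) + (l * b + i), s * (a * b) + (l * b + j)) =
         (if t = s then complex_of_real (P t) * M t $$ (l * b + i, l * b + j) else 0)"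
        using h l carrier_matD[OF assms(1)[OF h(1)]] bdiag_index[OF h(1) l(1) h(2) l(2)] by (cases "t = s") simp_all
    qed
    also have "\<dots> = cq_state k b P (\<lambda>t. ptr 1 a b (M t)) $$ (t * b + i, s * b + j)"
    proof (cases "t = s")
      case True
      have d: "dim_row (ptr 1 a b (M t)) = b" "dim_col (ptr 1 a b (M t)) = b" by (simp_all add: ptr_def)
      show ?thesis unfolding eq1 using h True d
        by (simp add: bdiag_index ptr_first_index[unfolded One_nat_def] sum_distrib_left)
    next
      case False
      then show ?thesis unfolding eq1 using h by (simp add: bdiag_index)
    qed
    finally show "ptr k a b (cq_state k (a * b) P M) $$ (t * b + i, s * b + j) =
      cq_state k b P (\<lambda>t. ptr 1 a b (M t)) $$ (t * b + i, s * b + j)" .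
  qed (auto simp: ptr_def cq_state_def)
qed

lemma ptr_cq_state_last:
  assumes "\<And>t. t < k \<Longrightarrow> M t \<in> carrier_mat (a * b) (a * b)" "0 < a" "0 < b"
  shows "ptr (k * a) b 1 (cq_state k (a * b) P M) = cq_state k a P (\<lambda>t. ptr a b 1 (M t))"
proof -
  have eq: "cq_state k (a * b) P M = bdiag k (a * b) (\<lambda>t. complex_of_real (P t) \<cdot>\<^sub>m M t)"
    using assms by (intro cq_state_eq_bdiag) auto
  have eq1: "cq_state k a P (\<lambda>t. ptr a b 1 (M t)) = bdiag k a (\<lambda>t. complex_of_real (P t) \<cdot>\<^sub>m ptr a b 1 (M t))"
    using assms(2) by (intro cq_state_eq_bdiag) (auto simp: ptr_def)
  show ?thesis
  proof (rule eq_blocksI[of _ k a])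
    fix t s i j assume h: "t < k" "s < k" "i < a" "j < a"
    have ix: "(t * a + i) * b + l = t * (a * b) + (i * b + l)" for t l i by (simp add: algebra_simps)
    have "ptr (k * a) b 1 (cq_state k (a * b) P M) $$ (t * a + i, s * a + j) =
      (\<Sum>l<b. cq_state k (a * b) P M $$ (t * (a * b) + (i * b + l), s * (a * b) + (j * b + l)))"
      unfolding ptr_last_index[OF block_index_less[OF h(1,3)] block_index_less[OF h(2,4)]] ix ..
    also have "\<dots> = (\<Sum>l<b. if t = s then complex_of_real (P t) * M t $$ (i * b + l, j * b + l) else 0)"
      unfolding eq
    proof (intro sum.cong refl)
      fix l assume "l \<in> {..<b}"
      then have l: "i * b + l < a * b" "j * b + l < a * b" using h block_index_less by auto
      show "bdiag k (a * b) (\<lambda>t. complex_of_real (P t) \<cdot>\<^sub>m M t) $$ (t * (a * b) + (i * b + l), s * (a * b) + (j * b + l)) =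
         (if t = s then complex_of_real (P t) * M t $$ (i * b + l, j * b + l) else 0)"
        using h l carrier_matD[OF assms(1)[OF h(1)]] bdiag_index[OF h(1) l(1) h(2) l(2)] by (cases "t = s") simp_all
    qed
    also have "\<dots> = cq_state k a P (\<lambda>t. ptr a b 1 (M t)) $$ (t * a + i, s * a + j)"
    proof (cases "t = s")
      case True
      have d: "dim_row (ptr a b 1 (M t)) = a" "dim_col (ptr a b 1 (M t)) = a" by (simp_all add: ptr_def)
      show ?thesis unfolding eq1 using h True d
        by (simp add: bdiag_index ptr_last_index[unfolded One_nat_def] sum_distrib_left)
    next
      case False
      then show ?thesis unfolding eq1 using h by (simp add: bdiag_index)
    qed
    finally show "ptr (k * a) b 1 (cq_state k (a * b) P M) $$ (t * a + i, s * a + j) =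
      cq_state k a P (\<lambda>t. ptr a b 1 (M t)) $$ (t * a + i, s * a + j)" .
  qed (auto simp: ptr_def cq_state_def)
qed

section \<open>Converse bounds\<close>

lemma elog2_mono: "x \<le> y \<Longrightarrow> elog2 x \<le> elog2 y"
proof -
  assume xy: "x \<le> y"
  show ?thesis
  proof (cases "y = \<infinity> \<or> x \<le> 0")
    case False
    then obtain a b where "x = ereal a" "y = ereal b" "0 < a" "a \<le> b"
      using xy by (cases x; cases y) auto
    then show ?thesis by (simp add: elog2_def)
  qed (auto simp: elog2_def)
qed

lemma elog2_ereal: "0 < l \<Longrightarrow> elog2 (ereal l) = ereal (log 2 l)"
  by (simp add: elog2_def)

lemma Hmin_ge:
  assumes "dens dB \<sigma>" "psd (dA * dB) (complex_of_real l \<cdot>\<^sub>m kron (1\<^sub>m dA) \<sigma> - \<rho>)" "0 < l"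
  shows "ereal (- log 2 l) \<le> Hmin dA dB \<rho>"
proof -
  let ?I = "Inf {ereal l | l. psd (dA * dB) (complex_of_real l \<cdot>\<^sub>m kron (1\<^sub>m dA) \<sigma> - \<rho>)}"
  have "?I \<le> ereal l" using assms(2) by (intro Inf_lower) auto
  from elog2_mono[OF this] have "elog2 ?I \<le> ereal (log 2 l)" by (simp only: elog2_ereal[OF assms(3)])
  then have "- ereal (log 2 l) \<le> - elog2 ?I" by (simp only: ereal_minus_le_minus)
  also have "\<dots> \<le> Hmin dA dB \<rho>" unfolding Hmin_def using assms(1) by (intro SUP_upper) simp
  finally show ?thesis by simp
qed

lemma Hmax_le_0I:
  assumes "\<And>\<sigma>. dens dB \<sigma> \<Longrightarrow> fid \<rho> (kron (1\<^sub>m dA) \<sigma>) \<le> 1"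
  shows "Hmax dA dB \<rho> \<le> 0"
  unfolding Hmax_def
proof (rule SUP_least)
  fix \<sigma> assume "\<sigma> \<in> {\<sigma>. dens dB \<sigma>}"
  then have "elog2 (ereal (fid \<rho> (kron (1\<^sub>m dA) \<sigma>))) \<le> elog2 (ereal 1)"
    using assms by (intro elog2_mono) simp
  then have "elog2 (ereal (fid \<rho> (kron (1\<^sub>m dA) \<sigma>))) \<le> 0" by (simp add: elog2_ereal zero_ereal_def)
  then show "2 * elog2 (ereal (fid \<rho> (kron (1\<^sub>m dA) \<sigma>))) \<le> 0"
    by (cases "elog2 (ereal (fid \<rho> (kron (1\<^sub>m dA) \<sigma>)))") auto
qed

lemma mix_minus_summand:
  assumes "\<And>x. x < n \<Longrightarrow> psd d (M x)" "t < n" "\<And>x. x < n \<Longrightarrow> 0 \<le> w x" "w t = 1"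
  shows "mix d w M n - M t = mix d (\<lambda>x. if x = t then 0 else w x) M n"
    "psd d (mix d w M n - M t)"
proof -
  have c: "M t \<in> carrier_mat d d" using assms by auto
  show eq: "mix d w M n - M t = mix d (\<lambda>x. if x = t then 0 else w x) M n"
  proof (rule eq_matI)
    fix i j assume "i < dim_row (mix d (\<lambda>x. if x = t then 0 else w x) M n)" "j < dim_col (mix d (\<lambda>x. if x = t then 0 else w x) M n)"
    then have ij: "i < d" "j < d" by (auto simp: mix_def)
    have "(\<Sum>x<n. complex_of_real (w x) * M x $$ (i, j)) =
       complex_of_real (w t) * M t $$ (i, j) + (\<Sum>x\<in>{..<n} - {t}. complex_of_real (w x) * M x $$ (i, j))"
      using assms(2) by (subst sum.remove[of _ t]) auto
    moreover have "(\<Sum>x<n. complex_of_real (if x = t then 0 else w x) * M x $$ (i, j)) =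
       (\<Sum>x\<in>{..<n} - {t}. complex_of_real (w x) * M x $$ (i, j))"
      using assms(2) by (subst sum.remove[of _ t]) (auto intro!: sum.cong)
    ultimately show "(mix d w M n - M t) $$ (i, j) = mix d (\<lambda>x. if x = t then 0 else w x) M n $$ (i, j)"
      using ij c assms(4) by (simp add: mix_index carrier_matD[OF c])
  qed (use c in \<open>auto simp: mix_def\<close>)
  show "psd d (mix d w M n - M t)"
    unfolding eq using assms by (intro mix_psd) auto
qed

text \<open>The smoothing state is the state after the measurement: its block at t is P t times
  \<theta> t conjugated by the root of E t. It is produced as B \<open>adj B\<close>, and the
  original state as A \<open>adj A\<close>, so that both required fidelities are trace norms of
  products of explicit factors.\<close>

lemma Hmax_s_le_0:
  assumes P: "pdistr k P" and \<theta>: "\<And>t. t < k \<Longrightarrow> dens d (\<theta> t)" and d: "0 < d"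
    and E: "\<And>t. t < k \<Longrightarrow> psd d (E t)" and sumE: "psd d (1\<^sub>m d - mix d (\<lambda>_. 1) E k)"
    and err: "\<And>t. t < k \<Longrightarrow> P t \<noteq> 0 \<Longrightarrow> 1 - rtr (E t * \<theta> t) \<le> eps" and eps: "0 \<le> eps" "eps \<le> 1"
  shows "Hmax_s (sqrt (2 * eps)) k d (cq_state k d P \<theta>) \<le> 0"
proof -
  define r where "r t = msqrt (\<theta> t)" for t
  define S where "S t = msqrt (E t)" for t
  have Pn: "0 \<le> P t" if "t < k" for t using P that by (simp add: pdistr_def)
  have th: "psd d (\<theta> t)" "rtr (\<theta> t) = 1" "\<theta> t \<in> carrier_mat d d" if "t < k" for t using densD[OF \<theta>[OF that]] by auto
  have r: "psd d (r t)" "r t * r t = \<theta> t" if "t < k" for t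
    using msqrt_psd[OF th(1)[OF that]] msqrt_square[OF th(1)[OF that]] by (auto simp: r_def)
  have S: "psd d (S t)" "S t * S t = E t" if "t < k" for t
    using msqrt_psd[OF E[OF that]] msqrt_square[OF E[OF that]] by (auto simp: S_def)
  have c: "r t \<in> carrier_mat d d" "S t \<in> carrier_mat d d" "E t \<in> carrier_mat d d" if "t < k" for t
    using r(1)[OF that] S(1)[OF that] E[OF that] by auto
  have ad: "adj (r t) = r t" "adj (S t) = S t" if "t < k" for t
    using psd_adj[OF r(1)[OF that]] psd_adj[OF S(1)[OF that]] by auto
  have effE: "eff d (E t)" if "t < k" for t
  proof -
    have "psd d ((1\<^sub>m d - mix d (\<lambda>_. 1) E k) + (mix d (\<lambda>_. 1) E k - E t))"
      using mix_minus_summand(2)[of k d E t "\<lambda>_. 1"] E that by (intro psd_add[OF sumE]) auto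
    also have "(1\<^sub>m d - mix d (\<lambda>_. 1) E k) + (mix d (\<lambda>_. 1) E k - E t) = 1\<^sub>m d - E t"
      using c(3)[OF that] by (intro eq_matI) (auto simp: mix_def)
    finally show ?thesis unfolding eff_def using E[OF that] by blast
  qed
  define A where "A = bdiag k d (\<lambda>t. complex_of_real (sqrt (P t)) \<cdot>\<^sub>m r t)"
  define B where "B = bdiag k d (\<lambda>t. complex_of_real (sqrt (P t)) \<cdot>\<^sub>m (S t * r t))"
  have Ac: "A \<in> carrier_mat (k * d) (k * d)" and Bc: "B \<in> carrier_mat (k * d) (k * d)" by (simp_all add: A_def B_def)
  have adjA: "adj A = A"
    unfolding A_def using c ad by (subst bdiag_adj) (auto intro!: bdiag_cong)
  have adjB: "adj B = bdiag k d (\<lambda>t. complex_of_real (sqrt (P t)) \<cdot>\<^sub>m (r t * S t))"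
    unfolding B_def using c ad by (subst bdiag_adj) (auto intro!: bdiag_cong simp: adj_mult[of _ d d _ d])
  have sq: "(complex_of_real (sqrt (P t)) \<cdot>\<^sub>m X) * (complex_of_real (sqrt (P t)) \<cdot>\<^sub>m Y) = complex_of_real (P t) \<cdot>\<^sub>m (X * Y)"
    if "t < k" "X \<in> carrier_mat d d" "Y \<in> carrier_mat d d" for t X Y
  proof -
    have "complex_of_real (sqrt (P t)) * complex_of_real (sqrt (P t)) = complex_of_real (P t)"
      using Pn[OF that(1)] by (simp flip: of_real_mult)
    then show ?thesis using that
      by (intro eq_matI) (auto simp: mult_smult_distrib[of _ d d _ d] mult_smult_assoc_mat[of _ d d _ d] mult.assoc[symmetric])
  qed
  have A2: "A * adj A = cq_state k d P \<theta>"
    unfolding adjA unfolding A_def using c r(2) th(3) d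
    by (subst bdiag_mult) (auto simp: cq_state_eq_bdiag sq intro!: bdiag_cong)
  define \<rho>' where "\<rho>' = B * adj B"
  have B2: "rtr (adj B * B) = (\<Sum>t<k. P t * rtr (E t * \<theta> t))"
  proof -
    have "adj B * B = bdiag k d (\<lambda>t. complex_of_real (P t) \<cdot>\<^sub>m ((r t * S t) * (S t * r t)))"
      unfolding adjB unfolding B_def using c
      by (subst bdiag_mult) (auto simp: sq intro!: bdiag_cong)
    moreover have "rtr (complex_of_real (P t) \<cdot>\<^sub>m ((r t * S t) * (S t * r t))) = P t * rtr (E t * \<theta> t)" if "t < k" for t
    proof -
      note c' = c[OF that]
      have "(r t * S t) * (S t * r t) = r t * (E t * r t)"
        using c' by (simp add: S(2)[OF that, symmetric] assoc_square[of _ d])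
      moreover have "rtr (r t * (E t * r t)) = rtr (E t * r t * r t)" using c' by (intro rtr_mult_comm[of _ d]) auto
      moreover have "E t * r t * r t = E t * \<theta> t" using c' by (simp add: r(2)[OF that, symmetric] assoc_square[of _ d])
      ultimately show ?thesis using c' by (simp add: rtr_smult[of _ d])
    qed
    ultimately show ?thesis using c by (simp add: rtr_bdiag)
  qed
  have rsub: "subdens (k * d) \<rho>'"
  proof -
    have "rtr \<rho>' = rtr (adj B * B)" unfolding \<rho>'_def using Bc by (intro rtr_mult_comm[of _ "k * d"]) auto
    also have "\<dots> \<le> (\<Sum>t<k. P t * 1)" unfolding B2
      using Pn eff_rtr_bounds(2)[OF effE th(1)] th(2) by (intro sum_mono mult_left_mono) auto
    finally have "rtr \<rho>' \<le> 1" using P by (simp add: pdistr_def)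
    then show ?thesis using psd_mult_adj[OF Bc] by (simp add: subdens_def \<rho>'_def rtr_def)
  qed
  \<comment> \<open>The fidelity is at least the overlap of the factors, the mean of tr(S t \<theta>
    t); and the root S t of an effect dominates the effect E t itself.\<close>
  have F: "1 - eps \<le> fid (cq_state k d P \<theta>) \<rho>'"
  proof -
    have "1 - eps = (\<Sum>t<k. P t * (1 - eps))" using P by (simp add: pdistr_def flip: sum_distrib_right)
    also have "\<dots> \<le> (\<Sum>t<k. P t * rtr (S t * \<theta> t))"
    proof (rule sum_mono)
      fix t assume "t \<in> {..<k}"
      then have t: "t < k" by simp
      have "psd d (S t * S t - E t * E t)" using eff_square[OF effE[OF t]] S(2)[OF t] by simp
      then have "psd d (S t - E t)" by (rule psd_diff_of_squares[OF S(1)[OF t] E[OF t]])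
      then have "rtr (E t * \<theta> t) \<le> rtr (S t * \<theta> t)" using rtr_mult_mono th(1)[OF t] c[OF t] by blast
      then show "P t * (1 - eps) \<le> P t * rtr (S t * \<theta> t)"
        using err[OF t] Pn[OF t] by (cases "P t = 0") (auto intro!: mult_left_mono)
    qed
    also have "\<dots> = rtr (adj A * B)"
    proof -
      have "adj A * B = bdiag k d (\<lambda>t. complex_of_real (P t) \<cdot>\<^sub>m (r t * (S t * r t)))"
        unfolding adjA unfolding A_def B_def using c by (subst bdiag_mult) (auto simp: sq intro!: bdiag_cong)
      moreover have "rtr (complex_of_real (P t) \<cdot>\<^sub>m (r t * (S t * r t))) = P t * rtr (S t * \<theta> t)" if "t < k" for t
      proof -
        note c' = c[OF that]
        have "rtr (r t * (S t * r t)) = rtr (S t * r t * r t)" using c' by (intro rtr_mult_comm[of _ d]) auto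
        moreover have "S t * r t * r t = S t * \<theta> t" using c' by (simp add: r(2)[OF that, symmetric] assoc_square[of _ d])
        ultimately show ?thesis using c' by (simp add: rtr_smult[of _ d])
      qed
      ultimately show ?thesis using c by (simp add: rtr_bdiag)
    qed
    also have "\<dots> \<le> tnorm (adj A * B)" using Ac Bc by (intro rtr_le_tnorm[of _ "k * d"]) auto
    also have "\<dots> = fid (cq_state k d P \<theta>) \<rho>'"
      unfolding \<rho>'_def A2[symmetric] by (rule fid_eq_tnorm[OF Ac Bc, symmetric])
    finally show ?thesis .
  qed
  have ball: "\<rho>' \<in> sball (sqrt (2 * eps)) (k * d) (cq_state k d P \<theta>)"
  proof -
    have "(1 - eps)\<^sup>2 \<le> (fid (cq_state k d P \<theta>) \<rho>')\<^sup>2" using F eps by (intro power_mono) auto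
    \<comment> \<open>Origin of the radius sqrt(2 eps): fidelity 1 - eps means purification distance
      at most sqrt(2 eps).\<close>
    moreover have "1 - (1 - eps)\<^sup>2 \<le> 2 * eps" by (simp add: power2_eq_square algebra_simps)
    ultimately have "pdist (cq_state k d P \<theta>) \<rho>' \<le> sqrt (2 * eps)" unfolding pdist_def by (intro real_sqrt_le_mono) linarith
    then show ?thesis using rsub by (simp add: sball_def)
  qed
  have "Hmax k d \<rho>' \<le> 0"
  proof (rule Hmax_le_0I)
    fix \<sigma> assume s: "dens d \<sigma>"
    define q where "q = msqrt \<sigma>"
    have q: "psd d q" "q * q = \<sigma>" using msqrt_psd[OF densD(1)[OF s]] msqrt_square[OF densD(1)[OF s]] by (auto simp: q_def)
    have qc: "q \<in> carrier_mat d d" using q(1) by simp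
    define D where "D = bdiag k d (\<lambda>_. q)"
    define D' where "D' = bdiag k d (\<lambda>t. S t * q)"
    have Dc: "D \<in> carrier_mat (k * d) (k * d)" "D' \<in> carrier_mat (k * d) (k * d)" by (simp_all add: D_def D'_def)
    have "adj D = D" unfolding D_def using qc q(1) by (subst bdiag_adj) (auto intro!: bdiag_cong)
    then have DD: "D * adj D = kron (1\<^sub>m k) \<sigma>"
      using qc q(2) densD(3)[OF s] d by (simp add: D_def bdiag_mult kron_one_eq_bdiag)
    \<comment> \<open>The root of E t is moved from the state to the side of \<sigma>. What stays
      behind has Hilbert-Schmidt norm 1, and the squared norm of \<open>D'\<close> is the sum of
      tr(\<sigma> E t), which is at most 1 for a measurement.\<close>
    have "adj B * D = bdiag k d (\<lambda>t. (complex_of_real (sqrt (P t)) \<cdot>\<^sub>m (r t * S t)) * q)"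
      unfolding adjB D_def using c qc by (subst bdiag_mult) auto
    also have "\<dots> = bdiag k d (\<lambda>t. (complex_of_real (sqrt (P t)) \<cdot>\<^sub>m r t) * (S t * q))"
      using c qc by (intro bdiag_cong) (simp add: mult_smult_assoc_mat[of _ d d _ d] assoc_square[of _ d])
    also have "\<dots> = A * D'" unfolding A_def D'_def using c qc by (subst bdiag_mult) auto
    finally have BD: "adj B * D = adj A * D'" using adjA by simp
    have A1: "rtr (adj A * A) = 1"
    proof -
      have "rtr (adj A * A) = rtr (A * adj A)" using Ac by (intro rtr_mult_comm[of _ "k * d"]) auto
      then show ?thesis using A2 densD(2)[OF cq_state_dens[OF \<theta> P d]] by simp
    qed
    have D1: "rtr (adj D' * D') \<le> 1"
    proof -
      have "adj D' * D' = bdiag k d (\<lambda>t. (q * S t) * (S t * q))"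
        unfolding D'_def using c qc ad q(1)
        by (subst bdiag_adj) (auto simp: bdiag_mult adj_mult[of _ d d _ d] intro!: bdiag_cong)
      moreover have "rtr ((q * S t) * (S t * q)) = rtr (\<sigma> * E t)" if "t < k" for t
      proof -
        note c' = c[OF that]
        have "(q * S t) * (S t * q) = q * E t * q"
          using c' qc by (simp add: S(2)[OF that, symmetric] assoc_square[of _ d])
        moreover have "rtr (q * E t * q) = rtr (q * (q * E t))" using c' qc by (intro rtr_mult_comm[of _ d]) auto
        moreover have "q * (q * E t) = \<sigma> * E t" using c' qc by (simp add: q(2)[symmetric] assoc_square[of _ d])
        ultimately show ?thesis by simp
      qed
      ultimately have "rtr (adj D' * D') = (\<Sum>t<k. 1 * rtr (\<sigma> * E t))"
        using c qc by (simp add: rtr_bdiag)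
      also have "\<dots> = rtr (\<sigma> * mix d (\<lambda>_. 1) E k)" using densD(3)[OF s] c by (intro rtr_mult_mix[symmetric]) auto
      also have "\<dots> = rtr (mix d (\<lambda>_. 1) E k * \<sigma>)" using densD(3)[OF s] by (intro rtr_mult_comm[of _ d]) auto
      also have "\<dots> \<le> rtr (1\<^sub>m d * \<sigma>)" using sumE densD(1)[OF s] by (intro rtr_mult_mono) auto
      also have "\<dots> = 1" using densD[OF s] by simp
      finally show ?thesis .
    qed
    have "fid \<rho>' (kron (1\<^sub>m k) \<sigma>) = tnorm (adj A * D')"
      unfolding \<rho>'_def DD[symmetric] BD[symmetric] by (rule fid_eq_tnorm[OF Bc Dc(1)])
    also have "\<dots> \<le> sqrt (rtr (adj A * A)) * sqrt (rtr (adj D' * D'))" by (rule tnorm_adj_mult_le[OF Ac Dc(2)])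
    also have "\<dots> \<le> 1" unfolding A1 using D1 by simp
    finally show "fid \<rho>' (kron (1\<^sub>m k) \<sigma>) \<le> 1" .
  qed
  then show ?thesis unfolding Hmax_s_def using ball by (intro INF_lower2)
qed

text \<open>At radius 1 the ball contains the zero operator. Its fidelity with everything is 0, and
  \<open>elog2\<close> sends 0 to -\<infinity>.\<close>

lemma Hmax_s_large:
  assumes "psd (k * d) \<rho>" "1 \<le> e" "0 < d"
  shows "Hmax_s e k d \<rho> = -\<infinity>"
proof -
  let ?Z = "0\<^sub>m (k * d) (k * d)"
  have "1 - (fid \<rho> ?Z)\<^sup>2 \<le> 1" by simp
  then have "pdist \<rho> ?Z \<le> 1" unfolding pdist_def using real_sqrt_le_mono by fastforce
  then have ball: "?Z \<in> sball e (k * d) \<rho>" using assms(2) by (simp add: sball_def subdens_def rtr_def[symmetric])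
  have "Hmax k d ?Z \<le> -\<infinity>" unfolding Hmax_def
  proof (rule SUP_least)
    fix \<sigma> assume "\<sigma> \<in> {\<sigma>. dens d \<sigma>}"
    then have s: "psd d \<sigma>" "\<sigma> \<in> carrier_mat d d" using densD by auto
    have "psd (k * d) (kron (1\<^sub>m k) \<sigma>)"
      unfolding kron_one_eq_bdiag[OF s(2) assms(3)] using s(1) by (intro psd_bdiag)
    then have "fid ?Z (kron (1\<^sub>m k) \<sigma>) \<le> 0" using fid_le_psd[of "k * d" ?Z] by simp
    then show "2 * elog2 (ereal (fid ?Z (kron (1\<^sub>m k) \<sigma>))) \<le> - \<infinity>" by (simp add: elog2_def)
  qed
  then have "Hmax_s e k d \<rho> \<le> -\<infinity>" unfolding Hmax_s_def using ball by (intro INF_lower2)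
  then show ?thesis by simp
qed

text \<open>Two messages with a common codeword would both have to be decoded from it with
  probability above 1/2. Distinct codewords are what gives the uniform distribution on the code a
  min-entropy of log N.\<close>

lemma pub_code_injective:
  assumes code: "pub_code nX dY \<theta> eps N Enc E" and eps: "eps < 1 / 2"
    and \<theta>: "\<And>x. x < nX \<Longrightarrow> dens dY (\<theta> x)"
  shows "inj_on Enc {..<N}"
proof (rule inj_onI, rule ccontr)
  fix m n assume h: "m \<in> {..<N}" "n \<in> {..<N}" "Enc m = Enc n" "m \<noteq> n"
  have E: "psd dY (E i)" if "i < N" for i using code that by (simp add: pub_code_def povm_def)
  have sE: "mix dY (\<lambda>_. 1) E N = 1\<^sub>m dY" using code by (simp add: pub_code_def povm_def)
  have t: "dens dY (\<theta> (Enc m))" using code h \<theta> by (simp add: pub_code_def)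
  let ?t = "\<theta> (Enc m)"
  have er: "1 - rtr (E i * \<theta> (Enc i)) \<le> eps" if "i < N" for i
    using code that by (simp add: pub_code_def rtr_def)
  have "rtr (?t * mix dY (\<lambda>_. 1) E N) = (\<Sum>i<N. 1 * rtr (?t * E i))"
    using densD(3)[OF t] E by (intro rtr_mult_mix) auto
  then have s: "(\<Sum>i<N. rtr (?t * E i)) = 1" using sE densD[OF t] by simp
  have "rtr (?t * E m) + rtr (?t * E n) = (\<Sum>i\<in>{m, n}. rtr (?t * E i))" using h by simp
  also have "\<dots> \<le> (\<Sum>i<N. rtr (?t * E i))"
    using h psd_mult_rtr_nonneg[OF densD(1)[OF t] E] by (intro sum_mono2) auto
  finally have "rtr (?t * E m) + rtr (?t * E n) \<le> 1" using s by simp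
  moreover have "rtr (?t * E i) = rtr (E i * ?t)" if "i < N" for i
    using densD(3)[OF t] psd_carrier[OF E[OF that]] by (intro rtr_mult_comm[of _ dY])
  ultimately show False using er[of m] er[of n] h eps by force
qed

lemma pub_converse:
  assumes nX: "1 \<le> nX" and dY: "1 \<le> dY" and \<theta>: "\<And>x. x < nX \<Longrightarrow> dens dY (\<theta> x)" and eps: "0 < eps"
  shows "C_pub nX dY \<theta> eps \<le> (SUP P \<in> {P. pdistr nX P}.
          Hmin nX 1 (ptr nX dY 1 (cq_state nX dY P \<theta>))
          - Hmax_s (sqrt (2 * eps)) nX dY (cq_state nX dY P \<theta>))" (is "_ \<le> (SUP P \<in> _. ?f P)")
proof (cases "eps < 1 / 2")
  case False
  define P where "P x = (if x = 0 then 1 else 0 :: real)" for x :: nat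
  have P: "pdistr nX P" using nX by (simp add: pdistr_def P_def)
  have "psd (nX * dY) (cq_state nX dY P \<theta>)" using cq_state_dens[OF \<theta> P] dY densD(1) by auto
  moreover have "1 \<le> sqrt (2 * eps)" using False by simp
  ultimately have "Hmax_s (sqrt (2 * eps)) nX dY (cq_state nX dY P \<theta>) = -\<infinity>" using dY by (intro Hmax_s_large) auto
  then have "?f P = \<infinity>" by simp
  moreover have "?f P \<le> (SUP P \<in> {P. pdistr nX P}. ?f P)" using P by (intro SUP_upper) simp
  ultimately have "(SUP P \<in> {P. pdistr nX P}. ?f P) = \<infinity>" by simp
  then show ?thesis by simp
next
  case True
  show ?thesis unfolding C_pub_def
  proof (rule Sup_least)
    fix z assume "z \<in> {ereal (log 2 (real N)) | N. \<exists>Enc E. pub_code nX dY \<theta> eps N Enc E}"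
    then obtain N Enc E where z: "z = ereal (log 2 (real N))" and code: "pub_code nX dY \<theta> eps N Enc E" by blast
    have N: "1 \<le> N" and Enc: "\<And>m. m < N \<Longrightarrow> Enc m < nX" and E: "\<And>m. m < N \<Longrightarrow> psd dY (E m)"
      and sE: "mix dY (\<lambda>_. 1) E N = 1\<^sub>m dY" and err: "\<And>m. m < N \<Longrightarrow> 1 - rtr (E m * \<theta> (Enc m)) \<le> eps"
      using code by (auto simp: pub_code_def povm_def rtr_def)
    have inj: "inj_on Enc {..<N}" by (rule pub_code_injective[OF code True \<theta>])
    define I where "I = Enc ` {..<N}"
    have I: "I \<subseteq> {..<nX}" "finite I" "card I = N" using Enc inj by (auto simp: I_def card_image)
    define P where "P x = (if x \<in> I then 1 / real N else 0)" for x
    have P: "pdistr nX P"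
    proof -
      have "(\<Sum>x<nX. P x) = (\<Sum>x\<in>I. 1 / real N)"
        using I by (intro sum.mono_neutral_cong_right) (auto simp: P_def)
      then show ?thesis using N I by (simp add: pdistr_def P_def)
    qed
    \<comment> \<open>The decoding operators, indexed by input symbols instead of messages. Symbols
      outside the code have probability zero and get the zero operator, so the sum remains the
      identity.\<close>
    define F where "F x = (if x \<in> I then E (the_inv_into {..<N} Enc x) else 0\<^sub>m dY dY)" for x
    have FE: "F (Enc m) = E m" if "m < N" for m
      using that inj by (simp add: F_def I_def the_inv_into_f_f)
    have Fp: "psd dY (F x)" for x
    proof (cases "x \<in> I")
      case True
      then obtain m where "m < N" "x = Enc m" by (auto simp: I_def)
      then show ?thesis using FE E by simp
    qed (simp add: F_def)
    have sF: "mix dY (\<lambda>_. 1) F nX = 1\<^sub>m dY"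
    proof -
      have "mix dY (\<lambda>_. 1) F nX = mix dY (\<lambda>_. 1) E N"
      proof (rule eq_matI)
        fix i j assume "i < dim_row (mix dY (\<lambda>_. 1) E N)" "j < dim_col (mix dY (\<lambda>_. 1) E N)"
        then have ij: "i < dY" "j < dY" by (auto simp: mix_def)
        have "(\<Sum>x<nX. F x $$ (i, j)) = (\<Sum>x\<in>I. F x $$ (i, j))"
          using I ij by (intro sum.mono_neutral_right) (auto simp: F_def)
        also have "\<dots> = (\<Sum>m<N. E m $$ (i, j))" unfolding I_def using inj FE by (simp add: sum.reindex)
        finally show "mix dY (\<lambda>_. 1) F nX $$ (i, j) = mix dY (\<lambda>_. 1) E N $$ (i, j)"
          using ij by (simp add: mix_index)
      qed (auto simp: mix_def)
      then show ?thesis using sE by simp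
    qed
    have Hmax: "Hmax_s (sqrt (2 * eps)) nX dY (cq_state nX dY P \<theta>) \<le> 0"
    proof (rule Hmax_s_le_0[OF P \<theta>, where E = F])
      show "psd dY (1\<^sub>m dY - mix dY (\<lambda>_. 1) F nX)"
        unfolding sF minus_r_inv_mat[OF one_carrier_mat] by (rule psd_zero)
      show "1 - rtr (F t * \<theta> t) \<le> eps" if "t < nX" "P t \<noteq> 0" for t
      proof -
        have "t \<in> I" using that by (auto simp: P_def split: if_splits)
        then obtain m where "m < N" "t = Enc m" by (auto simp: I_def)
        then show ?thesis using FE err by simp
      qed
    qed (use dY Fp True eps in auto)
    have "ereal (- log 2 (1 / real N)) \<le> Hmin nX 1 (ptr nX dY 1 (cq_state nX dY P \<theta>))"
    proof (rule Hmin_ge)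
      show "dens 1 (1\<^sub>m 1)" by (rule densI) auto
      have 1: "kron (1\<^sub>m nX) (1\<^sub>m 1) = bdiag nX 1 (\<lambda>_. 1\<^sub>m 1)" by (rule kron_one_eq_bdiag) auto
      have 2: "ptr nX dY 1 (cq_state nX dY P \<theta>) = bdiag nX 1 (\<lambda>t. complex_of_real (P t) \<cdot>\<^sub>m 1\<^sub>m 1)"
        using ptr_cq_state_classical[OF \<theta>] dY cq_state_eq_bdiag[of nX "\<lambda>_. 1\<^sub>m 1" 1 P] by simp
      have "complex_of_real (1 / real N) \<cdot>\<^sub>m kron (1\<^sub>m nX) (1\<^sub>m 1) - ptr nX dY 1 (cq_state nX dY P \<theta>) =
        bdiag nX 1 (\<lambda>t. complex_of_real (1 / real N) \<cdot>\<^sub>m 1\<^sub>m 1 - complex_of_real (P t) \<cdot>\<^sub>m 1\<^sub>m 1)"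
        unfolding 1 2 by (subst bdiag_smult, simp, subst bdiag_diff) auto
      also have "\<dots> = bdiag nX 1 (\<lambda>t. complex_of_real (1 / real N - P t) \<cdot>\<^sub>m 1\<^sub>m 1)"
        by (intro bdiag_cong eq_matI) auto
      also have "psd (nX * 1) \<dots>" by (intro psd_bdiag psd_smult psd_one) (simp add: P_def)
      finally show "psd (nX * 1) (complex_of_real (1 / real N) \<cdot>\<^sub>m kron (1\<^sub>m nX) (1\<^sub>m 1) - ptr nX dY 1 (cq_state nX dY P \<theta>))" .
      show "0 < 1 / real N" using N by simp
    qed
    then have "z \<le> Hmin nX 1 (ptr nX dY 1 (cq_state nX dY P \<theta>))" using N by (simp add: z log_divide)
    then have "z - 0 \<le> ?f P" using Hmax by (intro ereal_minus_mono)
    moreover have "?f P \<le> (SUP P \<in> {P. pdistr nX P}. ?f P)" using P by (intro SUP_upper) simp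
    ultimately show "z \<le> (SUP P \<in> {P. pdistr nX P}. ?f P)" by simp
  qed
qed

lemma prv_converse:
  assumes nX: "1 \<le> nX" and dY: "1 \<le> dY" and dZ: "1 \<le> dZ"
    and \<theta>: "\<And>x. x < nX \<Longrightarrow> dens (dY * dZ) (\<theta> x)" and eps: "0 < eps"
  shows "C_prv nX dY dZ \<theta> eps \<le>
       (SUP (k, PT, W) \<in> {(k, PT, W). k \<ge> 1 \<and> pdistr k PT \<and> (\<forall>t<k. pdistr nX (W t))}.
          Hmin_s (sqrt (2 * eps)) k dZ (ptr k dY dZ (cqq_state nX dY dZ k PT W \<theta>))
          - Hmax_s (sqrt (2 * eps)) k dY (ptr (k * dY) dZ 1 (cqq_state nX dY dZ k PT W \<theta>)))"
    (is "_ \<le> (SUP (k, PT, W) \<in> ?S. ?f k PT W)")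
proof -
  have up: "?f k PT W \<le> (SUP (k, PT, W) \<in> ?S. ?f k PT W)" if "(k, PT, W) \<in> ?S" for k PT W
    using SUP_upper[OF that, of "\<lambda>(k, PT, W). ?f k PT W"] by simp
  have pos: "0 < dY" "0 < dZ" using dY dZ by auto
  have Wd: "dens (dY * dZ) (mix (dY * dZ) (W t) \<theta> nX)" if "\<forall>t<k. pdistr nX (W t)" "t < k" for k t and W :: "nat \<Rightarrow> nat \<Rightarrow> real"
    using that \<theta> by (intro mix_dens) auto
  show ?thesis
  proof (cases "eps < 1 / 2")
    case False
    define P where "P x = (if x = 0 then 1 else 0 :: real)" for x :: nat
    define W where "W = (\<lambda>t :: nat. P)"
    have P1: "pdistr 1 P" and Pn: "pdistr nX P" using nX by (simp_all add: pdistr_def P_def)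
    have W: "\<forall>t<(1::nat). pdistr nX (W t)" using Pn by (simp add: W_def)
    have "dens (1 * dY) (cq_state 1 dY P (\<lambda>t. ptr dY dZ 1 (mix (dY * dZ) (W t) \<theta> nX)))"
      by (rule cq_state_dens[OF dens_ptr_last[OF Wd[OF W]] P1 pos(1)])
    then have "dens (1 * dY) (ptr (1 * dY) dZ 1 (cqq_state nX dY dZ 1 P W \<theta>))"
      unfolding cqq_state_def ptr_cq_state_last[of 1 "\<lambda>t. mix (dY * dZ) (W t) \<theta> nX", OF mix_carrier pos] .
    then have "Hmax_s (sqrt (2 * eps)) 1 dY (ptr (1 * dY) dZ 1 (cqq_state nX dY dZ 1 P W \<theta>)) = -\<infinity>"
      using False pos by (intro Hmax_s_large densD(1)) auto
    then have "?f 1 P W = \<infinity>" by simp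
    moreover have "?f 1 P W \<le> (SUP (k, PT, W) \<in> ?S. ?f k PT W)" using P1 W by (intro up) simp
    ultimately have "(SUP (k, PT, W) \<in> ?S. ?f k PT W) = \<infinity>" by (simp only: ereal_infty_less_eq)
    then show ?thesis by (simp only: ereal_less_eq)
  next
    case True
    show ?thesis unfolding C_prv_def
    proof (rule Sup_least)
      fix z assume "z \<in> {ereal (log 2 (real N)) | N. \<exists>Enc E. prv_code nX dY dZ \<theta> eps N Enc E}"
      then obtain N Enc E where z: "z = ereal (log 2 (real N))" and code: "prv_code nX dY dZ \<theta> eps N Enc E" by blast
      define M where "M m = mix (dY * dZ) (Enc m) \<theta> nX" for m
      define \<zeta> where "\<zeta> m = ptr 1 dY dZ (M m)" for m
      define \<eta> where "\<eta> m = ptr dY dZ 1 (M m)" for m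
      define P where "P = (\<lambda>m :: nat. 1 / real N)"
      define \<zeta>m where "\<zeta>m = mix dZ P \<zeta> N"
      have N: "1 \<le> N" and Enc: "\<forall>m<N. pdistr nX (Enc m)" and E: "\<And>m. m < N \<Longrightarrow> psd dY (E m)"
        and sE: "mix dY (\<lambda>_. 1) E N = 1\<^sub>m dY" and err: "\<And>m. m < N \<Longrightarrow> 1 - rtr (E m * \<eta> m) \<le> eps"
        and sec: "\<And>m. m < N \<Longrightarrow> tnorm (\<zeta> m - \<zeta>m) / 2 \<le> eps"
        using code unfolding prv_code_def povm_def avg_out_def \<eta>_def \<zeta>_def M_def \<zeta>m_def P_def rtr_def by auto
      have P: "pdistr N P" using N by (simp add: pdistr_def P_def)
      have Md: "dens (dY * dZ) (M m)" if "m < N" for m unfolding M_def by (rule Wd[OF Enc that])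
      have zd: "dens dZ (\<zeta> m)" and ed: "dens dY (\<eta> m)" if "m < N" for m
        unfolding \<zeta>_def \<eta>_def by (rule dens_ptr_first[OF Md[OF that]], rule dens_ptr_last[OF Md[OF that]])
      have zmd: "dens dZ \<zeta>m" unfolding \<zeta>m_def using P zd by (intro mix_dens)
      have st: "cqq_state nX dY dZ N P Enc \<theta> = cq_state N (dY * dZ) P M" by (simp add: cqq_state_def M_def[abs_def])
      have stZ: "ptr N dY dZ (cqq_state nX dY dZ N P Enc \<theta>) = cq_state N dZ P \<zeta>"
        unfolding st \<zeta>_def using densD(3)[OF Md] pos by (intro ptr_cq_state_middle) auto
      have stY: "ptr (N * dY) dZ 1 (cqq_state nX dY dZ N P Enc \<theta>) = cq_state N dY P \<eta>"
        unfolding st \<eta>_def using densD(3)[OF Md] pos by (intro ptr_cq_state_last) auto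
      have Hmax: "Hmax_s (sqrt (2 * eps)) N dY (cq_state N dY P \<eta>) \<le> 0"
      proof (rule Hmax_s_le_0[OF P ed, where E = E])
        show "psd dY (1\<^sub>m dY - mix dY (\<lambda>_. 1) E N)"
          unfolding sE minus_r_inv_mat[OF one_carrier_mat] by (rule psd_zero)
      qed (use pos E err True eps in auto)
      define \<rho> where "\<rho> = cq_state N dZ P \<zeta>"
      define \<rho>' where "\<rho>' = cq_state N dZ P (\<lambda>_. \<zeta>m)"
      have rd: "dens (N * dZ) \<rho>" unfolding \<rho>_def using zd P pos by (intro cq_state_dens) auto
      have rd': "dens (N * dZ) \<rho>'" unfolding \<rho>'_def using zmd P pos by (intro cq_state_dens) auto
      \<comment> \<open>Powers-Stormer bounds the fidelity of two normalized states from below by 1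
        minus the advantage of one test. Both states are block diagonal, so only the blocks of
        \<open>T\<close> matter, and the secrecy condition for message t bounds the advantage of
        block t.\<close>
      obtain T where T: "eff (N * dZ) T"
        and ps: "rtr \<rho> - rtr (T * \<rho>) + rtr (T * \<rho>') \<le> rtr (msqrt \<rho> * msqrt \<rho>')"
        using powers_stormer_test[OF msqrt_psd[OF densD(1)[OF rd]] msqrt_psd[OF densD(1)[OF rd']]]
        by (auto simp: msqrt_square[OF densD(1)[OF rd]] msqrt_square[OF densD(1)[OF rd']])
      have F: "rtr (msqrt \<rho> * msqrt \<rho>') \<le> fid \<rho> \<rho>'"
        using rtr_roots_le_fid[OF msqrt_psd[OF densD(1)[OF rd]] msqrt_psd[OF densD(1)[OF rd']]]
        by (simp only: msqrt_square[OF densD(1)[OF rd]] msqrt_square[OF densD(1)[OF rd']])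
      note TM = rtr_mult_cq_state[OF eff_carrier[OF T] _ pos(2)]
      have "rtr (T * \<rho>) - rtr (T * \<rho>') \<le> eps"
      proof -
        have "rtr (T * \<rho>) - rtr (T * \<rho>') = (\<Sum>t<N. P t * (rtr (blk dZ t T * \<zeta> t) - rtr (blk dZ t T * \<zeta>m)))"
          unfolding \<rho>_def \<rho>'_def using densD(3)[OF zd] densD(3)[OF zmd]
          by (simp add: TM sum_subtractf right_diff_distrib)
        also have "\<dots> \<le> (\<Sum>t<N. P t * eps)"
        proof (intro sum_mono mult_left_mono)
          fix t assume "t \<in> {..<N}"
          then have t: "t < N" by simp
          have c: "\<zeta> t \<in> carrier_mat dZ dZ" "\<zeta>m \<in> carrier_mat dZ dZ" using densD(3)[OF zd[OF t]] densD(3)[OF zmd] by auto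
          have "2 * rtr (blk dZ t T * (\<zeta> t - \<zeta>m)) - rtr (\<zeta> t - \<zeta>m) \<le> tnorm (\<zeta> t - \<zeta>m)"
            using c by (intro tnorm_eff_ge[OF _ eff_blk[OF T t]]) auto
          then show "rtr (blk dZ t T * \<zeta> t) - rtr (blk dZ t T * \<zeta>m) \<le> eps"
            using c sec[OF t] densD(2)[OF zd[OF t]] densD(2)[OF zmd]
            by (simp add: mult_minus_square[of _ dZ] rtr_minus[of _ dZ])
          show "0 \<le> P t" by (simp add: P_def)
        qed
        also have "\<dots> = eps" using P by (simp add: pdistr_def flip: sum_distrib_right)
        finally show ?thesis .
      qed
      then have F1: "1 - eps \<le> fid \<rho> \<rho>'" using ps F densD(2)[OF rd] by linarith
      have "(1 - eps)\<^sup>2 \<le> (fid \<rho> \<rho>')\<^sup>2" using F1 True by (intro power_mono) auto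
      moreover have "1 - (1 - eps)\<^sup>2 \<le> 2 * eps" by (simp add: power2_eq_square algebra_simps)
      ultimately have "pdist \<rho> \<rho>' \<le> sqrt (2 * eps)" unfolding pdist_def by (intro real_sqrt_le_mono) linarith
      then have ball: "\<rho>' \<in> sball (sqrt (2 * eps)) (N * dZ) \<rho>"
        using densD[OF rd'] by (simp add: sball_def subdens_def rtr_def)
      have "ereal (- log 2 (1 / real N)) \<le> Hmin N dZ \<rho>'"
      proof (rule Hmin_ge[OF zmd])
        have c: "\<zeta>m \<in> carrier_mat dZ dZ" using densD(3)[OF zmd] .
        have "complex_of_real (1 / real N) \<cdot>\<^sub>m kron (1\<^sub>m N) \<zeta>m = \<rho>'"
          unfolding \<rho>'_def kron_one_eq_bdiag[OF c pos(2)] cq_state_eq_bdiag[of N "\<lambda>_. \<zeta>m", OF c pos(2)]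
          using c by (subst bdiag_smult) (auto simp: P_def)
        moreover have "\<rho>' - \<rho>' = 0\<^sub>m (N * dZ) (N * dZ)" using densD(3)[OF rd'] by (rule minus_r_inv_mat)
        ultimately show "psd (N * dZ) (complex_of_real (1 / real N) \<cdot>\<^sub>m kron (1\<^sub>m N) \<zeta>m - \<rho>')" by (simp only: psd_zero)
        show "0 < 1 / real N" using N by simp
      qed
      also have "\<dots> \<le> Hmin_s (sqrt (2 * eps)) N dZ \<rho>" unfolding Hmin_s_def using ball by (intro SUP_upper)
      finally have "z \<le> Hmin_s (sqrt (2 * eps)) N dZ \<rho>" using N by (simp add: z log_divide)
      then have "z - 0 \<le> ?f N P Enc" unfolding stZ stY \<rho>_def[symmetric] using Hmax by (intro ereal_minus_mono)
      moreover have "?f N P Enc \<le> (SUP (k, PT, W) \<in> ?S. ?f k PT W)" using N P Enc by (intro up) simp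
      ultimately have "z - 0 \<le> (SUP (k, PT, W) \<in> ?S. ?f k PT W)" by (rule order.trans)
      then show "z \<le> (SUP (k, PT, W) \<in> ?S. ?f k PT W)" by (simp only: ereal_minus)
    qed
  qed
qed

section \<open>Decoding\<close>

text \<open>The Powers-Stormer test between the root of \<rho>' and c times the root of identity
  tensor Y. The bound c f on the overlap controls both the weight of \<rho>' that is missed and c^2
  times the false acceptance under the product. The choice c = \<delta> / f makes these \<delta> and
  f^2 / \<delta>. The tests of the single symbols are the diagonal blocks, and returning from
  \<rho>' to the true state costs e.\<close>

lemma decoding_test:
  assumes P: "pdistr k P" and \<eta>: "\<And>t. t < k \<Longrightarrow> dens d (\<eta> t)" and d: "0 < d"
    and \<rho>': "subdens (k * d) \<rho>'" "pdist (cq_state k d P \<eta>) \<rho>' \<le> e" "0 \<le> e"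
    and f: "fid \<rho>' (kron (1\<^sub>m k) (mix d P \<eta> k)) \<le> f" "0 < f" and \<delta>: "0 < \<delta>"
  shows "\<exists>T. (\<forall>t<k. eff d (T t)) \<and> (\<Sum>t<k. P t * (1 - rtr (T t * \<eta> t))) \<le> \<delta> + e \<and>
    (\<Sum>t<k. rtr (T t * mix d P \<eta> k)) \<le> f\<^sup>2 / \<delta>"
proof -
  define Y where "Y = mix d P \<eta> k"
  have Yd: "dens d Y" unfolding Y_def using P \<eta> by (rule mix_dens)
  define \<tau> where "\<tau> = kron (1\<^sub>m k) Y"
  have \<tau>: "\<tau> = bdiag k d (\<lambda>_. Y)" unfolding \<tau>_def using densD(3)[OF Yd] d by (rule kron_one_eq_bdiag)
  have \<tau>p: "psd (k * d) \<tau>" unfolding \<tau> using densD(1)[OF Yd] by (intro psd_bdiag)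
  have rp: "psd (k * d) \<rho>'" using \<rho>'(1) by (simp add: subdens_def)
  define c where "c = \<delta> / f"
  have c0: "0 < c" using f \<delta> by (simp add: c_def)
  define X where "X = msqrt \<rho>'"
  define Z where "Z = msqrt \<tau>"
  have X: "psd (k * d) X" "X * X = \<rho>'" using msqrt_psd[OF rp] msqrt_square[OF rp] by (auto simp: X_def)
  have Z: "psd (k * d) Z" "Z * Z = \<tau>" using msqrt_psd[OF \<tau>p] msqrt_square[OF \<tau>p] by (auto simp: Z_def)
  let ?Z = "complex_of_real c \<cdot>\<^sub>m Z"
  have Zc: "Z \<in> carrier_mat (k * d) (k * d)" "X \<in> carrier_mat (k * d) (k * d)" "\<tau> \<in> carrier_mat (k * d) (k * d)"
    using Z(1) X(1) \<tau>p by auto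
  have ZZ: "?Z * ?Z = complex_of_real (c\<^sup>2) \<cdot>\<^sub>m \<tau>"
    unfolding Z(2)[symmetric] using Zc
    by (intro eq_matI) (auto simp: mult_smult_distrib[of _ "k * d" "k * d" _ "k * d"]
      mult_smult_assoc_mat[of _ "k * d" "k * d" _ "k * d"] power2_eq_square)
  obtain T where T: "eff (k * d) T" and t: "rtr \<rho>' - rtr (T * \<rho>') + rtr (T * (?Z * ?Z)) \<le> rtr (X * ?Z)"
    using powers_stormer_test[OF X(1) psd_smult[OF Z(1)], of c] c0 X(2) by auto
  have Tc: "T \<in> carrier_mat (k * d) (k * d)" using T by simp
  have XZ: "rtr (X * ?Z) = c * rtr (X * Z)"
    using Zc by (simp add: mult_smult_distrib[of _ "k * d" "k * d" _ "k * d"] rtr_smult[of _ "k * d"])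
  have "rtr (X * Z) \<le> f"
    using rtr_roots_le_fid[OF X(1) Z(1)] f(1) unfolding X(2) Z(2) \<tau>_def Y_def by linarith
  then have "c * rtr (X * Z) \<le> c * f" using c0 by simp
  then have a: "rtr (X * ?Z) \<le> \<delta>" using XZ f(2) by (simp add: c_def)
  have b: "rtr (T * (?Z * ?Z)) = c\<^sup>2 * rtr (T * \<tau>)"
    unfolding ZZ using Zc Tc by (simp add: mult_smult_distrib[of _ "k * d" "k * d" _ "k * d"] rtr_smult[of _ "k * d"] flip: of_real_power)
  note bd = eff_rtr_bounds[OF T rp] eff_rtr_bounds[OF T \<tau>p]
  have 1: "rtr \<rho>' - rtr (T * \<rho>') \<le> \<delta>"
    using t a b bd(3) by (metis add_le_cancel_left le_add_same_cancel1 mult_nonneg_nonneg order_trans zero_le_power2)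
  have "c\<^sup>2 * rtr (T * \<tau>) \<le> \<delta>" using t a b bd(2) by linarith
  then have 2: "rtr (T * \<tau>) \<le> f\<^sup>2 / \<delta>"
    using \<delta> f by (simp add: c_def power2_eq_square field_simps)
  define S where "S t = blk d t T" for t
  have eta: "\<eta> t \<in> carrier_mat d d" "rtr (\<eta> t) = 1" if "t < k" for t using densD[OF \<eta>[OF that]] by auto
  let ?U = "1\<^sub>m (k * d) - T"
  have U: "eff (k * d) ?U"
  proof -
    have "1\<^sub>m (k * d) - ?U = T" using Tc by (intro eq_matI) auto
    then show ?thesis unfolding eff_def using effD[OF T] by simp
  qed
  have rd: "dens (k * d) (cq_state k d P \<eta>)" using \<eta> P d by (rule cq_state_dens)
  have "rtr (?U * cq_state k d P \<eta>) - rtr (?U * \<rho>') \<le> e"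
    using pdist_test[OF rd \<rho>' U] by linarith
  moreover have "rtr (?U * \<rho>') = rtr \<rho>' - rtr (T * \<rho>')" using Tc psd_carrier[OF rp]
    by (simp add: mult_minus_square[of _ "k * d"] rtr_minus[of _ "k * d"])
  moreover have "rtr (?U * cq_state k d P \<eta>) = (\<Sum>t<k. P t * (1 - rtr (S t * \<eta> t)))"
  proof -
    have "rtr (?U * cq_state k d P \<eta>) = (\<Sum>t<k. P t * rtr (blk d t ?U * \<eta> t))"
      using Tc eta d by (intro rtr_mult_cq_state) auto
    also have "\<dots> = (\<Sum>t<k. P t * (1 - rtr (S t * \<eta> t)))"
    proof (intro sum.cong refl)
      fix t assume "t \<in> {..<k}"
      then have t: "t < k" by simp
      have "blk d t ?U = 1\<^sub>m d - S t" using blk_diff[of "1\<^sub>m (k * d)" k d T t] Tc t by (simp add: blk_one S_def)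
      then show "P t * rtr (blk d t ?U * \<eta> t) = P t * (1 - rtr (S t * \<eta> t))"
        using eta[OF t] by (simp add: mult_minus_square[of _ d] rtr_minus[of _ d] S_def)
    qed
    finally show ?thesis .
  qed
  ultimately have 3: "(\<Sum>t<k. P t * (1 - rtr (S t * \<eta> t))) \<le> \<delta> + e" using 1 by linarith
  have 4: "(\<Sum>t<k. rtr (S t * Y)) \<le> f\<^sup>2 / \<delta>"
    using 2 unfolding \<tau> S_def by (subst (asm) rtr_mult_bdiag) (use Tc densD(3)[OF Yd] in auto)
  have "\<forall>t<k. eff d (S t)" using eff_blk[OF T] by (simp add: S_def)
  then show ?thesis using 3 4 unfolding Y_def by blast
qed

lemma fc_pos_eigs:
  assumes "herm d M" "psd d (M - complex_of_real \<kappa> \<cdot>\<^sub>m 1\<^sub>m d)" "i < d"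
  shows "\<kappa> \<le> eigs d M i"
proof -
  have "complex_of_real \<kappa> \<cdot>\<^sub>m 1\<^sub>m d = fc d M (\<lambda>x. \<kappa>)"
  proof -
    define U where "U = fst (eigsys d M)"
    have U: "U \<in> carrier_mat d d" "U * adj U = 1\<^sub>m d"
      using eigsys(1)[OF assms(1)] by (auto simp: unitary_mat_def U_def)
    have "mat_diag d (\<lambda>i. complex_of_real \<kappa>) = complex_of_real \<kappa> \<cdot>\<^sub>m 1\<^sub>m d"
      by (rule eq_matI) (auto simp: mat_diag_def)
    then show ?thesis using U unfolding fc_def U_def[symmetric]
      by (simp add: mult_smult_distrib[of _ d d _ d] mult_smult_assoc_mat[of _ d d _ d])
  qed
  moreover have "M = fc d M (\<lambda>x. x)" using eigsys(2)[OF assms(1)] by simp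
  ultimately have "M - complex_of_real \<kappa> \<cdot>\<^sub>m 1\<^sub>m d = fc d M (\<lambda>x. x - \<kappa>)"
    using fc_minus[OF assms(1), of "\<lambda>x. x" "\<lambda>x. \<kappa>"] by metis
  then have "psd d (fc d M (\<lambda>x. x - \<kappa>))" using assms(2) by simp
  then show ?thesis using fc_psd_iff[OF assms(1)] assms(3) by simp
qed

text \<open>The square-root measurement built from tests \<open>T\<close>, with the operator inequality of Hayashi and Nagaoka;
  the shift by \<open>\<kappa>\<close> makes the sum of the tests invertible.\<close>
lemma square_root_decoder:
  assumes T: "\<And>t. t < k \<Longrightarrow> eff d (T t)" and w: "\<And>t. t < k \<Longrightarrow> 0 \<le> w t" and \<kappa>: "0 < \<kappa>"
  shows "\<exists>\<Lambda>. (\<forall>t<k. psd d (\<Lambda> t)) \<and> psd d (1\<^sub>m d - mix d w \<Lambda> k) \<and>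
    (\<forall>t<k. \<forall>\<rho>. w t = 1 \<longrightarrow> dens d \<rho> \<longrightarrow> 1 - rtr (\<Lambda> t * \<rho>) \<le> 3 / 2 * (1 - rtr (T t * \<rho>))
       + 9 / 2 * ((\<Sum>s<k. (if s = t then 0 else w s) * rtr (T s * \<rho>)) + \<kappa>))"
proof -
  define M0 where "M0 = mix d w T k"
  define M where "M = M0 + complex_of_real \<kappa> \<cdot>\<^sub>m 1\<^sub>m d"
  have Tp: "psd d (T t)" and Tc: "T t \<in> carrier_mat d d" if "t < k" for t using effD(1)[OF T[OF that]] by auto
  have M0: "psd d M0" "M0 \<in> carrier_mat d d" unfolding M0_def using Tp w by (auto intro!: mix_psd)
  have Kp: "psd d (complex_of_real \<kappa> \<cdot>\<^sub>m 1\<^sub>m d)" using \<kappa> by (intro psd_smult) auto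
  have Mp: "psd d M" unfolding M_def using M0(1) Kp by (rule psd_add)
  have Mc: "M \<in> carrier_mat d d" using Mp by simp
  have Mh: "herm d M" using Mp by (rule psd_herm)
  note fM = eigsys(2)[OF Mh]
  have "M - complex_of_real \<kappa> \<cdot>\<^sub>m 1\<^sub>m d = M0" unfolding M_def using M0(2) by (intro eq_matI) auto
  then have "psd d (M - complex_of_real \<kappa> \<cdot>\<^sub>m 1\<^sub>m d)" using M0(1) by simp
  then have pos: "0 < eigs d M i" if "i < d" for i using fc_pos_eigs[OF Mh _ that, of \<kappa>] \<kappa> by simp
  define R where "R = fc d M (\<lambda>x. 1 / sqrt x)"
  define Q where "Q = fc d M sqrt"
  have Rp: "psd d R" unfolding R_def using pos by (simp add: fc_psd_iff[OF Mh] less_imp_le)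
  have Rc: "R \<in> carrier_mat d d" "adj R = R" using Rp by auto
  have Q: "psd d Q" "Q * Q = M" unfolding Q_def by (rule psd_root[OF Mp])+
  have Qc: "Q \<in> carrier_mat d d" using Q(1) by simp
  have RM: "R * M = Q" "M * R = Q" "R * Q = 1\<^sub>m d"
  proof -
    have "R * fc d M (\<lambda>x. x) = Q" "fc d M (\<lambda>x. x) * R = Q"
      unfolding R_def Q_def fc_mult[OF Mh] using pos by (intro fc_cong; simp add: real_div_sqrt less_imp_le)+
    then show "R * M = Q" "M * R = Q" unfolding fM .
    have "R * Q = fc d M (\<lambda>x. 1)" unfolding R_def Q_def fc_mult[OF Mh] using pos by (intro fc_cong) force
    then show "R * Q = 1\<^sub>m d" unfolding fc_one[OF Mh] .
  qed
  have RMR: "R * (M * R) = 1\<^sub>m d" using RM by simp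
  define \<Lambda> where "\<Lambda> t = R * T t * R" for t
  have Lp: "psd d (\<Lambda> t)" if "t < k" for t unfolding \<Lambda>_def using psd_conj[OF Tp[OF that] Rc(1)] Rc by simp
  have "psd d (1\<^sub>m d - mix d w \<Lambda> k)"
  proof -
    have "mix d w \<Lambda> k = R * M0 * R"
      unfolding \<Lambda>_def[abs_def] M0_def using Rc Tc by (simp add: mix_mult_left mix_mult_right)
    moreover have "R * (M - M0) * R = 1\<^sub>m d - R * M0 * R"
      using RMR Rc Mc M0(2) by (simp add: mult_minus_square[of _ d] assoc_square[of _ d])
    moreover have "M - M0 = complex_of_real \<kappa> \<cdot>\<^sub>m 1\<^sub>m d" unfolding M_def using M0(2) by (intro eq_matI) auto
    ultimately show ?thesis using psd_conj[OF Kp Rc(1)] by (metis Rc(2))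
  qed
  moreover have "1 - rtr (\<Lambda> t * \<rho>) \<le> 3 / 2 * (1 - rtr (T t * \<rho>))
       + 9 / 2 * ((\<Sum>s<k. (if s = t then 0 else w s) * rtr (T s * \<rho>)) + \<kappa>)"
    if t: "t < k" and wt: "w t = 1" and \<rho>: "dens d \<rho>" for t \<rho>
  proof -
    define S where "S = T t"
    define V where "V = M - S"
    have S: "eff d S" "S \<in> carrier_mat d d" using T[OF t] by (auto simp: S_def)
    have \<rho>p: "psd d \<rho>" "rtr \<rho> = 1" "\<rho> \<in> carrier_mat d d" using densD[OF \<rho>] by auto
    have Vc: "V \<in> carrier_mat d d" using Mc S by (simp add: V_def)
    have VV: "V = mix d (\<lambda>s. if s = t then 0 else w s) T k + complex_of_real \<kappa> \<cdot>\<^sub>m 1\<^sub>m d"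
    proof -
      have "mix d (\<lambda>s. if s = t then 0 else w s) T k = M0 - S"
        unfolding M0_def S_def using mix_minus_summand(1)[of k d T t w] Tp t w wt by simp
      then show ?thesis unfolding V_def M_def using M0(2) S(2) by (intro eq_matI) auto
    qed
    have Vp: "psd d V" unfolding VV using Tp w by (intro psd_add Kp mix_psd) auto
    have v: "rtr (V * \<rho>) = (\<Sum>s<k. (if s = t then 0 else w s) * rtr (T s * \<rho>)) + \<kappa>"
    proof -
      have "rtr (mix d (\<lambda>s. if s = t then 0 else w s) T k * \<rho>) = rtr (\<rho> * mix d (\<lambda>s. if s = t then 0 else w s) T k)"
        using \<rho>p by (intro rtr_mult_comm[of _ d]) auto
      also have "\<dots> = (\<Sum>s<k. (if s = t then 0 else w s) * rtr (\<rho> * T s))"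
        using \<rho>p Tc by (intro rtr_mult_mix) auto
      also have "\<dots> = (\<Sum>s<k. (if s = t then 0 else w s) * rtr (T s * \<rho>))"
        using \<rho>p Tc by (intro sum.cong refl arg_cong2[where f = "(*)"] rtr_mult_comm[of _ d]) auto
      finally show ?thesis using \<rho>p unfolding VV
        by (simp add: mult_add_square[of _ d] rtr_add[of _ d] mult_smult_assoc_mat[of _ d d _ d] rtr_smult[of _ d])
    qed
    have m: "rtr (M * \<rho>) = rtr (V * \<rho>) + rtr (S * \<rho>)"
      unfolding V_def using Mc S \<rho>p by (simp add: mult_minus_square[of _ d] rtr_minus[of _ d])
    \<comment> \<open>M - S^2 = V + (S - S^2) is positive, so the root Q of M dominates S by
      operator monotonicity.\<close>
    have QS: "rtr (S * \<rho>) \<le> rtr (Q * \<rho>)"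
    proof -
      have "psd d (V + (S - S * S))" by (rule psd_add[OF Vp eff_square[OF S(1)]])
      also have "V + (S - S * S) = Q * Q - S * S" unfolding Q(2) V_def using Mc S by (intro eq_matI) auto
      finally have "psd d (Q - S)" by (rule psd_diff_of_squares[OF Q(1) effD(1)[OF S(1)]])
      then show ?thesis using \<rho>p S Qc by (intro rtr_mult_mono) auto
    qed
    have L: "rtr (\<Lambda> t * \<rho>) = 1 - rtr (R * V * R * \<rho>)"
    proof -
      have "R * V * R = 1\<^sub>m d - \<Lambda> t"
        unfolding V_def \<Lambda>_def S_def[symmetric] using RMR Rc Mc S by (simp add: mult_minus_square[of _ d] assoc_square[of _ d])
      then show ?thesis using \<rho>p Lp[OF t] by (simp add: mult_minus_square[of _ d] rtr_minus[of _ d])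
    qed
    \<comment> \<open>The failure operator of symbol t is R V R. Positivity of (R - 3) V (R - 3)
      bounds the cross terms R V + V R by (R V R + 9 V) / 3; V <= M inside (R - 1) V (R - 1) bounds
      R V R minus the cross terms plus V by 1 - 2 Q + M. Eliminating the cross terms and using Q >=
      S in the state \<rho> gives the coefficients 3/2 and 9/2, the Hayashi-Nagaoka inequality with
      parameter 1/2.\<close>
    define C where "C = R - complex_of_real 3 \<cdot>\<^sub>m 1\<^sub>m d"
    define B where "B = R - 1\<^sub>m d"
    have Cc: "C \<in> carrier_mat d d" "adj C = C" "B \<in> carrier_mat d d" "adj B = B"
      using Rc by (auto simp: C_def B_def adj_minus[of _ d d])
    have C0: "0 \<le> rtr (C * V * C * \<rho>)" using psd_mult_rtr_nonneg[OF psd_conj[OF Vp Cc(1)] \<rho>p(1)] Cc by simp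
    have B0: "rtr (B * V * B * \<rho>) \<le> rtr (B * M * B * \<rho>)"
    proof -
      have "psd d (adj B * S * B)" using psd_conj[OF effD(1)[OF S(1)] Cc(3)] .
      from psd_mult_rtr_nonneg[OF this \<rho>p(1)] have "0 \<le> rtr (B * S * B * \<rho>)" by (simp only: Cc)
      moreover have "B * V * B * \<rho> = B * M * B * \<rho> - B * S * B * \<rho>"
        unfolding V_def using Cc(3) Mc S(2) \<rho>p(3) by (simp add: mult_minus_square[of _ d] assoc_square[of _ d])
      ultimately show ?thesis using Cc(3) Mc S(2) \<rho>p(3) by (simp add: rtr_minus[of _ d])
    qed
    have Cx: "rtr (C * V * C * \<rho>) = rtr (R * V * R * \<rho>) - 3 * rtr (R * V * \<rho>) - 3 * rtr (V * R * \<rho>) + 9 * rtr (V * \<rho>)"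
      unfolding C_def using Rc Vc \<rho>p
      by (simp add: mult_minus_square[of _ d] rtr_minus[of _ d] mult_smult_assoc_mat[of _ d d _ d]
          mult_smult_distrib[of _ d d _ d] rtr_smult[of _ d, of _ 3, simplified] assoc_square[of _ d])
    have Bx: "rtr (B * W * B * \<rho>) = rtr (R * W * R * \<rho>) - rtr (R * W * \<rho>) - rtr (W * R * \<rho>) + rtr (W * \<rho>)"
      if "W \<in> carrier_mat d d" for W
      unfolding B_def using Rc that \<rho>p
      by (simp add: mult_minus_square[of _ d] rtr_minus[of _ d] assoc_square[of _ d])
    have y3: "rtr (B * M * B * \<rho>) = 1 - 2 * rtr (Q * \<rho>) + rtr (M * \<rho>)"
    proof -
      have "R * M * R = 1\<^sub>m d" using RMR Rc(1) Mc by (simp add: assoc_square[of _ d])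
      then have "R * M * R * \<rho> = \<rho>" using \<rho>p(3) by simp
      then show ?thesis using Bx[OF Mc] RM \<rho>p(2) by simp
    qed
    have y1: "3 * (rtr (R * V * \<rho>) + rtr (V * R * \<rho>)) \<le> rtr (R * V * R * \<rho>) + 9 * rtr (V * \<rho>)"
    proof -
      have gen: "0 \<le> c \<Longrightarrow> c = x - 3 * a - 3 * b + 9 * v \<Longrightarrow> 3 * (a + b) \<le> x + 9 * v" for a b c v x :: real
        by argo
      show ?thesis by (rule gen[OF C0 Cx])
    qed
    have y2: "rtr (R * V * R * \<rho>) - (rtr (R * V * \<rho>) + rtr (V * R * \<rho>)) + rtr (V * \<rho>) \<le> rtr (B * M * B * \<rho>)"
      using B0 Bx[OF Vc] by linarith
    have "rtr (R * V * R * \<rho>) \<le> 3 / 2 * (1 - rtr (S * \<rho>)) + 9 / 2 * rtr (V * \<rho>)"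
    proof -
      have gen: "3 * y \<le> x + 9 * v \<Longrightarrow> x - y + v \<le> b \<Longrightarrow> b = 1 - 2 * q + m \<Longrightarrow> s \<le> q \<Longrightarrow> m = v + s
         \<Longrightarrow> x \<le> 3 / 2 * (1 - s) + 9 / 2 * v" for x y v b q m s :: real
        by argo
      show ?thesis by (rule gen[OF y1 y2 y3 QS m])
    qed
    then show ?thesis unfolding L v S_def by simp
  qed
  ultimately show ?thesis using Lp by blast
qed

section \<open>Privacy amplification\<close>

text \<open>Cauchy-Schwarz in the geometry of \<open>G\<close>: the matrix is written as G^(1/4) B
  G^(1/4), and the outer quarter powers are given to the contraction that attains its trace norm.
  This trades the trace norm for an expression quadratic in \<open>A\<close>, whose average over
  random maps can be computed.\<close>

lemma tnorm_le_weighted: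
  assumes A: "herm d A" and G: "psd d G" and \<kappa>: "0 < \<kappa>" "psd d (G - complex_of_real \<kappa> \<cdot>\<^sub>m 1\<^sub>m d)"
  defines "N \<equiv> fc d G (\<lambda>x. 1 / sqrt x)"
  shows "tnorm A \<le> sqrt (rtr G * rtr (N * A * (N * A)))"
proof -
  have h: "herm d G" using G by (rule psd_herm)
  have pos: "0 < eigs d G i" if "i < d" for i using fc_pos_eigs[OF h \<kappa>(2) that] \<kappa>(1) by simp
  define S where "S = fc d G sqrt"
  define R where "R = fc d G (\<lambda>x. sqrt (sqrt x))"
  define I where "I = fc d G (\<lambda>x. 1 / sqrt (sqrt x))"
  have c: "S \<in> carrier_mat d d" "R \<in> carrier_mat d d" "I \<in> carrier_mat d d" "N \<in> carrier_mat d d" "A \<in> carrier_mat d d" "G \<in> carrier_mat d d"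
    using A G by (simp_all add: S_def R_def I_def N_def fc_carrier[OF h])
  have ad: "adj S = S" "adj R = R" "adj I = I" "adj A = A"
    using A by (simp_all add: S_def R_def I_def fc_adj[OF h] herm_def)
  have RI: "R * I = 1\<^sub>m d" "I * R = 1\<^sub>m d" "R * R = S" "I * I = N" "S * S = G"
  proof -
    have "R * I = fc d G (\<lambda>x. 1)" "I * R = fc d G (\<lambda>x. 1)"
      unfolding R_def I_def fc_mult[OF h] using pos by (intro fc_cong; force)+
    then show "R * I = 1\<^sub>m d" "I * R = 1\<^sub>m d" unfolding fc_one[OF h] .
    show "R * R = S" "I * I = N" unfolding R_def S_def I_def N_def fc_mult[OF h]
      using pos by (intro fc_cong; simp add: less_imp_le)+
    show "S * S = G" unfolding S_def by (rule psd_root(2)[OF G])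
  qed
  define B where "B = I * A * I"
  have Bc: "B \<in> carrier_mat d d" using c by (simp add: B_def)
  have Bad: "adj B = B" using c ad by (simp add: B_def adj_mult[of _ d d _ d] assoc_square[of _ d])
  have AB: "A = R * B * R"
  proof -
    have "R * B * R = (R * I) * A * (I * R)" using c by (simp add: B_def assoc_square[of _ d])
    then show ?thesis using c by (simp add: RI)
  qed
  obtain Y where Y: "contr d Y" "rtr (Y * A) = tnorm A" using tnorm_attained[OF c(5)] by blast
  have Yc: "Y \<in> carrier_mat d d" using Y(1) by simp
  define K where "K = R * adj Y * R"
  have Kc: "K \<in> carrier_mat d d" using c Yc by (simp add: K_def)
  have "rtr (Y * A) = rtr (Y * (R * B) * R)" unfolding AB using c Bc Yc by (simp add: assoc_square[of _ d])
  also have "\<dots> = rtr (R * (Y * (R * B)))" using c Bc Yc by (intro rtr_mult_comm[of _ d]) auto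
  also have "\<dots> = rtr (adj K * B)" unfolding K_def using c Bc Yc ad by (simp add: adj_mult[of _ d d _ d] assoc_square[of _ d])
  finally have 1: "tnorm A = rtr (adj K * B)" using Y(2) by simp
  have 2: "rtr (adj K * B) \<le> sqrt (rtr (adj K * K)) * sqrt (rtr (adj B * B))"
    by (rule hilbert_schmidt_Cauchy_Schwarz[OF Kc Bc])
  have 3: "rtr (adj B * B) = rtr (N * A * (N * A))"
  proof -
    have "rtr (adj B * B) = rtr (I * (A * N * A * I))"
      unfolding Bad unfolding B_def RI(4)[symmetric] using c by (simp add: assoc_square[of _ d])
    also have "\<dots> = rtr (A * N * A * I * I)" using c by (intro rtr_mult_comm[of _ d]) auto
    also have "\<dots> = rtr (A * N * A * N)" unfolding RI(4)[symmetric] using c by (simp add: assoc_square[of _ d])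
    also have "\<dots> = rtr (N * (A * N * A))" using c by (intro rtr_mult_comm[of _ d]) auto
    finally show ?thesis using c by (simp add: assoc_square[of _ d])
  qed
  \<comment> \<open>With S the root of G this is the trace of Y S \<open>adj Y\<close> S. A second
    Cauchy-Schwarz separates S \<open>adj Y\<close> from \<open>adj Y\<close> S, and each has
    squared norm at most tr G.\<close>
  have 4: "rtr (adj K * K) \<le> rtr G"
  proof -
    have "rtr (adj K * K) = rtr (R * (Y * S * adj Y * R))"
      unfolding K_def RI(3)[symmetric] using c Yc ad by (simp add: adj_mult[of _ d d _ d] assoc_square[of _ d])
    also have "\<dots> = rtr (Y * S * adj Y * R * R)" using c Yc by (intro rtr_mult_comm[of _ d]) auto
    also have "\<dots> = rtr (Y * S * adj Y * S)" unfolding RI(3)[symmetric] using c Yc by (simp add: assoc_square[of _ d])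
    also have "\<dots> = rtr (adj (S * adj Y) * (adj Y * S))" using c Yc ad by (simp add: adj_mult[of _ d d _ d] assoc_square[of _ d])
    finally have a: "rtr (adj K * K) = rtr (adj (S * adj Y) * (adj Y * S))" .
    have b: "rtr (adj (S * adj Y) * (adj Y * S)) \<le> sqrt (rtr (adj (S * adj Y) * (S * adj Y))) * sqrt (rtr (adj (adj Y * S) * (adj Y * S)))"
      using c Yc by (intro hilbert_schmidt_Cauchy_Schwarz) auto
    have "rtr (adj (S * adj Y) * (S * adj Y)) = rtr (Y * (G * adj Y))"
      unfolding RI(5)[symmetric] using c Yc ad by (simp add: adj_mult[of _ d d _ d] assoc_square[of _ d])
    also have "\<dots> = rtr (G * adj Y * Y)" using c Yc by (intro rtr_mult_comm[of _ d]) auto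
    also have "\<dots> = rtr (G * (adj Y * Y))" using c Yc by (simp add: assoc_square[of _ d])
    also have "\<dots> = rtr (adj Y * Y * G)" using c Yc by (intro rtr_mult_comm[of _ d]) auto
    finally have e1: "rtr (adj (S * adj Y) * (S * adj Y)) \<le> rtr G" using contr_rtr_le[OF Y(1) G] by simp
    have "rtr (adj (adj Y * S) * (adj Y * S)) = rtr (S * (Y * adj Y * S))"
      using c Yc ad by (simp add: adj_mult[of _ d d _ d] assoc_square[of _ d])
    also have "\<dots> = rtr (Y * adj Y * S * S)" using c Yc by (intro rtr_mult_comm[of _ d]) auto
    also have "\<dots> = rtr (adj (adj Y) * adj Y * G)" unfolding RI(5)[symmetric] using c Yc by (simp add: assoc_square[of _ d])
    finally have e2: "rtr (adj (adj Y * S) * (adj Y * S)) \<le> rtr G" using contr_rtr_le[OF contr_adj[OF Y(1)] G] by simp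
    have g: "0 \<le> rtr G" using psd_rtr_nonneg[OF G] .
    have "sqrt (rtr (adj (S * adj Y) * (S * adj Y))) * sqrt (rtr (adj (adj Y * S) * (adj Y * S))) \<le> sqrt (rtr G) * sqrt (rtr G)"
      by (rule mult_mono[OF real_sqrt_le_mono[OF e1] real_sqrt_le_mono[OF e2]])
        (use g rtr_adj_mult_self_nonneg[of "adj Y * S" d] c Yc in auto)
    then show ?thesis using a b g by simp
  qed
  have b0: "0 \<le> rtr (adj B * B)" by (rule rtr_adj_mult_self_nonneg[OF Bc])
  have "sqrt (rtr (adj K * K)) * sqrt (rtr (adj B * B)) \<le> sqrt (rtr G) * sqrt (rtr (adj B * B))"
    by (rule mult_right_mono[OF real_sqrt_le_mono[OF 4]]) (use b0 in simp)
  then show ?thesis using 1 2 3 by (simp add: real_sqrt_mult)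
qed

text \<open>Domination by \<open>G\<close> makes N B N at most the identity. This is where the
  min-entropy acts: the self-collision of a conditional state is bounded by its trace.\<close>

lemma weighted_collision_le:
  assumes G: "psd d G" and \<kappa>: "0 < \<kappa>" "psd d (G - complex_of_real \<kappa> \<cdot>\<^sub>m 1\<^sub>m d)"
    and B: "psd d B" "psd d (G - B)"
  defines "N \<equiv> fc d G (\<lambda>x. 1 / sqrt x)"
  shows "0 \<le> rtr (N * B * (N * B))" "rtr (N * B * (N * B)) \<le> rtr B"
proof -
  have h: "herm d G" using G by (rule psd_herm)
  have pos: "0 < eigs d G i" if "i < d" for i using fc_pos_eigs[OF h \<kappa>(2) that] \<kappa>(1) by simp
  have c: "N \<in> carrier_mat d d" "B \<in> carrier_mat d d" "G \<in> carrier_mat d d" "adj N = N"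
    using G B by (simp_all add: N_def fc_carrier[OF h] fc_adj[OF h])
  have "N * fc d G (\<lambda>x. x) * N = fc d G (\<lambda>x. 1)"
    unfolding N_def fc_mult[OF h] using pos by (intro fc_cong) (force simp: real_div_sqrt less_imp_le)
  then have NGN: "N * G * N = 1\<^sub>m d" unfolding eigsys(2)[OF h] fc_one[OF h] .
  have e: "rtr (N * B * (N * B)) = rtr (N * B * N * B)" using c by (simp add: assoc_square[of _ d])
  have p: "psd d (N * B * N)" using psd_conj[OF B(1) c(1)] c by simp
  show "0 \<le> rtr (N * B * (N * B))" unfolding e by (rule psd_mult_rtr_nonneg[OF p B(1)])
  have "psd d (adj N * (G - B) * N)" by (rule psd_conj[OF B(2) c(1)])
  moreover have "adj N * (G - B) * N = 1\<^sub>m d - N * B * N"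
    unfolding c(4) NGN[symmetric] using c(1-3) by (simp add: mult_minus_square[of _ d])
  ultimately have nb: "psd d (1\<^sub>m d - N * B * N)" by (simp only:)
  have "rtr (N * B * N * B) \<le> rtr (1\<^sub>m d * B)" using c(1-3) by (intro rtr_mult_mono[OF nb B(1)]) simp_all
  then show "rtr (N * B * (N * B)) \<le> rtr B" unfolding e using c by simp
qed

text \<open>Pairwise independence of a uniformly random function, in counting form: the k - 2 points
  other than t and t' contribute one factor \<open>card S\<close> each.\<close>

lemma sum_PiE_pair:
  fixes u v :: "'a \<Rightarrow> real"
  assumes S: "finite S" and t: "t < k" "t' < k" "t \<noteq> t'"
  shows "(\<Sum>g\<in>PiE {..<k} (\<lambda>_. S). u (g t) * v (g t')) = real (card S) ^ (k - 2) * (sum u S * sum v S)"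
proof -
  define f where "f x = (if x = t then u else if x = t' then v else (\<lambda>_. 1))" for x
  have split: "(\<Prod>x<k. h x) = h t * (h t' * (\<Prod>x\<in>{..<k} - {t} - {t'}. h x))" for h :: "nat \<Rightarrow> real"
    using t by (subst prod.remove[of _ t], simp, simp, subst prod.remove[of _ t']) auto
  have card: "card ({..<k} - {t} - {t'}) = k - 2" using t by (simp add: card_Diff_subset)
  have "(\<Prod>x<k. \<Sum>y\<in>S. f x y) = (\<Sum>g\<in>PiE {..<k} (\<lambda>_. S). \<Prod>x<k. f x (g x))"
    using S by (intro prod_sum_PiE) auto
  moreover have "(\<Prod>x<k. f x (g x)) = u (g t) * v (g t')" for g
  proof -
    have "(\<Prod>x\<in>{..<k} - {t} - {t'}. f x (g x)) = 1" by (intro prod.neutral) (auto simp: f_def)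
    then show ?thesis unfolding split[of "\<lambda>x. f x (g x)"] using t by (simp add: f_def)
  qed
  moreover have "(\<Prod>x<k. \<Sum>y\<in>S. f x y) = real (card S) ^ (k - 2) * (sum u S * sum v S)"
  proof -
    have "(\<Prod>x\<in>{..<k} - {t} - {t'}. \<Sum>y\<in>S. f x y) = (\<Prod>x\<in>{..<k} - {t} - {t'}. real (card S))"
      by (intro prod.cong) (auto simp: f_def)
    then show ?thesis unfolding split[of "\<lambda>x. \<Sum>y\<in>S. f x y"] using t card by (simp add: f_def)
  qed
  ultimately show ?thesis by simp
qed

lemma tnorm_abs_rtr_le:
  assumes "A \<in> carrier_mat d d" shows "\<bar>rtr A\<bar> \<le> tnorm A"
proof -
  have "(1\<^sub>m d :: complex mat) - 0\<^sub>m d d = 1\<^sub>m d" by (intro eq_matI) auto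
  then have "eff d (0\<^sub>m d d)" unfolding eff_def by simp
  from tnorm_eff_ge[OF assms this] have "- rtr A \<le> tnorm A" using assms by (simp add: left_mult_zero_mat[of _ d d])
  then show ?thesis using rtr_le_tnorm[OF assms] by simp
qed

lemma eff_compl: "eff d T \<Longrightarrow> eff d (1\<^sub>m d - T)"
proof -
  assume T: "eff d T"
  have "1\<^sub>m d - (1\<^sub>m d - T) = T" using eff_carrier[OF T] by (intro eq_matI) auto
  then show ?thesis unfolding eff_def using effD[OF T] by simp
qed

lemma tnorm_eff_abs:
  assumes A: "A \<in> carrier_mat d d" and T: "eff d T"
  shows "\<bar>2 * rtr (T * A) - rtr A\<bar> \<le> tnorm A"
proof -
  have "rtr ((1\<^sub>m d - T) * A) = rtr A - rtr (T * A)"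
    using A eff_carrier[OF T] by (simp add: mult_minus_square[of _ d] rtr_minus[of _ d])
  then show ?thesis using tnorm_eff_ge[OF A T] tnorm_eff_ge[OF A eff_compl[OF T]] by (simp add: abs_le_iff)
qed

text \<open>A triangle inequality: the test that is optimal for the left-hand side is evaluated on
  each summand.\<close>

lemma tnorm_mix_perturb:
  assumes X: "\<And>t. t < k \<Longrightarrow> herm d (X t)" and Y: "\<And>t. t < k \<Longrightarrow> herm d (Y t)"
  shows "tnorm (mix d c X k) \<le> tnorm (mix d c Y k) + (\<Sum>t<k. \<bar>c t\<bar> * tnorm (X t - Y t))"
proof -
  have Xc: "X t \<in> carrier_mat d d" and Yc: "Y t \<in> carrier_mat d d" if "t < k" for t using X[OF that] Y[OF that] by auto
  obtain T where T: "eff d T" and eq: "tnorm (mix d c X k) = 2 * rtr (T * mix d c X k) - rtr (mix d c X k)"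
  proof -
    have "herm d (mix d c X k)" using X by (intro mix_herm)
    then show ?thesis using that tnorm_herm_attained by blast
  qed
  have Tc: "T \<in> carrier_mat d d" using T by simp
  have m: "2 * rtr (T * mix d c Z k) - rtr (mix d c Z k) = (\<Sum>t<k. c t * (2 * rtr (T * Z t) - rtr (Z t)))"
    if "\<And>t. t < k \<Longrightarrow> Z t \<in> carrier_mat d d" for Z
  proof -
    have "rtr (T * mix d c Z k) = (\<Sum>t<k. c t * rtr (T * Z t))" using Tc that by (intro rtr_mult_mix) auto
    moreover have "rtr (mix d c Z k) = (\<Sum>t<k. c t * rtr (Z t))" using that by (intro rtr_mix) auto
    ultimately show ?thesis
      by (simp add: sum_subtractf right_diff_distrib sum_distrib_left mult.left_commute)
  qed
  have mX: "2 * rtr (T * mix d c X k) - rtr (mix d c X k) = (\<Sum>t<k. c t * (2 * rtr (T * X t) - rtr (X t)))"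
    and mY: "2 * rtr (T * mix d c Y k) - rtr (mix d c Y k) = (\<Sum>t<k. c t * (2 * rtr (T * Y t) - rtr (Y t)))"
    by (rule m, rule Xc, assumption, rule m, rule Yc, assumption)
  have "tnorm (mix d c X k) - (2 * rtr (T * mix d c Y k) - rtr (mix d c Y k)) =
     (\<Sum>t<k. c t * (2 * rtr (T * (X t - Y t)) - rtr (X t - Y t)))"
    unfolding eq mX mY sum_subtractf[symmetric]
  proof (intro sum.cong refl)
    fix t assume "t \<in> {..<k}"
    then have "X t \<in> carrier_mat d d" "Y t \<in> carrier_mat d d" using Xc Yc by auto
    then have "rtr (T * (X t - Y t)) = rtr (T * X t) - rtr (T * Y t)" "rtr (X t - Y t) = rtr (X t) - rtr (Y t)"
      using Tc by (simp_all add: mult_minus_square[of _ d] rtr_minus[of _ d])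
    then show "c t * (2 * rtr (T * X t) - rtr (X t)) - c t * (2 * rtr (T * Y t) - rtr (Y t)) =
      c t * (2 * rtr (T * (X t - Y t)) - rtr (X t - Y t))" by (simp only: right_diff_distrib)
  qed
  also have "\<dots> \<le> (\<Sum>t<k. \<bar>c t\<bar> * tnorm (X t - Y t))"
  proof (rule sum_mono)
    fix t assume "t \<in> {..<k}"
    then have "\<bar>2 * rtr (T * (X t - Y t)) - rtr (X t - Y t)\<bar> \<le> tnorm (X t - Y t)"
      using Xc Yc by (intro tnorm_eff_abs[OF _ T]) auto
    then have "\<bar>c t * (2 * rtr (T * (X t - Y t)) - rtr (X t - Y t))\<bar> \<le> \<bar>c t\<bar> * tnorm (X t - Y t)"
      unfolding abs_mult by (intro mult_left_mono) auto
    then show "c t * (2 * rtr (T * (X t - Y t)) - rtr (X t - Y t)) \<le> \<bar>c t\<bar> * tnorm (X t - Y t)" by linarith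
  qed
  finally show ?thesis using tnorm_eff_ge[OF mix_carrier T, of c Y k] by linarith
qed

lemma one_eq_bdiag: "1\<^sub>m (k * d) = bdiag k d (\<lambda>_. 1\<^sub>m d)"
proof (rule eq_blocksI[of _ k d])
  fix t s i j assume h: "t < k" "s < k" "i < d" "j < d"
  have "t * d + i = s * d + j \<longleftrightarrow> t = s \<and> i = j"
  proof
    assume eq: "t * d + i = s * d + j"
    have "(t * d + i) div d = t" "(s * d + j) div d = s" using h by auto
    then have "t = s" using eq by simp
    then show "t = s \<and> i = j" using eq by simp
  qed simp
  then show "1\<^sub>m (k * d) $$ (t * d + i, s * d + j) = bdiag k d (\<lambda>_. 1\<^sub>m d) $$ (t * d + i, s * d + j)"
    using h by (simp add: bdiag_index block_index_less)
qed auto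

lemma eff_bdiag:
  assumes "\<And>t. t < k \<Longrightarrow> eff d (T t)" "0 < d"
  shows "eff (k * d) (bdiag k d T)"
proof -
  have "1\<^sub>m (k * d) - bdiag k d T = bdiag k d (\<lambda>t. 1\<^sub>m d - T t)"
    using assms eff_carrier by (subst bdiag_diff[symmetric]) (auto simp: one_eq_bdiag)
  then show ?thesis unfolding eff_def using effD[OF assms(1)] by (auto intro!: psd_bdiag)
qed

text \<open>The optimal tests of the blocks assemble into one block-diagonal effect. As \<rho>' may
  be subnormalized, the sum of the trace norms is the advantage of this effect minus that of its
  complement, and each contributes at most e.\<close>

lemma pinching_distance:
  assumes P: "pdistr k P" and \<zeta>: "\<And>t. t < k \<Longrightarrow> dens d (\<zeta> t)" and d: "0 < d"
    and \<rho>': "subdens (k * d) \<rho>'" "pdist (cq_state k d P \<zeta>) \<rho>' \<le> e" "0 \<le> e"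
  shows "(\<Sum>t<k. tnorm (complex_of_real (P t) \<cdot>\<^sub>m \<zeta> t - blk d t \<rho>')) \<le> 2 * e"
proof -
  have rp: "psd (k * d) \<rho>'" and rc: "\<rho>' \<in> carrier_mat (k * d) (k * d)" using \<rho>'(1) by (auto simp: subdens_def)
  define \<Delta> where "\<Delta> t = complex_of_real (P t) \<cdot>\<^sub>m \<zeta> t - blk d t \<rho>'" for t
  have z: "psd d (\<zeta> t)" "\<zeta> t \<in> carrier_mat d d" if "t < k" for t using densD[OF \<zeta>[OF that]] by auto
  have h: "herm d (\<Delta> t)" if "t < k" for t
    unfolding \<Delta>_def using P that z[OF that] psd_blk[OF rp that]
    by (intro herm_diff psd_herm psd_smult) (auto simp: pdistr_def)
  have "\<exists>T. eff d T \<and> tnorm (\<Delta> t) = 2 * rtr (T * \<Delta> t) - rtr (\<Delta> t)" if "t < k" for t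
    using tnorm_herm_attained[OF h[OF that]] by blast
  then obtain T where T: "\<And>t. t < k \<Longrightarrow> eff d (T t)"
    and eq: "\<And>t. t < k \<Longrightarrow> tnorm (\<Delta> t) = 2 * rtr (T t * \<Delta> t) - rtr (\<Delta> t)" by metis
  have Tc: "T t \<in> carrier_mat d d" if "t < k" for t using T[OF that] by simp
  let ?B = "bdiag k d T"
  let ?\<rho> = "cq_state k d P \<zeta>"
  have B: "eff (k * d) ?B" using T d by (rule eff_bdiag)
  have Bc: "?B \<in> carrier_mat (k * d) (k * d)" by simp
  have rd: "dens (k * d) ?\<rho>" using \<zeta> P d by (rule cq_state_dens)
  have cq: "?\<rho> = bdiag k d (\<lambda>t. complex_of_real (P t) \<cdot>\<^sub>m \<zeta> t)"
    using z d by (intro cq_state_eq_bdiag) auto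
  have 1: "rtr (?B * ?\<rho>) - rtr (?B * \<rho>') = (\<Sum>t<k. rtr (T t * \<Delta> t))"
  proof -
    have "rtr (?B * ?\<rho>) = (\<Sum>t<k. rtr (T t * (complex_of_real (P t) \<cdot>\<^sub>m \<zeta> t)))"
      unfolding cq using Tc z by (simp add: bdiag_mult rtr_bdiag)
    moreover have "rtr (?B * \<rho>') = rtr (\<rho>' * ?B)" using rc by (intro rtr_mult_comm[of _ "k * d"]) auto
    moreover have "rtr (\<rho>' * ?B) = (\<Sum>t<k. rtr (blk d t \<rho>' * T t))" using rc Tc by (intro rtr_mult_bdiag) auto
    moreover have "(\<Sum>t<k. rtr (blk d t \<rho>' * T t)) = (\<Sum>t<k. rtr (T t * blk d t \<rho>'))"
      using Tc by (intro sum.cong refl rtr_mult_comm[of _ d]) auto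
    ultimately have "rtr (?B * ?\<rho>) - rtr (?B * \<rho>') = (\<Sum>t<k. rtr (T t * (complex_of_real (P t) \<cdot>\<^sub>m \<zeta> t)) - rtr (T t * blk d t \<rho>'))"
      by (simp add: sum_subtractf)
    also have "\<dots> = (\<Sum>t<k. rtr (T t * \<Delta> t))"
      unfolding \<Delta>_def using Tc z by (intro sum.cong refl) (simp add: mult_minus_square[of _ d] rtr_minus[of _ d])
    finally show ?thesis .
  qed
  have 2: "rtr ?\<rho> - rtr \<rho>' = (\<Sum>t<k. rtr (\<Delta> t))"
  proof -
    have "rtr ?\<rho> = (\<Sum>t<k. rtr (complex_of_real (P t) \<cdot>\<^sub>m \<zeta> t))"
      unfolding cq using z by (simp add: rtr_bdiag)
    moreover have "rtr \<rho>' = (\<Sum>t<k. rtr (blk d t \<rho>'))"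
      using rc by (simp add: rtr_def mtrace_eq[of _ "k * d" "k * d"] sum_blocks) (simp add: mtrace_eq[of _ d d] submat_def mtrace_def)
    ultimately have "rtr ?\<rho> - rtr \<rho>' = (\<Sum>t<k. rtr (complex_of_real (P t) \<cdot>\<^sub>m \<zeta> t) - rtr (blk d t \<rho>'))"
      by (simp add: sum_subtractf)
    then show ?thesis unfolding \<Delta>_def using z by (simp add: rtr_minus[of _ d])
  qed
  have 3: "\<bar>rtr (?B * ?\<rho>) - rtr (?B * \<rho>')\<bar> \<le> e" by (rule pdist_test[OF rd \<rho>' B])
  have 4: "\<bar>rtr ((1\<^sub>m (k * d) - ?B) * ?\<rho>) - rtr ((1\<^sub>m (k * d) - ?B) * \<rho>')\<bar> \<le> e"
    by (rule pdist_test[OF rd \<rho>' eff_compl[OF B]])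
  have 5: "rtr ((1\<^sub>m (k * d) - ?B) * R) = rtr R - rtr (?B * R)" if "R \<in> carrier_mat (k * d) (k * d)" for R
    using that Bc by (simp add: mult_minus_square[of _ "k * d"] rtr_minus[of _ "k * d"])
  have "(\<Sum>t<k. tnorm (\<Delta> t)) = (\<Sum>t<k. rtr (T t * \<Delta> t)) + ((\<Sum>t<k. rtr (T t * \<Delta> t)) - (\<Sum>t<k. rtr (\<Delta> t)))"
    using eq by (simp add: sum.distrib[symmetric] sum_subtractf[symmetric])
  then have "(\<Sum>t<k. tnorm (\<Delta> t)) \<le> 2 * e"
    using 3 4 unfolding 5[OF densD(3)[OF rd]] 5[OF rc] 1[symmetric] 2[symmetric] by linarith
  then show ?thesis unfolding \<Delta>_def .
qed

text \<open>Leftover hashing against quantum side information: \<open>G\<close> dominates all conditional states, and the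
  second moment of the deviation in the geometry given by \<open>G\<close> only retains its diagonal terms.\<close>
lemma leftover_hash:
  assumes \<rho>: "\<And>t. t < k \<Longrightarrow> psd d (\<rho> t)" and G: "psd d G" and \<kappa>: "0 < \<kappa>" "psd d (G - complex_of_real \<kappa> \<cdot>\<^sub>m 1\<^sub>m d)"
    and dom: "\<And>t. t < k \<Longrightarrow> psd d (G - \<rho> t)" and S: "finite S" "S \<noteq> {}"
  defines "H \<equiv> PiE {..<k} (\<lambda>_. S)" and "L \<equiv> real (card S)"
  shows "(\<Sum>g\<in>H. \<Sum>s\<in>S. tnorm (mix d (\<lambda>t. (if g t = s then 1 else 0) - 1 / L) \<rho> k))
    \<le> real (card H) * sqrt (L * rtr G * (\<Sum>t<k. rtr (\<rho> t)))"
proof -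
  define N where "N = fc d G (\<lambda>x. 1 / sqrt x)"
  \<comment> \<open>The indicator of bin s minus its mean: for fixed s and t it averages to zero
    over the random value of \<open>g t\<close>.\<close>
  define c where "c g s t = (if g t = s then 1 else 0) - 1 / L" for g :: "nat \<Rightarrow> 'a" and s t
  define q where "q g s = rtr (N * mix d (c g s) \<rho> k * (N * mix d (c g s) \<rho> k))" for g s
  define b where "b t t' = rtr (N * \<rho> t * (N * \<rho> t'))" for t t'
  have L: "0 < L" using S by (simp add: L_def card_gt_0_iff)
  have rc: "\<rho> t \<in> carrier_mat d d" if "t < k" for t using \<rho>[OF that] by simp
  have Nc: "N \<in> carrier_mat d d" unfolding N_def by (rule fc_carrier[OF psd_herm[OF G]])
  have tn: "tnorm (mix d (c g s) \<rho> k) \<le> sqrt (rtr G * q g s)" for g s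
    unfolding q_def N_def using \<rho> by (intro tnorm_le_weighted[OF mix_herm G \<kappa>] psd_herm)
  have gq: "0 \<le> rtr G * q g s" for g s
  proof -
    have "0 \<le> sqrt (rtr G * q g s)" using tn[of g s] tnorm_nonneg[OF mix_carrier, of d "c g s" \<rho> k] by linarith
    then show ?thesis by simp
  qed
  have qe: "q g s = (\<Sum>t<k. \<Sum>t'<k. c g s t * c g s t' * b t t')" for g s
  proof -
    let ?A = "mix d (c g s) \<rho> k"
    have "q g s = rtr (N * ?A * N * ?A)" unfolding q_def using Nc by (simp add: assoc_square[of _ d])
    also have "\<dots> = (\<Sum>t'<k. c g s t' * rtr (N * ?A * N * \<rho> t'))"
      using Nc rc by (intro rtr_mult_mix) auto
    also have "\<dots> = (\<Sum>t'<k. c g s t' * (\<Sum>t<k. c g s t * b t t'))"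
    proof (intro sum.cong refl)
      fix t' assume "t' \<in> {..<k}"
      then have t': "\<rho> t' \<in> carrier_mat d d" using rc by simp
      have "rtr (N * ?A * N * \<rho> t') = rtr (N * (?A * N * \<rho> t'))" using Nc t' by (simp add: assoc_square[of _ d])
      also have "\<dots> = rtr (?A * N * \<rho> t' * N)" using Nc t' by (intro rtr_mult_comm[of _ d]) auto
      also have "\<dots> = rtr (?A * (N * \<rho> t' * N))" using Nc t' by (simp add: assoc_square[of _ d])
      also have "\<dots> = rtr (N * \<rho> t' * N * ?A)" using Nc t' by (intro rtr_mult_comm[of _ d]) auto
      also have "\<dots> = (\<Sum>t<k. c g s t * rtr (N * \<rho> t' * N * \<rho> t))" using Nc t' rc by (intro rtr_mult_mix) auto
      also have "\<dots> = (\<Sum>t<k. c g s t * b t t')"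
      proof (intro sum.cong refl)
        fix t assume "t \<in> {..<k}"
        then have t: "\<rho> t \<in> carrier_mat d d" using rc by simp
        have "rtr (N * \<rho> t' * N * \<rho> t) = rtr (N * \<rho> t' * (N * \<rho> t))" using Nc t t' by (simp add: assoc_square[of _ d])
        also have "\<dots> = rtr (N * \<rho> t * (N * \<rho> t'))" using Nc t t' by (intro rtr_mult_comm[of _ d]) auto
        finally show "c g s t * rtr (N * \<rho> t' * N * \<rho> t) = c g s t * b t t'" by (simp add: b_def)
      qed
      finally show "c g s t' * rtr (N * ?A * N * \<rho> t') = c g s t' * (\<Sum>t<k. c g s t * b t t')" by simp
    qed
    also have "\<dots> = (\<Sum>t'<k. \<Sum>t<k. c g s t * c g s t' * b t t')"
      by (simp add: sum_distrib_left mult_ac)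
    also have "\<dots> = (\<Sum>t<k. \<Sum>t'<k. c g s t * c g s t' * b t t')" by (rule sum.swap)
    finally show ?thesis .
  qed
  have csum: "(\<Sum>y\<in>S. (if y = s then 1 else 0) - 1 / L) = 0" if "s \<in> S" for s
    using that S L by (simp add: sum_subtractf L_def)
  \<comment> \<open>The bins of distinct symbols are independent and both factors have mean zero, so
    the cross terms disappear.\<close>
  have off: "(\<Sum>g\<in>H. \<Sum>s\<in>S. c g s t * c g s t') = 0" if "t < k" "t' < k" "t \<noteq> t'" for t t'
  proof -
    have "(\<Sum>g\<in>H. c g s t * c g s t') = 0" if "s \<in> S" for s
      unfolding c_def H_def
      using sum_PiE_pair[OF S(1) \<open>t < k\<close> \<open>t' < k\<close> \<open>t \<noteq> t'\<close>, of "\<lambda>y. (if y = s then 1 else 0) - 1 / L" "\<lambda>y. (if y = s then 1 else 0) - 1 / L"]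
        csum[OF that] by simp
    then show ?thesis by (subst sum.swap) simp
  qed
  have dia: "(\<Sum>s\<in>S. c g s t * c g s t) \<le> 1" if "g \<in> H" "t < k" for g t
  proof -
    have gt: "g t \<in> S" using that by (auto simp: H_def)
    have "c g s t * c g s t = (if s = g t then 1 - 2 / L else 0) + 1 / L * (1 / L)" for s
      by (simp add: c_def algebra_simps)
    then have "(\<Sum>s\<in>S. c g s t * c g s t) = (\<Sum>s\<in>S. if s = g t then 1 - 2 / L else 0) + L * (1 / L * (1 / L))"
      by (simp add: sum.distrib L_def)
    also have "(\<Sum>s\<in>S. if s = g t then 1 - 2 / L else 0) = 1 - 2 / L" using S gt by simp
    finally show ?thesis using L by simp
  qed
  have bd: "0 \<le> b t t" "b t t \<le> rtr (\<rho> t)" if "t < k" for t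
    unfolding b_def N_def using weighted_collision_le[OF G \<kappa> \<rho>[OF that] dom[OF that]] by auto
  have total: "(\<Sum>g\<in>H. \<Sum>s\<in>S. q g s) \<le> real (card H) * (\<Sum>t<k. rtr (\<rho> t))"
  proof -
    have "(\<Sum>g\<in>H. \<Sum>s\<in>S. q g s) = (\<Sum>g\<in>H. \<Sum>s\<in>S. \<Sum>t<k. \<Sum>t'<k. c g s t * c g s t' * b t t')"
      by (simp add: qe)
    also have "\<dots> = (\<Sum>g\<in>H. \<Sum>t<k. \<Sum>s\<in>S. \<Sum>t'<k. c g s t * c g s t' * b t t')"
      by (intro sum.cong refl sum.swap)
    also have "\<dots> = (\<Sum>t<k. \<Sum>g\<in>H. \<Sum>s\<in>S. \<Sum>t'<k. c g s t * c g s t' * b t t')" by (rule sum.swap)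
    also have "\<dots> = (\<Sum>t<k. \<Sum>g\<in>H. \<Sum>t'<k. \<Sum>s\<in>S. c g s t * c g s t' * b t t')"
      by (intro sum.cong refl sum.swap)
    also have "\<dots> = (\<Sum>t<k. \<Sum>t'<k. \<Sum>g\<in>H. \<Sum>s\<in>S. c g s t * c g s t' * b t t')"
      by (intro sum.cong refl sum.swap)
    also have "\<dots> = (\<Sum>t<k. \<Sum>t'<k. (\<Sum>g\<in>H. \<Sum>s\<in>S. c g s t * c g s t') * b t t')"
      by (simp add: sum_distrib_right)
    also have "\<dots> = (\<Sum>t<k. \<Sum>t'<k. if t' = t then (\<Sum>g\<in>H. \<Sum>s\<in>S. c g s t * c g s t) * b t t else 0)"
      using off by (intro sum.cong refl) auto
    also have "\<dots> = (\<Sum>t<k. (\<Sum>g\<in>H. \<Sum>s\<in>S. c g s t * c g s t) * b t t)" by simp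
    also have "\<dots> \<le> (\<Sum>t<k. real (card H) * rtr (\<rho> t))"
    proof (intro sum_mono mult_mono)
      fix t assume "t \<in> {..<k}"
      then have t: "t < k" by simp
      have "(\<Sum>g\<in>H. \<Sum>s\<in>S. c g s t * c g s t) \<le> (\<Sum>g\<in>H. 1)" using dia t by (intro sum_mono) auto
      then show "(\<Sum>g\<in>H. \<Sum>s\<in>S. c g s t * c g s t) \<le> real (card H)" by simp
    qed (use bd in auto)
    finally show ?thesis by (simp add: sum_distrib_left)
  qed
  let ?I = "H \<times> S"
  have "(\<Sum>g\<in>H. \<Sum>s\<in>S. tnorm (mix d (c g s) \<rho> k)) \<le> (\<Sum>g\<in>H. \<Sum>s\<in>S. sqrt (rtr G * q g s))"
    by (intro sum_mono tn)
  also have "\<dots> = (\<Sum>p\<in>?I. 1 * sqrt (rtr G * q (fst p) (snd p)))" by (simp add: sum.cartesian_product case_prod_unfold)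
  \<comment> \<open>Cauchy-Schwarz over all pairs of a map and a bin; the first factor counts the L
    bins of each map.\<close>
  also have "\<dots> \<le> sqrt ((\<Sum>p\<in>?I. 1\<^sup>2) * (\<Sum>p\<in>?I. (sqrt (rtr G * q (fst p) (snd p)))\<^sup>2))"
    by (rule real_le_rsqrt) (rule Cauchy_Schwarz_ineq_sum)
  also have "\<dots> = sqrt (real (card H) * L * (rtr G * (\<Sum>g\<in>H. \<Sum>s\<in>S. q g s)))"
    using gq by (simp add: L_def card_cartesian_product sum.cartesian_product case_prod_unfold sum_distrib_left)
  also have "\<dots> \<le> sqrt (real (card H) * L * (rtr G * (real (card H) * (\<Sum>t<k. rtr (\<rho> t)))))"
    using total L psd_rtr_nonneg[OF G] by (intro real_sqrt_le_mono mult_left_mono) auto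
  also have "\<dots> = sqrt ((real (card H))\<^sup>2 * (L * rtr G * (\<Sum>t<k. rtr (\<rho> t))))"
    by (simp add: power2_eq_square mult_ac)
  also have "\<dots> = real (card H) * sqrt (L * rtr G * (\<Sum>t<k. rtr (\<rho> t)))" by (simp add: real_sqrt_mult)
  finally show ?thesis unfolding c_def .
qed

text \<open>\<open>X\<close> is the unnormalized eavesdropper state of a bin of probability
  \<open>rtr X\<close>, and q Z is its ideal form. Messages are uniform whereas bins have
  probability \<open>rtr X\<close>, so the weight q is exchanged for \<open>rtr X\<close> at the
  price of the positive part of q - \<open>rtr X\<close>. The latter is at most half of the trace
  norm plus half of q - \<open>rtr X\<close>, and this last difference cancels in the sum over all
  bins.\<close>

lemma bin_value_le:
  assumes X: "psd d X" and Z: "dens d Z" and q: "0 < q" and x: "0 \<le> x" "x \<le> 1" and w: "0 \<le> w"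
  shows "q * (if rtr X = 0 then 1 + w else x + w * (tnorm (complex_of_real (1 / rtr X) \<cdot>\<^sub>m X - Z) / 2))
    \<le> rtr X * x + (tnorm (X - complex_of_real q \<cdot>\<^sub>m Z) + (q - rtr X)) / 2 + w * tnorm (X - complex_of_real q \<cdot>\<^sub>m Z)"
proof -
  define D where "D = X - complex_of_real q \<cdot>\<^sub>m Z"
  have c: "X \<in> carrier_mat d d" "Z \<in> carrier_mat d d" "D \<in> carrier_mat d d" using X densD(3)[OF Z] by (auto simp: D_def)
  have rD: "rtr D = rtr X - q" unfolding D_def using c densD(2)[OF Z] by (simp add: rtr_minus[of _ d] rtr_smult[of _ d])
  have tD: "\<bar>rtr X - q\<bar> \<le> tnorm D" using tnorm_abs_rtr_le[OF c(3)] rD by simp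
  have p0: "0 \<le> rtr X" by (rule psd_rtr_nonneg[OF X])
  show ?thesis
  proof (cases "rtr X = 0")
    case True
    then have "q \<le> tnorm D" using tD q by simp
    moreover have "w * q \<le> w * tnorm D" using \<open>q \<le> tnorm D\<close> w by (intro mult_left_mono)
    ultimately have "q + w * q \<le> (tnorm D + q) / 2 + w * tnorm D" by (intro add_mono) auto
    then have "q * (1 + w) \<le> (tnorm D + q) / 2 + w * tnorm D" by (simp add: distrib_left mult.commute[of w q])
    then show ?thesis using True unfolding D_def[symmetric] by simp
  next
    case False
    define p where "p = rtr X"
    have p: "0 < p" using False p0 by (simp add: p_def)
    have 1: "q * x \<le> p * x + (tnorm D + (q - p)) / 2"
    proof -
      have "(q - p) * x \<le> (tnorm D + (q - p)) / 2"
      proof (cases "q \<le> p")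
        case True
        then have "(q - p) * x \<le> 0" using x by (intro mult_nonpos_nonneg) auto
        moreover have "0 \<le> tnorm D + (q - p)" using tD by (simp add: p_def)
        ultimately show ?thesis by simp
      next
        case False
        then have "(q - p) * x \<le> (q - p) * 1" using x by (intro mult_left_mono) auto
        moreover have "q - p \<le> tnorm D" using tD by (simp add: p_def)
        ultimately show ?thesis by simp
      qed
      moreover have "q * x = p * x + (q - p) * x" by (simp add: algebra_simps)
      ultimately show ?thesis by linarith
    qed
    define A where "A = complex_of_real (1 / p) \<cdot>\<^sub>m X - Z"
    have hA: "herm d A" unfolding A_def using X densD(1)[OF Z] p by (intro herm_diff psd_herm psd_smult) auto
    obtain T where T: "eff d T" and eq: "tnorm A = 2 * rtr (T * A) - rtr A" using tnorm_herm_attained[OF hA] by blast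
    have Tc: "T \<in> carrier_mat d d" using T by simp
    have rA: "rtr A = 0" unfolding A_def using c p densD(2)[OF Z] rtr_smult[OF c(1), of "1 / p"]
      by (simp add: rtr_minus[of _ d] p_def)
    define \<tau> where "\<tau> = rtr (T * X) / p"
    have tau: "0 \<le> \<tau>" "\<tau> \<le> 1" using eff_rtr_bounds[OF T X] p by (auto simp: \<tau>_def p_def[symmetric])
    have TA: "rtr (T * A) = \<tau> - rtr (T * Z)" unfolding A_def \<tau>_def using c Tc
      by (simp add: mult_minus_square[of _ d] rtr_minus[of _ d] mult_smult_distrib[of _ d d _ d] rtr_smult[of _ d, of _ "1 / p", simplified])
    have TD: "rtr (T * D) = p * \<tau> - q * rtr (T * Z)" unfolding D_def \<tau>_def using c Tc p
      by (simp add: mult_minus_square[of _ d] rtr_minus[of _ d] mult_smult_distrib[of _ d d _ d] rtr_smult[of _ d])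
    have "2 * rtr (T * D) - rtr D \<le> tnorm D" by (rule tnorm_eff_ge[OF c(3) T])
    then have b1: "2 * (p * \<tau> - q * rtr (T * Z)) - (p - q) \<le> tnorm D" unfolding TD rD p_def .
    have b2: "(q - p) * (2 * \<tau> - 1) \<le> tnorm D"
    proof -
      have "(q - p) * (2 * \<tau> - 1) \<le> \<bar>q - p\<bar> * \<bar>2 * \<tau> - 1\<bar>" by (metis abs_ge_self abs_mult)
      also have "\<dots> \<le> \<bar>q - p\<bar> * 1" using tau by (intro mult_left_mono) (auto simp: abs_le_iff)
      also have "\<dots> \<le> tnorm D" using tD by (simp add: p_def abs_minus_commute)
      finally show ?thesis .
    qed
    \<comment> \<open>Normalizing X shifts the value of T by a multiple of q - p, which costs a
      second trace norm of D. The resulting factor 2 is absorbed by the 1/2 of the trace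
      distance.\<close>
    have "q * tnorm A = 2 * (p * \<tau> - q * rtr (T * Z)) - (p - q) + (q - p) * (2 * \<tau> - 1)"
      unfolding eq rA TA by (simp add: algebra_simps)
    then have "q * tnorm A \<le> 2 * tnorm D" using b1 b2 by simp
    then have "w * (q * tnorm A) \<le> w * (2 * tnorm D)" using w by (intro mult_left_mono)
    then have 2: "q * (w * (tnorm A / 2)) \<le> w * tnorm D" by (simp add: mult_ac)
    have "q * (x + w * (tnorm A / 2)) \<le> p * x + (tnorm D + (q - p)) / 2 + w * tnorm D"
      using 1 2 by (simp add: distrib_left)
    then show ?thesis using False unfolding D_def A_def p_def by simp
  qed
qed

section \<open>Random binning\<close>

lemma exists_le_average:
  fixes F :: "'a \<Rightarrow> real"
  assumes "finite H" "H \<noteq> {}" "(\<Sum>g\<in>H. F g) \<le> real (card H) * b"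
  shows "\<exists>g\<in>H. F g \<le> b"
proof (rule ccontr)
  assume "\<not> ?thesis"
  then have "(\<Sum>g\<in>H. b) < (\<Sum>g\<in>H. F g)" using assms by (intro sum_strict_mono) auto
  then show False using assms(3) by simp
qed

text \<open>The badness of a bin when used as a message: its conditional decoding error plus
  \<open>w\<close> times the distance of the eavesdropper's conditional state from the average
  state. A bin of probability zero gets the worst value 1 + w, so any threshold below that excludes
  it.\<close>

definition bin_val :: "nat \<Rightarrow> nat \<Rightarrow> (nat \<Rightarrow> real) \<Rightarrow> (nat \<Rightarrow> complex mat) \<Rightarrow> (nat \<Rightarrow> complex mat)
    \<Rightarrow> (nat \<Rightarrow> complex mat) \<Rightarrow> real \<Rightarrow> nat set \<Rightarrow> real" where
  "bin_val k dZ P \<eta> \<zeta> \<Lambda> w B =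
    (if (\<Sum>t\<in>B. P t) = 0 then 1 + w
     else (\<Sum>t\<in>B. P t * (1 - rtr (\<Lambda> t * \<eta> t))) / (\<Sum>t\<in>B. P t)
       + w * (tnorm (mix dZ (\<lambda>t. if t \<in> B then P t / (\<Sum>t\<in>B. P t) else 0) \<zeta> k - mix dZ P \<zeta> k) / 2))"

text \<open>A wrong symbol competes with the true one only if both have the same syndrome; this
  lemma makes that event as rare as one map in C.\<close>

lemma collision_count:
  fixes k s t C K :: nat
  assumes k: "s < k" "t < k" "s \<noteq> t" and C: "0 < C" and K: "0 < K"
  defines "H \<equiv> PiE {..<k} (\<lambda>_. {..<C} \<times> {..<K})"
  shows "(\<Sum>g\<in>H. if fst (g s) = fst (g t) then 1 else 0) = real (card H) / real C"
proof -
  let ?S = "{..<C} \<times> {..<K}"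
  let ?u = "\<lambda>c p. if fst p = c then 1 else 0 :: real"
  have us: "sum (?u c) ?S = real K" if "c < C" for c
  proof -
    have "sum (?u c) ?S = (\<Sum>x<C. \<Sum>y<K. if x = c then 1 else 0)"
      unfolding sum.cartesian_product by (simp add: case_prod_unfold)
    also have "\<dots> = (\<Sum>x<C. if x = c then real K else 0)" by (intro sum.cong) auto
    finally show ?thesis using that by simp
  qed
  have "(\<Sum>g\<in>H. if fst (g s) = fst (g t) then 1 else 0) = (\<Sum>g\<in>H. \<Sum>c<C. ?u c (g s) * ?u c (g t))"
  proof (intro sum.cong refl)
    fix g assume "g \<in> H"
    then have "g s \<in> ?S" unfolding H_def using k by auto
    then have lt: "fst (g s) < C" by auto
    have "(\<Sum>c<C. ?u c (g s) * ?u c (g t)) = (\<Sum>c<C. if c = fst (g s) then (if fst (g s) = fst (g t) then 1 else 0) else 0)"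
      by (intro sum.cong) auto
    also have "\<dots> = (if fst (g s) = fst (g t) then 1 else 0)" using lt by (simp only: sum.delta finite_lessThan lessThan_iff if_True)
    finally show "(if fst (g s) = fst (g t) then 1 else 0) = (\<Sum>c<C. ?u c (g s) * ?u c (g t))" by simp
  qed
  also have "\<dots> = (\<Sum>c<C. \<Sum>g\<in>H. ?u c (g s) * ?u c (g t))" by (rule sum.swap)
  also have "\<dots> = (\<Sum>c<C. real (card ?S) ^ (k - 2) * (real K * real K))"
  proof (intro sum.cong refl)
    fix c assume "c \<in> {..<C}"
    then show "(\<Sum>g\<in>H. ?u c (g s) * ?u c (g t)) = real (card ?S) ^ (k - 2) * (real K * real K)"
      unfolding H_def using sum_PiE_pair[of ?S s k t "?u c" "?u c"] k us[of c] by simp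
  qed
  also have "\<dots> = real C * (real (card ?S) ^ (k - 2) * (real K * real K))" by simp
  also have "\<dots> = real (card H) / real C"
  proof -
    have k2: "k = (k - 2) + 2" using k by auto
    have "card H = card ?S ^ k" unfolding H_def by (simp add: card_PiE)
    then have "real (card H) = real (card ?S) ^ (k - 2) * (real C * real K * (real C * real K))"
      by (subst (asm) k2) (simp add: power_add power2_eq_square card_cartesian_product)
    then show ?thesis using C by simp
  qed
  finally show ?thesis .
qed

text \<open>A random map \<open>g\<close> sends each symbol to a pair (syndrome, message). The receiver, told the syndrome,
  recovers the symbol; the pair itself is nearly uniform and independent of the eavesdropper's system.
  Both properties survive when the syndrome is fixed to a suitable constant.\<close>
lemma binning:
  fixes N :: nat
  assumes P: "pdistr k P" and \<eta>: "\<And>t. t < k \<Longrightarrow> dens dY (\<eta> t)" and \<zeta>: "\<And>t. t < k \<Longrightarrow> dens dZ (\<zeta> t)"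
    and dY: "0 < dY" and dZ: "0 < dZ" and eps: "0 < eps" "eps \<le> 1"
    and Z: "subdens (k * dZ) \<rho>Z" "pdist (cq_state k dZ P \<zeta>) \<rho>Z \<le> eps / 8"
    and l: "dens dZ \<sigma>" "psd (k * dZ) (complex_of_real l \<cdot>\<^sub>m kron (1\<^sub>m k) \<sigma> - \<rho>Z)" "0 < l"
    and Y: "subdens (k * dY) \<rho>Y" "pdist (cq_state k dY P \<eta>) \<rho>Y \<le> eps / 8"
    and f: "\<And>\<tau>. dens dY \<tau> \<Longrightarrow> fid \<rho>Y (kron (1\<^sub>m k) \<tau>) \<le> f" "0 < f"
    and N: "1 \<le> N" "real N * (l * f\<^sup>2) \<le> eps ^ 4 / 2 ^ 15"
    and w: "0 \<le> w"
  shows "\<exists>B \<Lambda>. (\<forall>m. B m \<subseteq> {..<k}) \<and> (\<forall>m n. m \<noteq> n \<longrightarrow> B m \<inter> B n = {}) \<and> (\<forall>t<k. psd dY (\<Lambda> t)) \<and>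
    (\<forall>m. \<forall>t\<in>B m. rtr (\<Lambda> t * \<eta> t) \<le> 1) \<and>
    psd dY (1\<^sub>m dY - mix dY (\<lambda>t. if \<exists>m<8 * N. t \<in> B m then 1 else 0) \<Lambda> k) \<and>
    (\<Sum>m<8 * N. bin_val k dZ P \<eta> \<zeta> \<Lambda> w (B m)) \<le> (7 / 8 + 2 * w) * eps * real (8 * N)"
proof -
  \<comment> \<open>With these values 3/2 (\<delta> + eps/8) + 9/2 \<kappa> and the collision term
    9/2 * 7/288 eps add up to exactly 13/32 eps in \<open>asum\<close>.\<close>
  define \<delta> where "\<delta> = 9 * eps / 128"
  define \<kappa> where "\<kappa> = eps / 1152"
  have pos: "0 < \<delta>" "0 < \<kappa>" using eps by (auto simp: \<delta>_def \<kappa>_def)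
  have Pn: "0 \<le> P t" if "t < k" for t using P that by (simp add: pdistr_def)
  have P1: "(\<Sum>t<k. P t) = 1" using P by (simp add: pdistr_def)
  define Ym where "Ym = mix dY P \<eta> k"
  define Zm where "Zm = mix dZ P \<zeta> k"
  have Ymd: "dens dY Ym" unfolding Ym_def using P \<eta> by (rule mix_dens)
  have Zmd: "dens dZ Zm" unfolding Zm_def using P \<zeta> by (rule mix_dens)
  have ec: "\<eta> t \<in> carrier_mat dY dY" "psd dY (\<eta> t)" "rtr (\<eta> t) = 1" if "t < k" for t using densD[OF \<eta>[OF that]] by auto
  have zc: "\<zeta> t \<in> carrier_mat dZ dZ" "psd dZ (\<zeta> t)" "rtr (\<zeta> t) = 1" if "t < k" for t using densD[OF \<zeta>[OF that]] by auto
  obtain T where T: "\<And>t. t < k \<Longrightarrow> eff dY (T t)"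
    and T1: "(\<Sum>t<k. P t * (1 - rtr (T t * \<eta> t))) \<le> \<delta> + eps / 8"
    and T2: "(\<Sum>t<k. rtr (T t * Ym)) \<le> f\<^sup>2 / \<delta>"
    using decoding_test[OF P \<eta> dY Y _ f(1)[OF Ymd[unfolded Ym_def]] f(2) pos(1)] eps unfolding Ym_def by auto
  define b where "b s t = rtr (T s * \<eta> t)" for s t
  have b0: "0 \<le> b s t" if "s < k" "t < k" for s t unfolding b_def by (rule eff_rtr_bounds(1)[OF T[OF that(1)] ec(2)[OF that(2)]])
  have bY: "rtr (T s * Ym) = (\<Sum>t<k. P t * b s t)" if "s < k" for s
    unfolding Ym_def b_def using eff_carrier[OF T[OF that]] ec by (intro rtr_mult_mix) auto
  have bsum: "(\<Sum>s<k. \<Sum>t<k. P t * b s t) \<le> f\<^sup>2 / \<delta>" using T2 bY by simp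
  \<comment> \<open>The tests accept the true symbol with probability at least 3/4, which forces f^2
    to be of order eps at least. This keeps the ideal number \<open>y\<close> of syndromes above 30,
    so that rounding it up to \<open>C\<close> costs at most a factor 31/30.\<close>
  have f2: "27 / 512 * eps \<le> f\<^sup>2"
  proof -
    have "1 - (\<delta> + eps / 8) \<le> (\<Sum>t<k. P t) - (\<Sum>t<k. P t * (1 - b t t))" using T1 P1 by (simp add: b_def)
    also have "\<dots> = (\<Sum>t<k. P t * b t t)" by (simp add: sum_subtractf[symmetric] algebra_simps)
    also have "\<dots> \<le> (\<Sum>s<k. \<Sum>t<k. P t * b s t)"
    proof (rule sum_mono)
      fix s assume s: "s \<in> {..<k}"
      show "P s * b s s \<le> (\<Sum>t<k. P t * b s t)"
        using s Pn b0 by (intro member_le_sum) auto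
    qed
    finally have "1 - (\<delta> + eps / 8) \<le> f\<^sup>2 / \<delta>" using bsum by linarith
    moreover have "3 / 4 \<le> 1 - (\<delta> + eps / 8)" using eps by (simp add: \<delta>_def)
    ultimately have "3 / 4 \<le> f\<^sup>2 / \<delta>" by linarith
    then show ?thesis using pos(1) by (simp add: \<delta>_def field_simps)
  qed
  \<comment> \<open>Chosen so that f^2 / \<delta> = 7/288 eps y: with at least y syndromes the mean
    collision term is at most 7/288 eps.\<close>
  define y where "y = 4096 / 7 * f\<^sup>2 / eps\<^sup>2"
  define C where "C = nat \<lceil>y\<rceil>"
  \<comment> \<open>Eight times as many bins as messages, since expurgation keeps one bin in
    eight.\<close>
  define K where "K = 8 * N"
  have y30: "30 \<le> y"
  proof -
    have "30 * eps\<^sup>2 \<le> 30 * eps" using eps by (simp add: power2_eq_square mult_left_le)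
    also have "\<dots> \<le> 4096 / 7 * f\<^sup>2" using f2 eps by linarith
    finally show ?thesis unfolding y_def using eps by (simp add: field_simps)
  qed
  have Cy: "y \<le> real C" "real C \<le> 31 / 30 * y"
  proof -
    have "y \<le> of_int \<lceil>y\<rceil>" "of_int \<lceil>y\<rceil> < y + 1" "0 \<le> \<lceil>y\<rceil>" using y30 by linarith+
    then show "y \<le> real C" "real C \<le> 31 / 30 * y" unfolding C_def using y30 by auto
  qed
  have C0: "0 < C" using Cy(1) y30 by (cases C) auto
  have K0: "0 < K" using N by (simp add: K_def)
  define S where "S = {..<C} \<times> {..<K}"
  define L where "L = real (card S)"
  have LCK: "L = real C * real K" by (simp add: L_def S_def card_cartesian_product)
  have Sf: "finite S" "S \<noteq> {}" using C0 K0 by (auto simp: S_def lessThan_empty_iff)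
  have L0: "0 < L" using C0 K0 by (simp add: LCK)
  define H where "H = PiE {..<k} (\<lambda>_. S)"
  have Hf: "finite H" unfolding H_def using Sf by (intro finite_PiE) auto
  have Hne: "H \<noteq> {}" unfolding H_def using Sf by (simp add: PiE_eq_empty_iff)

  define \<rho> where "\<rho> t = blk dZ t \<rho>Z" for t
  have rp: "psd (k * dZ) \<rho>Z" "\<rho>Z \<in> carrier_mat (k * dZ) (k * dZ)" "rtr \<rho>Z \<le> 1"
    using Z(1) by (auto simp: subdens_def rtr_def)
  have \<rho>p: "psd dZ (\<rho> t)" if "t < k" for t unfolding \<rho>_def by (rule psd_blk[OF rp(1) that])
  have \<rho>1: "(\<Sum>t<k. rtr (\<rho> t)) \<le> 1"
  proof -
    have "(\<Sum>t<k. rtr (\<rho> t)) = rtr \<rho>Z" unfolding \<rho>_def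
      using rp(2) by (simp add: rtr_def mtrace_eq[of _ "k * dZ" "k * dZ"] sum_blocks) (simp add: mtrace_eq[of _ dZ dZ] submat_def mtrace_def)
    then show ?thesis using rp(3) by simp
  qed
  \<comment> \<open>A multiple of the identity with total trace l / 4 makes \<open>G\<close>
    invertible, while its trace only grows to 5/4 l.\<close>
  define \<mu> where "\<mu> = l / (4 * real dZ)"
  have \<mu>: "0 < \<mu>" using l dZ by (simp add: \<mu>_def)
  have sc: "\<sigma> \<in> carrier_mat dZ dZ" "psd dZ \<sigma>" "rtr \<sigma> = 1" using densD[OF l(1)] by auto
  define G where "G = complex_of_real l \<cdot>\<^sub>m \<sigma> + complex_of_real \<mu> \<cdot>\<^sub>m 1\<^sub>m dZ"
  have Kp: "psd dZ (complex_of_real \<mu> \<cdot>\<^sub>m 1\<^sub>m dZ)" using \<mu> by (intro psd_smult) auto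
  have lp: "psd dZ (complex_of_real l \<cdot>\<^sub>m \<sigma>)" using sc l by (intro psd_smult) auto
  have G: "psd dZ G" unfolding G_def by (rule psd_add[OF lp Kp])
  have G\<mu>: "psd dZ (G - complex_of_real \<mu> \<cdot>\<^sub>m 1\<^sub>m dZ)"
  proof -
    have "G - complex_of_real \<mu> \<cdot>\<^sub>m 1\<^sub>m dZ = complex_of_real l \<cdot>\<^sub>m \<sigma>"
      unfolding G_def using carrier_matD[OF sc(1)] by (intro eq_matI) auto
    then show ?thesis using lp by simp
  qed
  have rG: "rtr G = 5 / 4 * l" unfolding G_def
    using sc dZ rtr_smult[OF one_carrier_mat, of \<mu> dZ] rtr_smult[OF sc(1), of l] by (simp add: rtr_add[of _ dZ] \<mu>_def del: of_real_divide)
  have dom: "psd dZ (G - \<rho> t)" if "t < k" for t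
  proof -
    have "blk dZ t (complex_of_real l \<cdot>\<^sub>m kron (1\<^sub>m k) \<sigma> - \<rho>Z) = complex_of_real l \<cdot>\<^sub>m \<sigma> - \<rho> t"
      unfolding \<rho>_def kron_one_eq_bdiag[OF sc(1) dZ] using that rp(2) sc(1)
      by (intro eq_matI) (auto simp: submat_def block_index_less bdiag_index carrier_matD[OF bdiag_carrier])
    then have "psd dZ (complex_of_real l \<cdot>\<^sub>m \<sigma> - \<rho> t)" using psd_blk[OF l(2) that] by simp
    from psd_add[OF this Kp] have "psd dZ ((complex_of_real l \<cdot>\<^sub>m \<sigma> - \<rho> t) + complex_of_real \<mu> \<cdot>\<^sub>m 1\<^sub>m dZ)" .
    moreover have "(complex_of_real l \<cdot>\<^sub>m \<sigma> - \<rho> t) + complex_of_real \<mu> \<cdot>\<^sub>m 1\<^sub>m dZ = G - \<rho> t"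
      unfolding G_def using sc psd_carrier[OF \<rho>p[OF that]] by (intro eq_matI) auto
    ultimately show ?thesis by simp
  qed
  define c where "c g s t = (if g t = s then 1 else 0) - 1 / L" for g :: "nat \<Rightarrow> nat \<times> nat" and s t
  define D where "D g = (\<Sum>s\<in>S. tnorm (mix dZ (c g s) \<rho> k))" for g
  have Dsum: "(\<Sum>g\<in>H. D g) \<le> real (card H) * (7 / 16 * eps)"
  proof -
    have "(\<Sum>g\<in>H. D g) \<le> real (card H) * sqrt (L * rtr G * (\<Sum>t<k. rtr (\<rho> t)))"
      unfolding D_def c_def H_def L_def using \<rho>p G \<mu> G\<mu> dom Sf by (intro leftover_hash)
    also have "\<dots> \<le> real (card H) * (7 / 16 * eps)"
    proof (intro mult_left_mono)
      have "L * rtr G * (\<Sum>t<k. rtr (\<rho> t)) \<le> L * rtr G * 1"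
        using \<rho>1 L0 rG l by (intro mult_left_mono) auto
      \<comment> \<open>The trade-off between syndromes and messages: L tr G = 8 C N * 5/4 l, and C
        is of order f^2 / eps^2, so the bound on N l f^2 leaves a quantity of order eps^2.\<close>
      also have "\<dots> = 10 * real C * (real N * l)" by (simp add: LCK rG K_def)
      also have "\<dots> \<le> 10 * (31 / 30 * y) * (real N * l)"
        using Cy(2) l by (intro mult_right_mono) auto
      also have "\<dots> = 10 * 31 / 30 * 4096 / 7 / eps\<^sup>2 * (real N * (l * f\<^sup>2))" by (simp add: y_def)
      also have "\<dots> \<le> 10 * 31 / 30 * 4096 / 7 / eps\<^sup>2 * (eps ^ 4 / 2 ^ 15)"
        using N(2) by (intro mult_left_mono) auto
      also have "\<dots> = 31 / 168 * eps\<^sup>2" using eps by (simp add: field_simps power2_eq_square power4_eq_xxxx)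
      also have "\<dots> \<le> (7 / 16 * eps)\<^sup>2" by (simp add: power2_eq_square)
      finally show "sqrt (L * rtr G * (\<Sum>t<k. rtr (\<rho> t))) \<le> 7 / 16 * eps"
        using eps by (intro real_le_lsqrt) auto
    qed simp
    finally show ?thesis .
  qed
  define I where "I g s t = (if fst (g s) = fst (g t) then 1 else 0 :: real)" for g :: "nat \<Rightarrow> nat \<times> nat" and s t :: nat
  \<comment> \<open>The Hayashi-Nagaoka bound on the error of symbol t under the map g: among the
    other symbols only those with the syndrome of t interfere.\<close>
  define ae where "ae g t = 3 / 2 * (1 - b t t) + 9 / 2 * ((\<Sum>s<k. (if s = t then 0 else I g s t) * b s t) + \<kappa>)" for g t
  define a where "a g = (\<Sum>t<k. P t * ae g t)" for g
  have asum: "(\<Sum>g\<in>H. a g) \<le> real (card H) * (13 / 32 * eps)"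
  proof -
    define q where "q = real (card H) / real C"
    have q0: "0 \<le> q" by (simp add: q_def)
    have "(\<Sum>g\<in>H. ae g t) \<le> real (card H) * (3 / 2 * (1 - b t t) + 9 / 2 * \<kappa>) + 9 / 2 * (q * (\<Sum>s<k. b s t))"
      if t: "t < k" for t
    proof -
      have "(\<Sum>g\<in>H. \<Sum>s<k. (if s = t then 0 else I g s t) * b s t) = (\<Sum>s<k. \<Sum>g\<in>H. (if s = t then 0 else I g s t) * b s t)"
        by (rule sum.swap)
      also have "\<dots> \<le> (\<Sum>s<k. q * b s t)"
      proof (rule sum_mono)
        fix s assume "s \<in> {..<k}"
        then have s: "s < k" by simp
        show "(\<Sum>g\<in>H. (if s = t then 0 else I g s t) * b s t) \<le> q * b s t"
        proof (cases "s = t")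
          case True
          then show ?thesis using q0 b0[OF s t] by simp
        next
          case False
          have "(\<Sum>g\<in>H. I g s t) = q"
            unfolding I_def H_def S_def q_def using collision_count[OF s t False C0 K0] by simp
          then show ?thesis using False by (simp add: sum_distrib_right[symmetric])
        qed
      qed
      finally have 1: "(\<Sum>g\<in>H. \<Sum>s<k. (if s = t then 0 else I g s t) * b s t) \<le> q * (\<Sum>s<k. b s t)" by (simp add: sum_distrib_left)
      have "(\<Sum>g\<in>H. ae g t) = real (card H) * (3 / 2 * (1 - b t t) + 9 / 2 * \<kappa>) + 9 / 2 * (\<Sum>g\<in>H. \<Sum>s<k. (if s = t then 0 else I g s t) * b s t)"
      proof -
        define A where "A = 3 / 2 * (1 - b t t) + 9 / 2 * \<kappa>"
        have "ae g t = A + 9 / 2 * (\<Sum>s<k. (if s = t then 0 else I g s t) * b s t)" for g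
          unfolding ae_def A_def by (simp add: distrib_left)
        then show ?thesis unfolding A_def[symmetric] by (simp only: sum.distrib sum_distrib_left[symmetric] sum_constant)
      qed
      then show ?thesis using 1 by linarith
    qed
    then have "(\<Sum>t<k. P t * (\<Sum>g\<in>H. ae g t)) \<le> (\<Sum>t<k. P t * (real (card H) * (3 / 2 * (1 - b t t) + 9 / 2 * \<kappa>) + 9 / 2 * (q * (\<Sum>s<k. b s t))))"
      using Pn by (intro sum_mono mult_left_mono) auto
    also have "\<dots> = real (card H) * (3 / 2 * (\<Sum>t<k. P t * (1 - b t t)) + 9 / 2 * \<kappa>) + 9 / 2 * (q * (\<Sum>s<k. \<Sum>t<k. P t * b s t))"
    proof -
      have sw: "(\<Sum>s<k. \<Sum>t<k. P t * b s t) = (\<Sum>t<k. P t * (\<Sum>s<k. b s t))"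
        by (subst sum.swap) (simp add: sum_distrib_left)
      have "P t * (real (card H) * (3 / 2 * (1 - b t t) + 9 / 2 * \<kappa>) + 9 / 2 * (q * (\<Sum>s<k. b s t))) =
        real (card H) * 3 / 2 * (P t * (1 - b t t)) + real (card H) * 9 / 2 * \<kappa> * P t + 9 / 2 * q * (P t * (\<Sum>s<k. b s t))" for t
        by (simp add: algebra_simps)
      then show ?thesis unfolding sw
        by (simp only: sum.distrib sum_distrib_left[symmetric] P1) (simp add: algebra_simps)
    qed
    also have "\<dots> \<le> real (card H) * (3 / 2 * (\<delta> + eps / 8) + 9 / 2 * \<kappa>) + 9 / 2 * (q * (f\<^sup>2 / \<delta>))"
      using T1 bsum q0 by (intro add_mono mult_left_mono) (auto simp: b_def)
    also have "\<dots> \<le> real (card H) * (13 / 32 * eps)"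
    proof -
      have "f\<^sup>2 / \<delta> \<le> 7 / 288 * eps * real C"
      proof -
        have "f\<^sup>2 / \<delta> = 7 / 288 * eps * y" unfolding y_def \<delta>_def using eps by (simp add: field_simps power2_eq_square)
        then show ?thesis using Cy(1) eps by simp
      qed
      then have "q * (f\<^sup>2 / \<delta>) \<le> q * (7 / 288 * eps * real C)" using q0 by (intro mult_left_mono)
      also have "\<dots> = real (card H) * (7 / 288 * eps)" using C0 by (simp add: q_def)
      finally have "9 / 2 * (q * (f\<^sup>2 / \<delta>)) \<le> 9 / 2 * (real (card H) * (7 / 288 * eps))" by (intro mult_left_mono) auto
      moreover have "real (card H) * (3 / 2 * (\<delta> + eps / 8) + 9 / 2 * \<kappa>) + 9 / 2 * (real (card H) * (7 / 288 * eps))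
        = real (card H) * (13 / 32 * eps)" by (simp add: \<delta>_def \<kappa>_def field_simps)
      ultimately show ?thesis by linarith
    qed
    finally have "(\<Sum>t<k. P t * (\<Sum>g\<in>H. ae g t)) \<le> real (card H) * (13 / 32 * eps)" .
    moreover have "(\<Sum>g\<in>H. a g) = (\<Sum>t<k. P t * (\<Sum>g\<in>H. ae g t))"
      unfolding a_def by (subst sum.swap) (simp add: sum_distrib_left)
    ultimately show ?thesis by simp
  qed
  \<comment> \<open>The sum 13/32 + 7/32 = 5/8. Averaging the combined quantity yields one map that
    serves decoding and hashing at once.\<close>
  have "(\<Sum>g\<in>H. a g + D g / 2) \<le> real (card H) * (5 / 8 * eps)"
    using asum Dsum by (simp add: sum.distrib sum_divide_distrib[symmetric])
  then obtain g where gH: "g \<in> H" and gb: "a g + D g / 2 \<le> 5 / 8 * eps"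
    using exists_le_average[OF Hf Hne] by blast
  have gS: "g t \<in> S" if "t < k" for t using gH that by (auto simp: H_def)
  have ae0: "0 \<le> ae g t" if "t < k" for t
  proof -
    have "b t t \<le> 1" unfolding b_def using eff_rtr_bounds(2)[OF T[OF that] ec(2)[OF that]] ec(3)[OF that] by simp
    moreover have "0 \<le> (\<Sum>s<k. (if s = t then 0 else I g s t) * b s t)"
      using b0 that by (intro sum_nonneg) (auto simp: I_def)
    ultimately show ?thesis unfolding ae_def using pos by (intro add_nonneg_nonneg mult_nonneg_nonneg) auto
  qed
  have a0: "0 \<le> a g" unfolding a_def using ae0 Pn by (intro sum_nonneg mult_nonneg_nonneg) auto

  \<comment> \<open>0/1 weights that select the symbols with syndrome c; each syndrome receives its
    own square-root decoder.\<close>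
  define wc where "wc c t = (if fst (g t) = c then 1 else 0 :: real)" for c t
  define Dec where "Dec c \<Lambda> \<longleftrightarrow> (\<forall>t<k. psd dY (\<Lambda> t)) \<and> psd dY (1\<^sub>m dY - mix dY (wc c) \<Lambda> k) \<and>
    (\<forall>t<k. \<forall>\<rho>. wc c t = 1 \<longrightarrow> dens dY \<rho> \<longrightarrow> 1 - rtr (\<Lambda> t * \<rho>) \<le> 3 / 2 * (1 - rtr (T t * \<rho>))
       + 9 / 2 * ((\<Sum>s<k. (if s = t then 0 else wc c s) * rtr (T s * \<rho>)) + \<kappa>))" for c \<Lambda>
  have "\<forall>c. \<exists>\<Lambda>. Dec c \<Lambda>"
    unfolding Dec_def using T pos by (intro allI square_root_decoder) (auto simp: wc_def)
  then obtain \<Lambda> where Dec: "\<And>c. Dec c (\<Lambda> c)" using choice[of Dec] by blast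
  have Lp: "psd dY (\<Lambda> c t)" if "t < k" for c t using Dec[of c] that unfolding Dec_def by blast
  have Ls: "psd dY (1\<^sub>m dY - mix dY (wc c) (\<Lambda> c) k)" for c using Dec[of c] unfolding Dec_def by blast
  have Le: "1 - rtr (\<Lambda> c t * \<rho>) \<le> 3 / 2 * (1 - rtr (T t * \<rho>))
       + 9 / 2 * ((\<Sum>s<k. (if s = t then 0 else wc c s) * rtr (T s * \<rho>)) + \<kappa>)"
    if "t < k" "wc c t = 1" "dens dY \<rho>" for c t \<rho> using Dec[of c] that unfolding Dec_def by blast
  define E where "E t = 1 - rtr (\<Lambda> (fst (g t)) t * \<eta> t)" for t
  have E01: "0 \<le> E t" "E t \<le> 1" "E t \<le> ae g t" if t: "t < k" for t
  proof -
    let ?c = "fst (g t)"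
    have "psd dY ((1\<^sub>m dY - mix dY (wc ?c) (\<Lambda> ?c) k) + (mix dY (wc ?c) (\<Lambda> ?c) k - \<Lambda> ?c t))"
      using Lp t by (intro psd_add[OF Ls] mix_minus_summand(2)) (auto simp: wc_def)
    also have "(1\<^sub>m dY - mix dY (wc ?c) (\<Lambda> ?c) k) + (mix dY (wc ?c) (\<Lambda> ?c) k - \<Lambda> ?c t) = 1\<^sub>m dY - \<Lambda> ?c t"
      by (intro eq_matI) (simp_all add: mix_index carrier_matD[OF psd_carrier[OF Lp[OF t]]] carrier_matD[OF mix_carrier])
    finally have "eff dY (\<Lambda> ?c t)" unfolding eff_def using Lp[OF t] by blast
    from eff_rtr_bounds[OF this ec(2)[OF t]] show "0 \<le> E t" "E t \<le> 1" using ec(3)[OF t] by (auto simp: E_def)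
    show "E t \<le> ae g t"
      using Le[OF t _ \<eta>[OF t], of ?c] unfolding E_def ae_def b_def I_def wc_def by simp
  qed
  define B where "B s = {t. t < k \<and> g t = s}" for s
  have Bk: "B s \<subseteq> {..<k}" "finite (B s)" for s by (auto simp: B_def)
  have fib: "(\<Sum>s\<in>S. \<Sum>t\<in>B s. h t) = (\<Sum>t<k. h t)" for h :: "nat \<Rightarrow> real"
  proof -
    have "g ` {..<k} \<subseteq> S" using gS by auto
    from sum.group[OF finite_lessThan Sf(1) this, of h] show ?thesis by (simp add: B_def)
  qed
  define p where "p s = (\<Sum>t\<in>B s. P t)" for s
  define X where "X s = mix dZ (\<lambda>t. if t \<in> B s then P t else 0) \<zeta> k" for s
  have Xp: "psd dZ (X s)" for s unfolding X_def using zc Pn by (intro mix_psd) auto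
  have Xr: "rtr (X s) = p s" for s
  proof -
    have "rtr (X s) = (\<Sum>t<k. (if t \<in> B s then P t else 0) * rtr (\<zeta> t))" unfolding X_def using zc by (intro rtr_mix) auto
    also have "\<dots> = (\<Sum>t<k. if t \<in> B s then P t else 0)" using zc by (intro sum.cong) auto
    also have "\<dots> = (\<Sum>t\<in>B s. P t)" using Bk by (simp add: sum.inter_restrict[symmetric] Int_absorb1)
    finally show ?thesis by (simp add: p_def)
  qed
  define tn where "tn s = tnorm (X s - complex_of_real (1 / L) \<cdot>\<^sub>m Zm)" for s
  define e where "e s = (\<Sum>t\<in>B s. P t * E t)" for s
  have val: "1 / L * bin_val k dZ P \<eta> \<zeta> (\<Lambda> (fst s)) w (B s) \<le> e s + (tn s + (1 / L - p s)) / 2 + w * tn s" if "s \<in> S" for s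
  proof -
    have Es: "(\<Sum>t\<in>B s. P t * (1 - rtr (\<Lambda> (fst s) t * \<eta> t))) = e s"
      unfolding e_def E_def by (intro sum.cong) (auto simp: B_def)
    have pB: "0 \<le> P t" "0 \<le> E t" "E t \<le> 1" if "t \<in> B s" for t using that Pn E01 by (auto simp: B_def)
    have p0: "0 \<le> p s" unfolding p_def using pB by (intro sum_nonneg)
    have e01: "0 \<le> e s" "e s \<le> p s" unfolding e_def p_def using pB by (auto intro!: sum_nonneg sum_mono mult_left_le)
    have smul: "mix dZ (\<lambda>t. if t \<in> B s then P t / p s else 0) \<zeta> k = complex_of_real (1 / rtr (X s)) \<cdot>\<^sub>m X s"
      unfolding Xr unfolding X_def by (intro eq_matI) (auto simp: mix_def sum_distrib_left intro!: sum.cong)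
    have "bin_val k dZ P \<eta> \<zeta> (\<Lambda> (fst s)) w (B s) =
      (if rtr (X s) = 0 then 1 + w else e s / p s + w * (tnorm (complex_of_real (1 / rtr (X s)) \<cdot>\<^sub>m X s - Zm) / 2))"
      unfolding bin_val_def p_def[symmetric] Es smul Zm_def[symmetric] by (simp add: Xr)
    moreover have "1 / L * \<dots> \<le> rtr (X s) * (e s / p s) + (tn s + (1 / L - rtr (X s))) / 2 + w * tn s"
      unfolding tn_def using L0 e01 p0 by (intro bin_value_le[OF Xp Zmd _ _ _ w]) (auto simp: divide_le_eq_1)
    moreover have "rtr (X s) * (e s / p s) = e s" unfolding Xr using e01 by (cases "p s = 0") auto
    ultimately show ?thesis by (simp add: Xr)
  qed
  \<comment> \<open>Return from the smoothed blocks to the actual states: a symbol enters all bins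
    with total weight at most 2, and the blocks deviate by eps/4 altogether.\<close>
  have tnsum: "(\<Sum>s\<in>S. tn s) \<le> D g + eps / 2"
  proof -
    define \<Delta> where "\<Delta> t = tnorm (complex_of_real (P t) \<cdot>\<^sub>m \<zeta> t - \<rho> t)" for t
    have \<Delta>0: "0 \<le> \<Delta> t" if "t < k" for t
      unfolding \<Delta>_def using zc[OF that] psd_carrier[OF \<rho>p[OF that]] by (intro tnorm_nonneg[of _ dZ]) auto
    have \<Delta>s: "(\<Sum>t<k. \<Delta> t) \<le> 2 * (eps / 8)"
      unfolding \<Delta>_def \<rho>_def using eps by (intro pinching_distance[OF P \<zeta> dZ Z]) auto
    have "tn s \<le> tnorm (mix dZ (c g s) \<rho> k) + (\<Sum>t<k. \<bar>c g s t\<bar> * \<Delta> t)" for s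
    proof -
      have "X s - complex_of_real (1 / L) \<cdot>\<^sub>m Zm = mix dZ (c g s) (\<lambda>t. complex_of_real (P t) \<cdot>\<^sub>m \<zeta> t) k"
      proof (rule eq_matI)
        fix i j assume "i < dim_row (mix dZ (c g s) (\<lambda>t. complex_of_real (P t) \<cdot>\<^sub>m \<zeta> t) k)" "j < dim_col (mix dZ (c g s) (\<lambda>t. complex_of_real (P t) \<cdot>\<^sub>m \<zeta> t) k)"
        then have ij: "i < dZ" "j < dZ" by (auto simp: mix_def)
        have "(X s - complex_of_real (1 / L) \<cdot>\<^sub>m Zm) $$ (i, j) =
          (\<Sum>t<k. complex_of_real (if t \<in> B s then P t else 0) * \<zeta> t $$ (i, j)) - complex_of_real (1 / L) * (\<Sum>t<k. complex_of_real (P t) * \<zeta> t $$ (i, j))"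
          using ij by (simp add: X_def Zm_def mix_index carrier_matD[OF mix_carrier])
        also have "\<dots> = (\<Sum>t<k. complex_of_real (c g s t) * (complex_of_real (P t) * \<zeta> t $$ (i, j)))"
          unfolding sum_distrib_left sum_subtractf[symmetric]
          by (intro sum.cong refl) (auto simp: c_def B_def algebra_simps)
        also have "\<dots> = mix dZ (c g s) (\<lambda>t. complex_of_real (P t) \<cdot>\<^sub>m \<zeta> t) k $$ (i, j)"
          unfolding mix_index[OF ij]
        proof (intro sum.cong refl)
          fix t assume "t \<in> {..<k}"
          then have "dim_row (\<zeta> t) = dZ" "dim_col (\<zeta> t) = dZ" using carrier_matD[OF zc(1)] by auto
          then show "complex_of_real (c g s t) * (complex_of_real (P t) * \<zeta> t $$ (i, j)) =
            complex_of_real (c g s t) * (complex_of_real (P t) \<cdot>\<^sub>m \<zeta> t) $$ (i, j)" using ij by simp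
        qed
        finally show "(X s - complex_of_real (1 / L) \<cdot>\<^sub>m Zm) $$ (i, j) = \<dots>" .
      qed (auto simp: X_def Zm_def mix_def)
      then show ?thesis unfolding tn_def \<Delta>_def using zc \<rho>p Pn
        by (simp only:) (intro tnorm_mix_perturb psd_herm psd_smult, auto)
    qed
    then have "(\<Sum>s\<in>S. tn s) \<le> (\<Sum>s\<in>S. tnorm (mix dZ (c g s) \<rho> k) + (\<Sum>t<k. \<bar>c g s t\<bar> * \<Delta> t))" by (intro sum_mono)
    also have "\<dots> = D g + (\<Sum>t<k. (\<Sum>s\<in>S. \<bar>c g s t\<bar>) * \<Delta> t)"
      unfolding D_def sum.distrib sum_distrib_right by (subst sum.swap[of _ S]) simp
    also have "\<dots> \<le> D g + (\<Sum>t<k. 2 * \<Delta> t)"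
    proof (intro add_left_mono sum_mono mult_right_mono)
      fix t assume "t \<in> {..<k}"
      then have t: "t < k" by simp
      have "(\<Sum>s\<in>S. \<bar>c g s t\<bar>) \<le> (\<Sum>s\<in>S. (if s = g t then 1 else 0) + 1 / L)"
        using L0 by (intro sum_mono) (auto simp: c_def abs_le_iff)
      also have "\<dots> = 2" using Sf gS[OF t] L0 by (simp add: sum.distrib L_def)
      finally show "(\<Sum>s\<in>S. \<bar>c g s t\<bar>) \<le> 2" .
      show "0 \<le> \<Delta> t" by (rule \<Delta>0[OF t])
    qed
    also have "\<dots> \<le> D g + eps / 2" using \<Delta>s by (simp add: sum_distrib_left[symmetric])
    finally show ?thesis .
  qed
  define v where "v s = bin_val k dZ P \<eta> \<zeta> (\<Lambda> (fst s)) w (B s)" for s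
  have "(\<Sum>s\<in>S. 1 / L * v s) \<le> (\<Sum>s\<in>S. e s + (tn s + (1 / L - p s)) / 2 + w * tn s)"
    unfolding v_def by (rule sum_mono[OF val])
  then have v1: "(\<Sum>s\<in>S. 1 / L * v s) \<le> (\<Sum>s\<in>S. e s) + ((\<Sum>s\<in>S. tn s) + ((\<Sum>s\<in>S. 1 / L) - (\<Sum>s\<in>S. p s))) / 2 + w * (\<Sum>s\<in>S. tn s)"
    by (simp only: sum.distrib sum_subtractf sum_divide_distrib[symmetric] sum_distrib_left[symmetric])
  \<comment> \<open>Uniform weights and bin probabilities both sum to 1, so the terms 1 / L - p s
    left over from \<open>bin_value_le\<close> cancel.\<close>
  have v2: "(\<Sum>s\<in>S. 1 / L) = 1" using L0 by (simp add: L_def)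
  have v3: "(\<Sum>s\<in>S. p s) = 1" unfolding p_def fib by (rule P1)
  have v4: "(\<Sum>s\<in>S. e s) = (\<Sum>t<k. P t * E t)" unfolding e_def by (rule fib)
  have vs: "(\<Sum>s\<in>S. 1 / L * v s) \<le> (\<Sum>t<k. P t * E t) + (\<Sum>s\<in>S. tn s) / 2 + w * (\<Sum>s\<in>S. tn s)"
    using v1 unfolding v2 v3 v4 by simp
  have Ea: "(\<Sum>t<k. P t * E t) \<le> a g" unfolding a_def using E01(3) Pn by (intro sum_mono mult_left_mono) auto
  have Dg: "D g \<le> 5 / 4 * eps" using gb a0 by simp
  have "w * (\<Sum>s\<in>S. tn s) \<le> w * (2 * eps)" using tnsum Dg eps w by (intro mult_left_mono) auto
  \<comment> \<open>7/8 is 5/8 from the choice of g plus 1/4 from smoothing; the secrecy part is at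
    most 5/4 + 1/2 < 2 times w eps.\<close>
  then have "(\<Sum>s\<in>S. 1 / L * v s) \<le> (7 / 8 + 2 * w) * eps"
    using vs Ea tnsum gb by (simp add: distrib_right)
  then have "(\<Sum>s\<in>S. v s) / L \<le> (7 / 8 + 2 * w) * eps" by (simp add: sum_divide_distrib)
  then have "(\<Sum>s\<in>S. v s) \<le> L * ((7 / 8 + 2 * w) * eps)"
    using L0 by (simp only: pos_divide_le_eq mult.commute[of L])
  then have "(\<Sum>c<C. \<Sum>m<K. v (c, m)) \<le> real (card {..<C}) * ((7 / 8 + 2 * w) * eps * real K)"
    unfolding S_def LCK by (simp add: sum.cartesian_product case_prod_unfold mult_ac)
  \<comment> \<open>Some syndrome is no worse than the average. Once it is fixed in advance, it need
    not be sent to the receiver.\<close>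
  then obtain c0 where c0: "c0 < C" "(\<Sum>m<K. v (c0, m)) \<le> (7 / 8 + 2 * w) * eps * real K"
    using exists_le_average[of "{..<C}" "\<lambda>c. \<Sum>m<K. v (c, m)"] C0 by (auto simp: lessThan_empty_iff)
  define B' where "B' m = B (c0, m)" for m
  \<comment> \<open>The K bins of syndrome \<open>c0\<close> together contain exactly the symbols
    with this syndrome, so the decoder built for it covers them and nothing else.\<close>
  have "mix dY (\<lambda>t. if \<exists>m<K. t \<in> B' m then 1 else 0) (\<Lambda> c0) k = mix dY (wc c0) (\<Lambda> c0) k"
  proof -
    have "(\<exists>m<K. t \<in> B' m) \<longleftrightarrow> fst (g t) = c0" if "t < k" for t
      using gS[OF that] that by (cases "g t") (auto simp: B'_def B_def S_def)
    then have "(\<Sum>x<k. complex_of_real (if \<exists>m<K. x \<in> B' m then 1 else 0) * \<Lambda> c0 x $$ ij) = (\<Sum>x<k. complex_of_real (wc c0 x) * \<Lambda> c0 x $$ ij)" for ij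
      by (intro sum.cong refl) (simp add: wc_def)
    then show ?thesis by (simp add: mix_def)
  qed
  then have 1: "psd dY (1\<^sub>m dY - mix dY (\<lambda>t. if \<exists>m<K. t \<in> B' m then 1 else 0) (\<Lambda> c0) k)" using Ls by simp
  have 2: "(\<Sum>m<K. bin_val k dZ P \<eta> \<zeta> (\<Lambda> c0) w (B' m)) \<le> (7 / 8 + 2 * w) * eps * real K"
    using c0(2) by (simp add: v_def B'_def)
  have 3: "\<forall>m. B' m \<subseteq> {..<k}" "\<forall>m n. m \<noteq> n \<longrightarrow> B' m \<inter> B' n = {}" "\<forall>t<k. psd dY (\<Lambda> c0 t)"
    using Lp by (auto simp: B'_def B_def)
  have 4: "\<forall>m. \<forall>t\<in>B' m. rtr (\<Lambda> c0 t * \<eta> t) \<le> 1"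
  proof (intro allI ballI)
    fix m t assume "t \<in> B' m"
    then have "t < k" "fst (g t) = c0" by (auto simp: B'_def B_def)
    then show "rtr (\<Lambda> c0 t * \<eta> t) \<le> 1" using E01(1)[of t] by (simp add: E_def)
  qed
  show ?thesis unfolding K_def[symmetric] using 1 2 3 4 by blast
qed

section \<open>Achievability\<close>

text \<open>Markov's inequality: with a mean of at most 7/8 \<tau>, no more than 7 N of the 8 N
  values can exceed \<tau>.\<close>

lemma select_below_threshold:
  fixes v :: "nat \<Rightarrow> real"
  assumes v: "\<And>m. m < 8 * N \<Longrightarrow> 0 \<le> v m" and \<tau>: "0 < \<tau>" and s: "(\<Sum>m<8 * N. v m) \<le> 7 / 8 * \<tau> * real (8 * N)"
  shows "\<exists>sel. inj_on sel {..<N} \<and> (\<forall>i<N. sel i < 8 * N \<and> v (sel i) \<le> \<tau>)"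
proof -
  define G where "G = {m. m < 8 * N \<and> v m \<le> \<tau>}"
  define Bd where "Bd = {..<8 * N} - G"
  have G: "G \<subseteq> {..<8 * N}" "finite G" by (auto simp: G_def)
  have "real (card Bd) * \<tau> = (\<Sum>m\<in>Bd. \<tau>)" by simp
  also have "\<dots> \<le> (\<Sum>m\<in>Bd. v m)" by (intro sum_mono) (auto simp: Bd_def G_def)
  also have "\<dots> \<le> (\<Sum>m<8 * N. v m)" using v by (intro sum_mono2) (auto simp: Bd_def)
  finally have "real (card Bd) * \<tau> \<le> (7 * real N) * \<tau>" using s by (simp add: mult_ac)
  then have "card Bd \<le> 7 * N" using \<tau> by simp
  moreover have "card Bd = 8 * N - card G" unfolding Bd_def using G by (simp add: card_Diff_subset)
  moreover have "card G \<le> 8 * N" using card_mono[OF _ G(1)] by simp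
  ultimately have "N \<le> card G" by linarith
  then obtain G' where G': "G' \<subseteq> G" "card G' = N" "finite G'" by (rule obtain_subset_with_card_n)
  obtain h where "bij_betw h {0..<card G'} G'" using ex_bij_betw_nat_finite[OF G'(3)] by blast
  then have "bij_betw h {..<N} G'" using G'(2) by (simp add: atLeast0LessThan)
  then show ?thesis using G'(1) unfolding bij_betw_def G_def by (intro exI[of _ h]) auto
qed

text \<open>This derandomizes the public encoder: some symbol of a bin is at least as good as the
  conditional mean.\<close>

lemma weighted_average_witness:
  fixes P x :: "nat \<Rightarrow> real"
  assumes "finite B" "\<And>t. t \<in> B \<Longrightarrow> 0 \<le> P t" "(\<Sum>t\<in>B. P t) \<noteq> 0" "(\<Sum>t\<in>B. P t * x t) / (\<Sum>t\<in>B. P t) \<le> c"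
  shows "\<exists>t\<in>B. x t \<le> c"
proof (rule ccontr)
  assume "\<not> ?thesis"
  then have x: "c < x t" if "t \<in> B" for t using that by auto
  have pos: "0 < (\<Sum>t\<in>B. P t)" using assms(2,3) sum_nonneg[of B P] by force
  have "(\<Sum>t\<in>B. P t * x t) \<le> c * (\<Sum>t\<in>B. P t)" using assms(4) pos by (simp add: pos_divide_le_eq)
  then have "(\<Sum>t\<in>B. P t * (x t - c)) \<le> 0" by (simp add: right_diff_distrib sum_subtractf sum_distrib_left mult.commute)
  moreover have nn: "0 \<le> P t * (x t - c)" if "t \<in> B" for t using assms(2)[OF that] x[OF that] by simp
  ultimately have "(\<Sum>t\<in>B. P t * (x t - c)) = 0" using sum_nonneg[of B "\<lambda>t. P t * (x t - c)"] by simp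
  then have "\<forall>t\<in>B. P t * (x t - c) = 0" using nn by (subst (asm) sum_nonneg_eq_0_iff[OF assms(1)]) auto
  then have "\<forall>t\<in>B. P t = 0" using x by force
  then show False using assms(3) by simp
qed

text \<open>A threshold below 1 + w rules out bins of probability zero; the two contributions are
  nonnegative, so each one inherits the bound.\<close>

lemma bin_val_parts:
  assumes val: "bin_val k dZ P \<eta> \<zeta> \<Lambda> w B \<le> c" "c < 1 + w" and w: "0 \<le> w"
    and B: "B \<subseteq> {..<k}" "\<And>t. t \<in> B \<Longrightarrow> rtr (\<Lambda> t * \<eta> t) \<le> 1" and P: "\<And>t. t < k \<Longrightarrow> 0 \<le> P t"
  shows "(\<Sum>t\<in>B. P t) \<noteq> 0" "(\<Sum>t\<in>B. P t * (1 - rtr (\<Lambda> t * \<eta> t))) / (\<Sum>t\<in>B. P t) \<le> c"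
    "w * (tnorm (mix dZ (\<lambda>t. if t \<in> B then P t / (\<Sum>t\<in>B. P t) else 0) \<zeta> k - mix dZ P \<zeta> k) / 2) \<le> c"
proof -
  show nz: "(\<Sum>t\<in>B. P t) \<noteq> 0" using val unfolding bin_val_def by (auto split: if_splits)
  have P0: "0 \<le> P t" if "t \<in> B" for t using that B P by auto
  have "0 \<le> w * (tnorm (mix dZ (\<lambda>t. if t \<in> B then P t / (\<Sum>t\<in>B. P t) else 0) \<zeta> k - mix dZ P \<zeta> k) / 2)"
    using w tnorm_nonneg[of "mix dZ (\<lambda>t. if t \<in> B then P t / (\<Sum>t\<in>B. P t) else 0) \<zeta> k - mix dZ P \<zeta> k" dZ] by simp
  moreover have "0 \<le> (\<Sum>t\<in>B. P t * (1 - rtr (\<Lambda> t * \<eta> t))) / (\<Sum>t\<in>B. P t)"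
    using P0 B(2) by (intro divide_nonneg_nonneg sum_nonneg mult_nonneg_nonneg) auto
  ultimately show "(\<Sum>t\<in>B. P t * (1 - rtr (\<Lambda> t * \<eta> t))) / (\<Sum>t\<in>B. P t) \<le> c"
    "w * (tnorm (mix dZ (\<lambda>t. if t \<in> B then P t / (\<Sum>t\<in>B. P t) else 0) \<zeta> k - mix dZ P \<zeta> k) / 2) \<le> c"
    using val nz unfolding bin_val_def by auto
qed

lemma bin_val_nonneg:
  assumes w: "0 \<le> w" and B: "B \<subseteq> {..<k}" "\<And>t. t \<in> B \<Longrightarrow> rtr (\<Lambda> t * \<eta> t) \<le> 1" and P: "\<And>t. t < k \<Longrightarrow> 0 \<le> P t"
  shows "0 \<le> bin_val k dZ P \<eta> \<zeta> \<Lambda> w B"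
proof (rule ccontr)
  assume "\<not> ?thesis"
  then have neg: "bin_val k dZ P \<eta> \<zeta> \<Lambda> w B < 0" by simp
  have "(\<Sum>t\<in>B. P t * (1 - rtr (\<Lambda> t * \<eta> t))) / (\<Sum>t\<in>B. P t) \<le> bin_val k dZ P \<eta> \<zeta> \<Lambda> w B"
    by (rule bin_val_parts(2)[OF order.refl _ w B P]) (use neg w in auto)
  moreover have "0 \<le> (\<Sum>t\<in>B. P t * (1 - rtr (\<Lambda> t * \<eta> t))) / (\<Sum>t\<in>B. P t)"
    using P B by (intro divide_nonneg_nonneg sum_nonneg mult_nonneg_nonneg) auto
  ultimately show False using neg by simp
qed

text \<open>The operator of a message is the sum over its bin. Whatever is missing to the identity
  is given to outcome 0, which can only increase its success probability.\<close>

lemma povm_of_bins: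
  assumes \<Lambda>: "\<And>t. t < k \<Longrightarrow> psd d (\<Lambda> t)" and sub: "psd d (1\<^sub>m d - mix d (\<lambda>t. if \<exists>m<M. t \<in> B m then 1 else 0) \<Lambda> k)"
    and B: "\<And>m. B m \<subseteq> {..<k}" "\<And>m n. m \<noteq> n \<Longrightarrow> B m \<inter> B n = {}"
    and sel: "inj_on sel {..<N}" "\<And>i. i < N \<Longrightarrow> sel i < M" and N: "1 \<le> N"
  shows "\<exists>E. povm d N E \<and> (\<forall>i<N. \<forall>t\<in>B (sel i). \<forall>\<rho>. psd d \<rho> \<longrightarrow> rtr (\<Lambda> t * \<rho>) \<le> rtr (E i * \<rho>))"
proof -
  define u where "u t = (if \<exists>m<M. t \<in> B m then 1 else 0 :: real)" for t
  define u' where "u' t = (\<Sum>i<N. if t \<in> B (sel i) then 1 else 0 :: real)" for t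
  have uu: "u' t \<le> u t" for t
  proof (cases "\<exists>i<N. t \<in> B (sel i)")
    case True
    then obtain i where i: "i < N" "t \<in> B (sel i)" by blast
    have "t \<in> B (sel j) \<longleftrightarrow> j = i" if "j < N" for j
      using B(2)[of "sel i" "sel j"] i that sel(1) by (metis IntI empty_iff inj_onD lessThan_iff)
    then have "u' t = (\<Sum>j<N. if j = i then 1 else 0)" unfolding u'_def by (intro sum.cong) auto
    then have "u' t = 1" using i by simp
    moreover have "u t = 1" unfolding u_def using i sel(2) by auto
    ultimately show ?thesis by simp
  next
    case False
    then have "u' t = 0" unfolding u'_def by (intro sum.neutral) auto
    then show ?thesis by (simp add: u_def)
  qed
  have Lc: "\<Lambda> t \<in> carrier_mat d d" if "t < k" for t using \<Lambda>[OF that] by simp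
  define F where "F i = mix d (\<lambda>t. if t \<in> B (sel i) then 1 else 0) \<Lambda> k" for i
  define R where "R = 1\<^sub>m d - mix d u' \<Lambda> k"
  have Fp: "psd d (F i)" for i unfolding F_def using \<Lambda> by (intro mix_psd) auto
  have Rp: "psd d R"
  proof -
    have "psd d ((1\<^sub>m d - mix d u \<Lambda> k) + mix d (\<lambda>t. u t - u' t) \<Lambda> k)"
      using sub \<Lambda> uu unfolding u_def[symmetric] by (intro psd_add mix_psd) auto
    moreover have "(1\<^sub>m d - mix d u \<Lambda> k) + mix d (\<lambda>t. u t - u' t) \<Lambda> k = R"
      unfolding R_def by (intro eq_matI) (auto simp: mix_def left_diff_distrib sum_subtractf)
    ultimately show ?thesis by simp
  qed
  define E where "E i = F i + (if i = 0 then R else 0\<^sub>m d d)" for i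
  have Ep: "psd d (E i)" for i unfolding E_def using Fp Rp by (intro psd_add) auto
  have Ec: "E i \<in> carrier_mat d d" for i using Ep by simp
  have Es: "mix d (\<lambda>_. 1) E N = 1\<^sub>m d"
  proof (rule eq_matI)
    fix a b assume "a < dim_row (1\<^sub>m d :: complex mat)" "b < dim_col (1\<^sub>m d :: complex mat)"
    then have ab: "a < d" "b < d" by auto
    have Rc: "R \<in> carrier_mat d d" using Rp by simp
    have "E i $$ (a, b) = F i $$ (a, b) + (if i = 0 then R $$ (a, b) else 0)" for i
      unfolding E_def using ab Rc carrier_matD[OF Rc] by (cases "i = 0") simp_all
    then have "mix d (\<lambda>_. 1) E N $$ (a, b) = (\<Sum>i<N. F i $$ (a, b)) + (\<Sum>i<N. if i = 0 then R $$ (a, b) else 0)"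
      using ab by (simp add: mix_index sum.distrib)
    also have "(\<Sum>i<N. if i = 0 then R $$ (a, b) else 0) = R $$ (a, b)" using N by simp
    also have "(\<Sum>i<N. F i $$ (a, b)) = mix d u' \<Lambda> k $$ (a, b)"
    proof -
      have "(\<Sum>i<N. F i $$ (a, b)) = (\<Sum>i<N. \<Sum>t<k. complex_of_real (if t \<in> B (sel i) then 1 else 0) * \<Lambda> t $$ (a, b))"
        unfolding F_def using ab by (simp add: mix_index)
      also have "\<dots> = (\<Sum>t<k. \<Sum>i<N. complex_of_real (if t \<in> B (sel i) then 1 else 0) * \<Lambda> t $$ (a, b))" by (rule sum.swap)
      also have "\<dots> = mix d u' \<Lambda> k $$ (a, b)" unfolding mix_index[OF ab] u'_def by (simp add: sum_distrib_right)
      finally show ?thesis .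
    qed
    finally show "mix d (\<lambda>_. 1) E N $$ (a, b) = 1\<^sub>m d $$ (a, b)"
      unfolding R_def using ab by (simp add: carrier_matD[OF mix_carrier])
  qed (auto simp: mix_def)
  have "rtr (\<Lambda> t * \<rho>) \<le> rtr (E i * \<rho>)" if "i < N" "t \<in> B (sel i)" "psd d \<rho>" for i t \<rho>
  proof -
    have t: "t < k" using that B(1) by auto
    have 1: "psd d (F i - \<Lambda> t)" unfolding F_def using \<Lambda> t that by (intro mix_minus_summand(2)) auto
    have "psd d ((F i - \<Lambda> t) + (if i = 0 then R else 0\<^sub>m d d))" using 1 Rp by (intro psd_add) auto
    moreover have "(F i - \<Lambda> t) + (if i = 0 then R else 0\<^sub>m d d) = E i - \<Lambda> t"
      unfolding E_def using carrier_matD[OF Lc[OF t]] carrier_matD[OF psd_carrier[OF Fp[of i]]] carrier_matD[OF psd_carrier[OF Rp]]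
      by (intro eq_matI) auto
    ultimately have "psd d (E i - \<Lambda> t)" by simp
    then show ?thesis using that(3) Ec Lc[OF t] by (intro rtr_mult_mono)
  qed
  then show ?thesis using Ep Es unfolding povm_def by blast
qed

text \<open>A strict bound gives witnesses without any appeal to attained suprema. A feasible l
  below 2^(-a) is raised to exactly 2^(-a), because this adds a positive multiple of identity tensor
  \<sigma>.\<close>

lemma Hmin_s_witness:
  assumes "ereal a < Hmin_s e k d \<rho>" "0 < d"
  shows "\<exists>\<rho>'\<in>sball e (k * d) \<rho>. \<exists>\<sigma>. dens d \<sigma> \<and> psd (k * d) (complex_of_real (2 powr (- a)) \<cdot>\<^sub>m kron (1\<^sub>m k) \<sigma> - \<rho>')"
proof -
  obtain \<rho>' where r: "\<rho>' \<in> sball e (k * d) \<rho>" "ereal a < Hmin k d \<rho>'" using assms(1) unfolding Hmin_s_def less_SUP_iff by blast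
  then obtain \<sigma> where s: "dens d \<sigma>"
    and lt: "ereal a < - elog2 (Inf {ereal l | l. psd (k * d) (complex_of_real l \<cdot>\<^sub>m kron (1\<^sub>m k) \<sigma> - \<rho>')})"
    unfolding Hmin_def less_SUP_iff by blast
  let ?I = "Inf {ereal l | l. psd (k * d) (complex_of_real l \<cdot>\<^sub>m kron (1\<^sub>m k) \<sigma> - \<rho>')}"
  have "?I < ereal (2 powr (- a))"
  proof (rule ccontr)
    assume "\<not> ?thesis"
    then have "elog2 (ereal (2 powr (- a))) \<le> elog2 ?I" by (intro elog2_mono) simp
    then have "- ereal a \<le> elog2 ?I" by (simp add: elog2_ereal)
    then have "- elog2 ?I \<le> ereal a" by (simp only: ereal_uminus_le_reorder)
    then show False using lt by simp
  qed
  then obtain l where l: "psd (k * d) (complex_of_real l \<cdot>\<^sub>m kron (1\<^sub>m k) \<sigma> - \<rho>')" "l < 2 powr (- a)"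
    unfolding Inf_less_iff by auto
  define \<tau> where "\<tau> = kron (1\<^sub>m k) \<sigma>"
  have \<tau>: "psd (k * d) \<tau>" unfolding \<tau>_def kron_one_eq_bdiag[OF densD(3)[OF s] assms(2)] using densD(1)[OF s] by (intro psd_bdiag)
  have rc: "\<rho>' \<in> carrier_mat (k * d) (k * d)" using r(1) by (auto simp: sball_def subdens_def)
  have "psd (k * d) ((complex_of_real l \<cdot>\<^sub>m \<tau> - \<rho>') + complex_of_real (2 powr (- a) - l) \<cdot>\<^sub>m \<tau>)"
    using l \<tau> unfolding \<tau>_def[symmetric] by (intro psd_add psd_smult) auto
  moreover have "(complex_of_real l \<cdot>\<^sub>m \<tau> - \<rho>') + complex_of_real (2 powr (- a) - l) \<cdot>\<^sub>m \<tau> = complex_of_real (2 powr (- a)) \<cdot>\<^sub>m \<tau> - \<rho>'"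
    using carrier_matD[OF rc] carrier_matD[OF psd_carrier[OF \<tau>]] by (intro eq_matI) (auto simp: algebra_simps)
  ultimately show ?thesis using r(1) s unfolding \<tau>_def by auto
qed

text \<open>The bound 2^(b/2) becomes the constant f of \<open>binning\<close>. It holds for every
  \<sigma>, in particular for the average output state, which is the one the decoding test
  uses.\<close>

lemma Hmax_s_witness:
  assumes "Hmax_s e k d \<rho> < ereal b"
  shows "\<exists>\<rho>'\<in>sball e (k * d) \<rho>. \<forall>\<sigma>. dens d \<sigma> \<longrightarrow> fid \<rho>' (kron (1\<^sub>m k) \<sigma>) \<le> 2 powr (b / 2)"
proof -
  obtain \<rho>' where r: "\<rho>' \<in> sball e (k * d) \<rho>" "Hmax k d \<rho>' < ereal b" using assms unfolding Hmax_s_def INF_less_iff by blast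
  have "fid \<rho>' (kron (1\<^sub>m k) \<sigma>) \<le> 2 powr (b / 2)" if s: "dens d \<sigma>" for \<sigma>
  proof (rule ccontr)
    let ?F = "fid \<rho>' (kron (1\<^sub>m k) \<sigma>)"
    assume "\<not> ?thesis"
    then have F: "2 powr (b / 2) < ?F" by simp
    then have F0: "0 < ?F" using powr_gt_zero[of 2 "b / 2"] by linarith
    have "b / 2 = log 2 (2 powr (b / 2))" by simp
    also have "\<dots> \<le> log 2 ?F" using F by (intro log_mono) auto
    finally have "ereal b \<le> 2 * elog2 (ereal ?F)" using F0 by (simp add: elog2_ereal)
    also have "\<dots> \<le> Hmax k d \<rho>'" unfolding Hmax_def using s by (intro SUP_upper) simp
    finally show False using r(2) by simp
  qed
  then show ?thesis using r(1) by blast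
qed

section \<open>Infinite entropies and the passage from strict bounds to differences of
  entropies\<close>

lemma self_in_sball:
  assumes "dens d \<rho>" "0 \<le> e" shows "\<rho> \<in> sball e d \<rho>"
proof -
  have p: "psd d \<rho>" using densD(1)[OF assms(1)] .
  have "1 \<le> fid \<rho> \<rho>"
    using rtr_roots_le_fid[OF msqrt_psd[OF p] msqrt_psd[OF p]] msqrt_square[OF p] densD(2)[OF assms(1)] by simp
  then have "1\<^sup>2 \<le> (fid \<rho> \<rho>)\<^sup>2" by (intro power_mono) auto
  then have "pdist \<rho> \<rho> \<le> 0" unfolding pdist_def by simp
  then show ?thesis using assms densD[OF assms(1)] by (simp add: sball_def subdens_def rtr_def)
qed

text \<open>The maximally mixed \<sigma> with l = d is feasible, since a state is at most the
  identity. Together with \<open>Hmax_s_not_pinf\<close> this excludes differences of equal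
  infinities, which extended-real subtraction evaluates to \<infinity>.\<close>

lemma Hmin_s_not_minf:
  assumes \<rho>: "dens (k * d) \<rho>" and e: "0 \<le> e" and d: "0 < d"
  shows "Hmin_s e k d \<rho> \<noteq> -\<infinity>"
proof -
  have h: "herm (k * d) \<rho>" using densD(1)[OF \<rho>] by (rule psd_herm)
  have "psd (k * d) (fc (k * d) \<rho> (\<lambda>x. 1 - x))"
  proof -
    have "eigs (k * d) \<rho> i \<le> 1" if "i < k * d" for i
    proof -
      have "eigs (k * d) \<rho> i \<le> (\<Sum>j<k * d. eigs (k * d) \<rho> j)"
        using that eigs_nonneg[OF densD(1)[OF \<rho>]] by (intro member_le_sum) auto
      also have "\<dots> = 1" using fc_rtr[OF h, of "\<lambda>x. x"] eigsys(2)[OF h] densD(2)[OF \<rho>] by simp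
      finally show ?thesis .
    qed
    then show ?thesis by (simp add: fc_psd_iff[OF h])
  qed
  then have 1: "psd (k * d) (1\<^sub>m (k * d) - \<rho>)" unfolding fc_minus[OF h, symmetric] fc_one[OF h] eigsys(2)[OF h] .
  define \<sigma> where "\<sigma> = complex_of_real (1 / real d) \<cdot>\<^sub>m 1\<^sub>m d"
  have s: "dens d \<sigma>"
  proof (rule densI)
    show "psd d \<sigma>" unfolding \<sigma>_def by (intro psd_smult) auto
    show "rtr \<sigma> = 1" unfolding \<sigma>_def using d rtr_smult[OF one_carrier_mat, of "1 / real d" d] by simp
  qed
  have "complex_of_real (real d) \<cdot>\<^sub>m kron (1\<^sub>m k) \<sigma> = 1\<^sub>m (k * d)"
  proof -
    have "complex_of_real (real d) \<cdot>\<^sub>m kron (1\<^sub>m k) \<sigma> = bdiag k d (\<lambda>_. complex_of_real (real d) \<cdot>\<^sub>m \<sigma>)"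
      unfolding kron_one_eq_bdiag[OF densD(3)[OF s] d] using densD(3)[OF s] by (intro bdiag_smult)
    also have "complex_of_real (real d) \<cdot>\<^sub>m \<sigma> = 1\<^sub>m d" unfolding \<sigma>_def using d by (intro eq_matI) auto
    finally show ?thesis by (simp only: one_eq_bdiag)
  qed
  then have "ereal (- log 2 (real d)) \<le> Hmin k d \<rho>" using d 1 by (intro Hmin_ge[OF s]) auto
  also have "\<dots> \<le> Hmin_s e k d \<rho>" unfolding Hmin_s_def using self_in_sball[OF \<rho> e] by (intro SUP_upper)
  finally show ?thesis by auto
qed

lemma Hmax_s_not_pinf:
  assumes \<rho>: "dens (k * d) \<rho>" and e: "0 \<le> e" and d: "0 < d"
  shows "Hmax_s e k d \<rho> \<noteq> \<infinity>"
proof -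
  have "Hmax k d \<rho> \<le> 2 * elog2 (ereal (sqrt (real k) + 1))" unfolding Hmax_def
  proof (rule SUP_least)
    fix \<sigma> assume "\<sigma> \<in> {\<sigma>. dens d \<sigma>}"
    then have s: "dens d \<sigma>" by simp
    have t: "kron (1\<^sub>m k) \<sigma> = bdiag k d (\<lambda>_. \<sigma>)" by (rule kron_one_eq_bdiag[OF densD(3)[OF s] d])
    have tp: "psd (k * d) (kron (1\<^sub>m k) \<sigma>)" unfolding t using densD(1)[OF s] by (intro psd_bdiag)
    have "rtr (kron (1\<^sub>m k) \<sigma>) = real k" unfolding t using densD[OF s] by (subst rtr_bdiag) auto
    then have "fid \<rho> (kron (1\<^sub>m k) \<sigma>) \<le> sqrt (real k) + 1"
      using fid_le_psd[OF densD(1)[OF \<rho>] tp] densD(2)[OF \<rho>] by simp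
    then have "elog2 (ereal (fid \<rho> (kron (1\<^sub>m k) \<sigma>))) \<le> elog2 (ereal (sqrt (real k) + 1))" by (intro elog2_mono) simp
    then show "2 * elog2 (ereal (fid \<rho> (kron (1\<^sub>m k) \<sigma>))) \<le> 2 * elog2 (ereal (sqrt (real k) + 1))"
      by (intro ereal_mult_left_mono) auto
  qed
  moreover have "0 < sqrt (real k) + 1" by (simp add: add_nonneg_pos)
  ultimately have "Hmax k d \<rho> < \<infinity>" by (auto simp: elog2_ereal)
  moreover have "Hmax_s e k d \<rho> \<le> Hmax k d \<rho>" unfolding Hmax_s_def using self_in_sball[OF \<rho> e] by (intro INF_lower)
  ultimately show ?thesis by auto
qed

text \<open>Finite entropies are approximated strictly within h/2 each; an infinite one permits
  arbitrarily large rates and makes \<open>X\<close> infinite.\<close>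

lemma ereal_difference_le:
  fixes A B X :: ereal
  assumes ab: "\<And>a b. ereal a < A \<Longrightarrow> B < ereal b \<Longrightarrow> ereal (a - b - c - 16) \<le> X" and A: "A \<noteq> -\<infinity>" and B: "B \<noteq> \<infinity>"
  shows "A - B - ereal c - 16 \<le> X"
proof -
  consider "A = \<infinity>" | "B = -\<infinity>" | \<alpha> \<beta> where "A = ereal \<alpha>" "B = ereal \<beta>"
    using A B by (cases A; cases B) auto
  then show ?thesis
  proof cases
    case 1
    obtain b where b: "B < ereal b" using B by (cases B) (auto intro: that[of 0] that[of "real_of_ereal B + 1"])
    have "ereal r \<le> X" for r using ab[of "r + b + c + 16" b] 1 b by simp
    then have "X = \<infinity>" by (rule ereal_top)
    then show ?thesis by simp
  next
    case 2
    obtain a where a: "ereal a < A" using A by (cases A) (auto intro: that[of 0] that[of "real_of_ereal A - 1"])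
    have "ereal r \<le> X" for r using ab[of a "a - r - c - 16"] 2 a by simp
    then have "X = \<infinity>" by (rule ereal_top)
    then show ?thesis by simp
  next
    case 3
    have "A - B - ereal c - 16 = ereal (\<alpha> - \<beta> - c - 16)" using 3 by (simp add: numeral_eq_ereal)
    moreover have "ereal (\<alpha> - \<beta> - c - 16) \<le> X + ereal h" if h: "0 < h" for h
    proof -
      have "ereal ((\<alpha> - h / 2) - (\<beta> + h / 2) - c - 16) \<le> X" using 3 h by (intro ab) auto
      then have "ereal ((\<alpha> - h / 2) - (\<beta> + h / 2) - c - 16) + ereal h \<le> X + ereal h" by (intro add_right_mono)
      moreover have "ereal ((\<alpha> - h / 2) - (\<beta> + h / 2) - c - 16) + ereal h = ereal (\<alpha> - \<beta> - c - 16)" by simp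
      ultimately show ?thesis by (simp only:)
    qed
    ultimately show ?thesis by (metis ereal_le_epsilon2)
  qed
qed

text \<open>Rounding a number above 1 up to an integer at most doubles it. This is the factor
  between the 2^16 of the rate and the 2^15 required by \<open>binning\<close>.\<close>

lemma block_size:
  fixes a b eps :: real
  assumes eps: "0 < eps" and R: "1 < 2 powr (a - b) * eps ^ 4 / 2 ^ 16"
  obtains N :: nat where "1 \<le> N" "2 powr (a - b) * eps ^ 4 / 2 ^ 16 \<le> real N"
    "real N * (2 powr (- a) * (2 powr (b / 2))\<^sup>2) \<le> eps ^ 4 / 2 ^ 15"
proof -
  define r where "r = 2 powr (a - b) * eps ^ 4 / 2 ^ 16"
  define N where "N = nat \<lceil>r\<rceil>"
  have r1: "1 < r" using R by (simp add: r_def)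
  have "r \<le> of_int \<lceil>r\<rceil>" "of_int \<lceil>r\<rceil> < r + 1" "0 \<le> \<lceil>r\<rceil>" using r1 by linarith+
  then have N: "r \<le> real N" "real N \<le> 2 * r" using r1 by (auto simp: N_def)
  have "(2 powr (b / 2))\<^sup>2 = 2 powr b" by (simp add: power2_eq_square flip: powr_add)
  then have "2 powr (- a) * (2 powr (b / 2))\<^sup>2 = 2 powr (b - a)" by (simp add: powr_add[symmetric])
  moreover have "real N * 2 powr (b - a) \<le> 2 * r * 2 powr (b - a)" using N(2) by (intro mult_right_mono) auto
  moreover have "2 * r * 2 powr (b - a) = eps ^ 4 / 2 ^ 15 * (2 powr (a - b) * 2 powr (b - a))" by (simp add: r_def)
  moreover have "2 powr (a - b) * 2 powr (b - a) = (1 :: real)" by (simp flip: powr_add)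
  ultimately have "real N * (2 powr (- a) * (2 powr (b / 2))\<^sup>2) \<le> eps ^ 4 / 2 ^ 15" by simp
  then show thesis using that[of N] N r1 by (auto simp: r_def)
qed

lemma log_block_size:
  assumes "0 < eps"
  shows "log 2 (2 powr (a - b) * eps ^ 4 / 2 ^ 16) = a - b - 4 * log 2 (1 / eps) - 16"
proof -
  have "log 2 (2 powr (a - b) * eps ^ 4 / 2 ^ 16) = log 2 (2 powr (a - b)) + log 2 (eps ^ 4) - log 2 (2 ^ 16)"
    using assms by (simp add: log_divide log_mult)
  also have "log 2 (eps ^ 4) = 4 * log 2 eps" using assms by (simp add: log_nat_power)
  also have "log 2 (2 ^ 16 :: real) = 16" using log_nat_power[of 2 2 16] by simp
  finally show ?thesis using assms by (simp add: log_divide)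
qed

section \<open>Trivial codes\<close>

lemma Sup_log_unbounded:
  assumes "\<And>N. 1 \<le> N \<Longrightarrow> Q N"
  shows "Sup {ereal (log 2 (real N)) | N. Q N} = \<infinity>"
proof (rule ereal_top)
  fix r :: real
  define N where "N = nat \<lceil>2 powr r\<rceil>"
  have p: "0 < (2::real) powr r" by simp
  have "2 powr r \<le> of_int \<lceil>2 powr r\<rceil>" by linarith
  then have N: "2 powr r \<le> real N" unfolding N_def using p by linarith
  then have "1 \<le> N" using p by (cases N) auto
  have "r = log 2 (2 powr r)" by simp
  also have "\<dots> \<le> log 2 (real N)" using N p by (intro log_mono) auto
  finally have "ereal r \<le> ereal (log 2 (real N))" by simp
  also have "\<dots> \<le> Sup {ereal (log 2 (real N)) | N. Q N}" using assms[OF \<open>1 \<le> N\<close>] by (intro Sup_upper) auto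
  finally show "ereal r \<le> Sup {ereal (log 2 (real N)) | N. Q N}" .
qed

lemma povm_first_outcome: "1 \<le> N \<Longrightarrow> povm d N (\<lambda>m. if m = 0 then 1\<^sub>m d else 0\<^sub>m d d)"
proof -
  assume N: "1 \<le> N"
  have "mix d (\<lambda>_. 1) (\<lambda>m. if m = 0 then 1\<^sub>m d else 0\<^sub>m d d) N = 1\<^sub>m d"
  proof (rule eq_matI)
    fix i j assume "i < dim_row (1\<^sub>m d :: complex mat)" "j < dim_col (1\<^sub>m d :: complex mat)"
    then have ij: "i < d" "j < d" by auto
    have "mix d (\<lambda>_. 1) (\<lambda>m. if m = 0 then 1\<^sub>m d else 0\<^sub>m d d) N $$ (i, j) = (\<Sum>m<N. if m = 0 then 1\<^sub>m d $$ (i, j) else 0)"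
      unfolding mix_index[OF ij] using ij by (intro sum.cong) auto
    then show "mix d (\<lambda>_. 1) (\<lambda>m. if m = 0 then 1\<^sub>m d else 0\<^sub>m d d) N $$ (i, j) = 1\<^sub>m d $$ (i, j)" using N by simp
  qed (auto simp: mix_def)
  then show ?thesis by (simp add: povm_def)
qed

lemma first_outcome_error:
  fixes m N :: nat
  assumes "dens d \<rho>" "0 \<le> eps" "N = 1 \<or> 1 \<le> eps" "m < N"
  shows "1 - rtr ((if m = 0 then 1\<^sub>m d else 0\<^sub>m d d) * \<rho>) \<le> eps"
  using assms densD[OF assms(1)] by (auto simp: left_mult_zero_mat[of _ d d])

text \<open>The decoder always announces message 0. This is free of error for N = 1, and admissible
  for every N once eps >= 1, in which case the capacity is infinite.\<close>

lemma pub_code_const: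
  assumes "1 \<le> nX" "\<And>x. x < nX \<Longrightarrow> dens dY (\<theta> x)" "0 \<le> eps" "1 \<le> N" "N = 1 \<or> 1 \<le> eps"
  shows "pub_code nX dY \<theta> eps N (\<lambda>_. 0) (\<lambda>m. if m = 0 then 1\<^sub>m dY else 0\<^sub>m dY dY)"
  using assms povm_first_outcome[of N dY] first_outcome_error[of dY "\<theta> 0" eps N]
  unfolding pub_code_def rtr_def by auto

text \<open>\<open>binning\<close> is applied with a one-dimensional eavesdropper and w = 0. Hashing
  then merely makes the bins almost equally likely, as governed by the min-entropy of the classical
  input.\<close>

lemma pub_rate_le:
  assumes nX: "1 \<le> nX" and dY: "1 \<le> dY" and \<theta>: "\<And>x. x < nX \<Longrightarrow> dens dY (\<theta> x)" and eps: "0 < eps" "eps < 1"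
    and P: "pdistr nX P"
    and a: "ereal a < Hmin_s (eps / 8) nX 1 (ptr nX dY 1 (cq_state nX dY P \<theta>))"
    and b: "Hmax_s (eps / 8) nX dY (cq_state nX dY P \<theta>) < ereal b"
  shows "ereal (a - b - 4 * log 2 (1 / eps) - 16) \<le> C_pub nX dY \<theta> eps"
proof -
  have C: "ereal (log 2 (real N)) \<le> C_pub nX dY \<theta> eps" if "pub_code nX dY \<theta> eps N Enc E" for N Enc E
    unfolding C_pub_def using that by (intro Sup_upper) blast
  define R where "R = 2 powr (a - b) * eps ^ 4 / 2 ^ 16"
  have R0: "0 < R" using eps by (simp add: R_def)
  have Rl: "log 2 R = a - b - 4 * log 2 (1 / eps) - 16" unfolding R_def using eps by (intro log_block_size)
  show ?thesis
  proof (cases "1 < R")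
    case False
    \<comment> \<open>The claimed rate is not positive here, and the code with a single message
      suffices.\<close>
    then have "log 2 R \<le> 0" using R0 by simp
    moreover have "ereal (log 2 (real 1)) \<le> C_pub nX dY \<theta> eps"
      using pub_code_const[of nX dY \<theta> eps 1] nX \<theta> eps by (intro C) auto
    ultimately show ?thesis unfolding Rl[symmetric] by (simp add: zero_ereal_def[symmetric] order.trans[of "ereal (log 2 R)" 0])
  next
    case True
    obtain N where N: "1 \<le> N" "R \<le> real N" "real N * (2 powr (- a) * (2 powr (b / 2))\<^sup>2) \<le> eps ^ 4 / 2 ^ 15"
      using block_size[OF eps(1) True[unfolded R_def]] unfolding R_def by blast
    have d0: "0 < dY" using dY by simp
    have cl: "ptr nX dY 1 (cq_state nX dY P \<theta>) = cq_state nX 1 P (\<lambda>_. 1\<^sub>m 1)" using \<theta> d0 by (rule ptr_cq_state_classical)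
    obtain \<rho>Z \<sigma> where Z: "\<rho>Z \<in> sball (eps / 8) (nX * 1) (cq_state nX 1 P (\<lambda>_. 1\<^sub>m 1))" "dens 1 \<sigma>"
      "psd (nX * 1) (complex_of_real (2 powr (- a)) \<cdot>\<^sub>m kron (1\<^sub>m nX) \<sigma> - \<rho>Z)"
    proof -
      have "0 < (1 :: nat)" by simp
      from Hmin_s_witness[OF a[unfolded cl] this] show ?thesis using that by blast
    qed
    obtain \<rho>Y where Y: "\<rho>Y \<in> sball (eps / 8) (nX * dY) (cq_state nX dY P \<theta>)"
      "\<And>\<tau>. dens dY \<tau> \<Longrightarrow> fid \<rho>Y (kron (1\<^sub>m nX) \<tau>) \<le> 2 powr (b / 2)"
      using Hmax_s_witness[OF b] by blast
    have one: "dens 1 (1\<^sub>m 1)" by (rule densI) auto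
    have "\<exists>B \<Lambda>. (\<forall>m. B m \<subseteq> {..<nX}) \<and> (\<forall>m n. m \<noteq> n \<longrightarrow> B m \<inter> B n = {}) \<and> (\<forall>t<nX. psd dY (\<Lambda> t)) \<and>
      (\<forall>m. \<forall>t\<in>B m. rtr (\<Lambda> t * \<theta> t) \<le> 1) \<and>
      psd dY (1\<^sub>m dY - mix dY (\<lambda>t. if \<exists>m<8 * N. t \<in> B m then 1 else 0) \<Lambda> nX) \<and>
      (\<Sum>m<8 * N. bin_val nX 1 P \<theta> (\<lambda>_. 1\<^sub>m 1) \<Lambda> 0 (B m)) \<le> (7 / 8 + 2 * 0) * eps * real (8 * N)"
    proof (rule binning[where \<sigma> = \<sigma> and l = "2 powr (- a)" and f = "2 powr (b / 2)"])
      show "subdens (nX * 1) \<rho>Z" "pdist (cq_state nX 1 P (\<lambda>_. 1\<^sub>m 1)) \<rho>Z \<le> eps / 8"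
        using Z(1) by (auto simp: sball_def)
      show "subdens (nX * dY) \<rho>Y" "pdist (cq_state nX dY P \<theta>) \<rho>Y \<le> eps / 8"
        using Y(1) by (auto simp: sball_def)
      show "psd (nX * 1) (complex_of_real (2 powr (- a)) \<cdot>\<^sub>m kron (1\<^sub>m nX) \<sigma> - \<rho>Z)" by fact
      show "eps \<le> 1" using eps by simp
    qed (use P \<theta> one d0 eps Z(2) Y(2) N in \<open>auto simp del: One_nat_def\<close>)
    then obtain B \<Lambda> where B: "\<And>m. B m \<subseteq> {..<nX}" "\<And>m n. m \<noteq> n \<Longrightarrow> B m \<inter> B n = {}" and \<Lambda>: "\<And>t. t < nX \<Longrightarrow> psd dY (\<Lambda> t)"
      and \<Lambda>1: "\<And>m t. t \<in> B m \<Longrightarrow> rtr (\<Lambda> t * \<theta> t) \<le> 1"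
      and sub: "psd dY (1\<^sub>m dY - mix dY (\<lambda>t. if \<exists>m<8 * N. t \<in> B m then 1 else 0) \<Lambda> nX)"
      and val: "(\<Sum>m<8 * N. bin_val nX 1 P \<theta> (\<lambda>_. 1\<^sub>m 1) \<Lambda> 0 (B m)) \<le> (7 / 8 + 2 * 0) * eps * real (8 * N)"
      by blast
    have P0: "0 \<le> P t" if "t < nX" for t using P that by (simp add: pdistr_def)
    have "0 \<le> bin_val nX 1 P \<theta> (\<lambda>_. 1\<^sub>m 1) \<Lambda> 0 (B m)" for m
      by (rule bin_val_nonneg) (use B(1) \<Lambda>1 P0 in auto)
    then obtain sel where sel: "inj_on sel {..<N}" "\<And>i. i < N \<Longrightarrow> sel i < 8 * N"
      "\<And>i. i < N \<Longrightarrow> bin_val nX 1 P \<theta> (\<lambda>_. 1\<^sub>m 1) \<Lambda> 0 (B (sel i)) \<le> eps"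
      using select_below_threshold[of N "\<lambda>m. bin_val nX 1 P \<theta> (\<lambda>_. 1\<^sub>m 1) \<Lambda> 0 (B m)" eps] val eps by auto
    obtain E where E: "povm dY N E"
      and Eg: "\<And>i t \<rho>. i < N \<Longrightarrow> t \<in> B (sel i) \<Longrightarrow> psd dY \<rho> \<Longrightarrow> rtr (\<Lambda> t * \<rho>) \<le> rtr (E i * \<rho>)"
      using povm_of_bins[of nX dY \<Lambda> "8 * N" B sel N, OF \<Lambda> sub B sel(1,2) N(1)] by blast
    \<comment> \<open>Every bin kept has mean error at most eps, hence contains a symbol with error
      at most eps. Choosing it makes the encoder deterministic.\<close>
    have "\<exists>t\<in>B (sel i). 1 - rtr (\<Lambda> t * \<theta> t) \<le> eps" if i: "i < N" for i
    proof (rule weighted_average_witness[where P = P])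
      show "finite (B (sel i))" using B(1) finite_subset by blast
      show "(\<Sum>t\<in>B (sel i). P t) \<noteq> 0" "(\<Sum>t\<in>B (sel i). P t * (1 - rtr (\<Lambda> t * \<theta> t))) / (\<Sum>t\<in>B (sel i). P t) \<le> eps"
        by (rule bin_val_parts[OF sel(3)[OF i]]; use eps B(1) \<Lambda>1 P0 in auto)+
    qed (use B(1) P0 in auto)
    then obtain Enc where Enc: "\<And>i. i < N \<Longrightarrow> Enc i \<in> B (sel i)" "\<And>i. i < N \<Longrightarrow> 1 - rtr (\<Lambda> (Enc i) * \<theta> (Enc i)) \<le> eps" by metis
    have "pub_code nX dY \<theta> eps N Enc E"
    proof -
      have "Enc i < nX" if "i < N" for i using Enc(1)[OF that] B(1) by auto
      moreover have "1 - rtr (E i * \<theta> (Enc i)) \<le> eps" if "i < N" for i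
        using Eg[OF that Enc(1)[OF that] densD(1)[OF \<theta>]] Enc(2)[OF that] \<open>\<And>i. i < N \<Longrightarrow> Enc i < nX\<close>[OF that] by force
      ultimately show ?thesis using N(1) E unfolding pub_code_def rtr_def by blast
    qed
    from C[OF this] have "ereal (log 2 (real N)) \<le> C_pub nX dY \<theta> eps" .
    moreover have "log 2 R \<le> log 2 (real N)" using N(2) R0 by (intro log_mono) auto
    ultimately show ?thesis unfolding Rl[symmetric] by (meson ereal_less_eq(3) order.trans)
  qed
qed

lemma pub_achievability:
  assumes nX: "1 \<le> nX" and dY: "1 \<le> dY" and \<theta>: "\<And>x. x < nX \<Longrightarrow> dens dY (\<theta> x)" and eps: "0 < eps"
  shows "(SUP P \<in> {P. pdistr nX P}.
          Hmin_s (eps / 8) nX 1 (ptr nX dY 1 (cq_state nX dY P \<theta>))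
          - Hmax_s (eps / 8) nX dY (cq_state nX dY P \<theta>)
          - ereal (4 * log 2 (1 / eps)) - 16) \<le> C_pub nX dY \<theta> eps"
proof (cases "eps < 1")
  case False
  have "C_pub nX dY \<theta> eps = \<infinity>" unfolding C_pub_def
    using pub_code_const[of nX dY \<theta> eps] nX \<theta> eps False by (intro Sup_log_unbounded) (metis less_imp_le not_less)
  then show ?thesis by simp
next
  case True
  show ?thesis
  proof (rule SUP_least)
    fix P assume "P \<in> {P. pdistr nX P}"
    then have P: "pdistr nX P" by simp
    have d0: "0 < dY" using dY by simp
    have cl: "ptr nX dY 1 (cq_state nX dY P \<theta>) = cq_state nX 1 P (\<lambda>_. 1\<^sub>m 1)" using \<theta> d0 by (rule ptr_cq_state_classical)
    have one: "dens 1 (1\<^sub>m 1)" by (rule densI) auto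
    have d1: "dens (nX * 1) (cq_state nX 1 P (\<lambda>_. 1\<^sub>m 1))" using one P by (intro cq_state_dens) auto
    have d2: "dens (nX * dY) (cq_state nX dY P \<theta>)" using \<theta> P d0 by (rule cq_state_dens)
    show "Hmin_s (eps / 8) nX 1 (ptr nX dY 1 (cq_state nX dY P \<theta>))
          - Hmax_s (eps / 8) nX dY (cq_state nX dY P \<theta>) - ereal (4 * log 2 (1 / eps)) - 16 \<le> C_pub nX dY \<theta> eps"
    proof (rule ereal_difference_le)
      show "Hmin_s (eps / 8) nX 1 (ptr nX dY 1 (cq_state nX dY P \<theta>)) \<noteq> - \<infinity>"
        unfolding cl using eps by (intro Hmin_s_not_minf[OF d1]) auto
      show "Hmax_s (eps / 8) nX dY (cq_state nX dY P \<theta>) \<noteq> \<infinity>" using eps d0 by (intro Hmax_s_not_pinf[OF d2]) auto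
    qed (rule pub_rate_le[OF nX dY \<theta> eps True P])
  qed
qed

section \<open>Private codes with randomized encoders\<close>

lemma ptr_last_mix: "ptr a b 1 (mix (a * b) q M k) = mix a q (\<lambda>t. ptr a b 1 (M t)) k"
proof (rule eq_matI)
  fix i j assume "i < dim_row (mix a q (\<lambda>t. ptr a b 1 (M t)) k)" "j < dim_col (mix a q (\<lambda>t. ptr a b 1 (M t)) k)"
  then have ij: "i < a" "j < a" by (auto simp: mix_def)
  have "ptr a b 1 (mix (a * b) q M k) $$ (i, j) = (\<Sum>l<b. \<Sum>t<k. complex_of_real (q t) * M t $$ (i * b + l, j * b + l))"
    unfolding ptr_last_index[OF ij] using ij by (intro sum.cong) (auto simp: mix_index block_index_less)
  also have "\<dots> = (\<Sum>t<k. \<Sum>l<b. complex_of_real (q t) * M t $$ (i * b + l, j * b + l))" by (rule sum.swap)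
  also have "\<dots> = mix a q (\<lambda>t. ptr a b 1 (M t)) k $$ (i, j)"
    unfolding mix_index[OF ij] ptr_last_index[OF ij] by (simp add: sum_distrib_left)
  finally show "ptr a b 1 (mix (a * b) q M k) $$ (i, j) = mix a q (\<lambda>t. ptr a b 1 (M t)) k $$ (i, j)" .
qed (auto simp: mix_def ptr_def)

lemma ptr_first_mix: "ptr 1 a b (mix (a * b) q M k) = mix b q (\<lambda>t. ptr 1 a b (M t)) k"
proof (rule eq_matI)
  fix i j assume "i < dim_row (mix b q (\<lambda>t. ptr 1 a b (M t)) k)" "j < dim_col (mix b q (\<lambda>t. ptr 1 a b (M t)) k)"
  then have ij: "i < b" "j < b" by (auto simp: mix_def)
  have "ptr 1 a b (mix (a * b) q M k) $$ (i, j) = (\<Sum>l<a. \<Sum>t<k. complex_of_real (q t) * M t $$ (l * b + i, l * b + j))"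
    unfolding ptr_first_index[OF ij] using ij by (intro sum.cong) (auto simp: mix_index block_index_less)
  also have "\<dots> = (\<Sum>t<k. \<Sum>l<a. complex_of_real (q t) * M t $$ (l * b + i, l * b + j))" by (rule sum.swap)
  also have "\<dots> = mix b q (\<lambda>t. ptr 1 a b (M t)) k $$ (i, j)"
    unfolding mix_index[OF ij] ptr_first_index[OF ij] by (simp add: sum_distrib_left)
  finally show "ptr 1 a b (mix (a * b) q M k) $$ (i, j) = mix b q (\<lambda>t. ptr 1 a b (M t)) k $$ (i, j)" .
qed (auto simp: mix_def ptr_def)

text \<open>Drawing t from \<open>q\<close> and then x from \<open>W t\<close> is a single random
  choice of x. This identifies the channel output of an encoder that first picks t in the bin of its
  message.\<close>

lemma mix_mix: "mix d (\<lambda>x. \<Sum>t<k. q t * W t x) \<theta> n = mix d q (\<lambda>t. mix d (W t) \<theta> n) k"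
proof (rule eq_matI)
  fix i j assume "i < dim_row (mix d q (\<lambda>t. mix d (W t) \<theta> n) k)" "j < dim_col (mix d q (\<lambda>t. mix d (W t) \<theta> n) k)"
  then have ij: "i < d" "j < d" by (auto simp: mix_def)
  have "mix d (\<lambda>x. \<Sum>t<k. q t * W t x) \<theta> n $$ (i, j) = (\<Sum>x<n. \<Sum>t<k. complex_of_real (q t) * (complex_of_real (W t x) * \<theta> x $$ (i, j)))"
    unfolding mix_index[OF ij] by (simp add: sum_distrib_right mult.assoc)
  also have "\<dots> = (\<Sum>t<k. \<Sum>x<n. complex_of_real (q t) * (complex_of_real (W t x) * \<theta> x $$ (i, j)))" by (rule sum.swap)
  also have "\<dots> = mix d q (\<lambda>t. mix d (W t) \<theta> n) k $$ (i, j)"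
    unfolding mix_index[OF ij] by (simp add: sum_distrib_left)
  finally show "mix d (\<lambda>x. \<Sum>t<k. q t * W t x) \<theta> n $$ (i, j) = mix d q (\<lambda>t. mix d (W t) \<theta> n) k $$ (i, j)" .
qed (auto simp: mix_def)

lemma pdistr_mixture:
  assumes "pdistr k q" "\<And>t. t < k \<Longrightarrow> pdistr n (W t)"
  shows "pdistr n (\<lambda>x. \<Sum>t<k. q t * W t x)"
proof -
  have "(\<Sum>x<n. \<Sum>t<k. q t * W t x) = (\<Sum>t<k. q t * (\<Sum>x<n. W t x))"
    by (subst sum.swap) (simp add: sum_distrib_left)
  also have "\<dots> = (\<Sum>t<k. q t)" using assms(2) by (intro sum.cong) (auto simp: pdistr_def)
  finally show ?thesis using assms by (auto simp: pdistr_def intro!: sum_nonneg)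
qed

text \<open>Hashing compares each bin with the average over the whole source, secrecy with the
  average over the code. The code average is a mixture of states that are all close to the source
  average, so the triangle inequality costs a factor 2.\<close>

lemma secrecy_of_average:
  assumes Z: "\<And>i. i < N \<Longrightarrow> dens d (Z i)" and Zm: "dens d Zm" and i: "i < N"
    and close: "\<And>j. j < N \<Longrightarrow> tnorm (Z j - Zm) / 2 \<le> c"
  shows "tnorm (Z i - mix d (\<lambda>_. 1 / real N) Z N) / 2 \<le> 2 * c"
proof -
  have N: "0 < N" using i by simp
  have u: "pdistr N (\<lambda>_. 1 / real N)" using N by (simp add: pdistr_def)
  define Za where "Za = mix d (\<lambda>_. 1 / real N) Z N"
  have Zad: "dens d Za" unfolding Za_def using u Z by (rule mix_dens)
  have c: "Z j \<in> carrier_mat d d" if "j < N" for j using densD(3)[OF Z[OF that]] .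
  have c': "Zm \<in> carrier_mat d d" "Za \<in> carrier_mat d d" using densD(3)[OF Zm] densD(3)[OF Zad] by auto
  have "herm d (Z i - Za)" using densD(1)[OF Z[OF i]] densD(1)[OF Zad] by (intro herm_diff psd_herm)
  then obtain T where T: "eff d T" "tnorm (Z i - Za) = 2 * rtr (T * (Z i - Za)) - rtr (Z i - Za)"
    using tnorm_herm_attained by blast
  have Tc: "T \<in> carrier_mat d d" using T(1) by simp
  have zr: "rtr (Z j - Zm) = 0" if "j < N" for j
    using c[OF that] c'(1) densD(2)[OF Z[OF that]] densD(2)[OF Zm] by (simp add: rtr_minus[of _ d])
  have tj: "\<bar>rtr (T * Z j) - rtr (T * Zm)\<bar> \<le> c" if "j < N" for j
  proof -
    have "\<bar>2 * rtr (T * (Z j - Zm)) - rtr (Z j - Zm)\<bar> \<le> tnorm (Z j - Zm)"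
      using c[OF that] c'(1) by (intro tnorm_eff_abs[OF _ T(1)]) auto
    moreover have "rtr (T * (Z j - Zm)) = rtr (T * Z j) - rtr (T * Zm)"
      using c[OF that] c'(1) Tc by (simp add: mult_minus_square[of _ d] rtr_minus[of _ d])
    ultimately show ?thesis using zr[OF that] close[OF that] by simp
  qed
  have "rtr (T * Za) = (\<Sum>j<N. 1 / real N * rtr (T * Z j))" unfolding Za_def using Tc c by (intro rtr_mult_mix) auto
  moreover have "(\<Sum>j<N. 1 / real N * rtr (T * Z j)) \<ge> (\<Sum>j<N. 1 / real N * (rtr (T * Zm) - c))"
  proof (intro sum_mono mult_left_mono)
    fix j assume "j \<in> {..<N}"
    then show "rtr (T * Zm) - c \<le> rtr (T * Z j)" using tj[of j] by (simp add: abs_le_iff)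
  qed simp
  moreover have "(\<Sum>j<N. 1 / real N * (rtr (T * Zm) - c)) = rtr (T * Zm) - c" using N by simp
  ultimately have "rtr (T * Zm) - c \<le> rtr (T * Za)" by simp
  moreover have "rtr (Z i - Za) = 0"
    using c[OF i] c' densD(2)[OF Z[OF i]] densD(2)[OF Zad] by (simp add: rtr_minus[of _ d])
  moreover have "rtr (T * (Z i - Za)) = rtr (T * Z i) - rtr (T * Za)"
    using c[OF i] c' Tc by (simp add: mult_minus_square[of _ d] rtr_minus[of _ d])
  ultimately show ?thesis using T(2) tj[OF i] unfolding Za_def by (simp add: abs_le_iff)
qed

lemma tnorm_zero: "tnorm (0\<^sub>m d d) = 0"
  using tnorm_adj_mult_le[of "0\<^sub>m d d" d "0\<^sub>m d d"] tnorm_nonneg[of "0\<^sub>m d d" d]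
  by (simp add: left_mult_zero_mat[of _ d d])

lemma prv_code_const:
  assumes nX: "1 \<le> nX" and \<theta>: "\<And>x. x < nX \<Longrightarrow> dens (dY * dZ) (\<theta> x)" and eps: "0 \<le> eps" and N: "1 \<le> N" "N = 1 \<or> 1 \<le> eps"
  shows "prv_code nX dY dZ \<theta> eps N (\<lambda>_ x. if x = 0 then 1 else 0) (\<lambda>m. if m = 0 then 1\<^sub>m dY else 0\<^sub>m dY dY)"
proof -
  define Q where "Q x = (if x = 0 then 1 else 0 :: real)" for x :: nat
  define A where "A = mix (dY * dZ) Q \<theta> nX"
  have Q: "pdistr nX Q" using nX by (simp add: pdistr_def Q_def)
  have A: "dens (dY * dZ) A" unfolding A_def using Q \<theta> by (rule mix_dens)
  have av: "avg_out nX dY dZ \<theta> (\<lambda>_. Q) m = A" for m by (simp add: avg_out_def A_def)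
  have Yd: "dens dY (ptr dY dZ 1 A)" and Zd: "dens dZ (ptr 1 dY dZ A)"
    by (rule dens_ptr_last[OF A], rule dens_ptr_first[OF A])
  have "mix dZ (\<lambda>_. 1 / real N) (\<lambda>_. ptr 1 dY dZ A) N = ptr 1 dY dZ A"
    using N carrier_matD[OF densD(3)[OF Zd]] by (intro eq_matI) (auto simp: mix_def)
  moreover have "ptr 1 dY dZ A - ptr 1 dY dZ A = 0\<^sub>m dZ dZ" using densD(3)[OF Zd] by (rule minus_r_inv_mat)
  ultimately have sec: "tnorm (ptr 1 dY dZ A - mix dZ (\<lambda>_. 1 / real N) (\<lambda>_. ptr 1 dY dZ A) N) / 2 \<le> eps"
    using eps by (simp only: tnorm_zero)
  have err: "1 - Re (mtrace ((if m = 0 then 1\<^sub>m dY else 0\<^sub>m dY dY) * ptr dY dZ 1 A)) \<le> eps" if "m < N" for m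
    using first_outcome_error[OF Yd eps N(2) that] by (simp add: rtr_def)
  have "prv_code nX dY dZ \<theta> eps N (\<lambda>_. Q) (\<lambda>m. if m = 0 then 1\<^sub>m dY else 0\<^sub>m dY dY)"
    unfolding prv_code_def av using N(1) Q povm_first_outcome[OF N(1)] err sec by blast
  then show ?thesis by (simp add: Q_def[abs_def])
qed

lemma prv_rate_le:
  assumes nX: "1 \<le> nX" and dY: "1 \<le> dY" and dZ: "1 \<le> dZ" and \<theta>: "\<And>x. x < nX \<Longrightarrow> dens (dY * dZ) (\<theta> x)"
    and eps: "0 < eps" "8 * eps < 1" and k: "1 \<le> k" and P: "pdistr k P" and W: "\<And>t. t < k \<Longrightarrow> pdistr nX (W t)"
  defines "M \<equiv> \<lambda>t. mix (dY * dZ) (W t) \<theta> nX"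
  defines "\<eta> \<equiv> \<lambda>t. ptr dY dZ 1 (M t)" and "\<zeta> \<equiv> \<lambda>t. ptr 1 dY dZ (M t)"
  assumes a: "ereal a < Hmin_s (eps / 8) k dZ (cq_state k dZ P \<zeta>)"
    and b: "Hmax_s (eps / 8) k dY (cq_state k dY P \<eta>) < ereal b"
  shows "ereal (a - b - 4 * log 2 (1 / eps) - 16) \<le> C_prv nX dY dZ \<theta> (8 * eps)"
proof -
  have C: "ereal (log 2 (real N)) \<le> C_prv nX dY dZ \<theta> (8 * eps)" if "prv_code nX dY dZ \<theta> (8 * eps) N Enc E" for N Enc E
    unfolding C_prv_def using that by (intro Sup_upper) blast
  define R where "R = 2 powr (a - b) * eps ^ 4 / 2 ^ 16"
  have R0: "0 < R" using eps by (simp add: R_def)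
  have Rl: "log 2 R = a - b - 4 * log 2 (1 / eps) - 16" unfolding R_def using eps by (intro log_block_size)
  show ?thesis
  proof (cases "1 < R")
    case False
    then have "log 2 R \<le> 0" using R0 by simp
    moreover have "ereal (log 2 (real 1)) \<le> C_prv nX dY dZ \<theta> (8 * eps)"
      using prv_code_const[of nX dY dZ \<theta> "8 * eps" 1] nX \<theta> eps by (intro C) auto
    ultimately show ?thesis unfolding Rl[symmetric] by (simp add: zero_ereal_def[symmetric] order.trans[of "ereal (log 2 R)" 0])
  next
    case True
    obtain N where N: "1 \<le> N" "R \<le> real N" "real N * (2 powr (- a) * (2 powr (b / 2))\<^sup>2) \<le> eps ^ 4 / 2 ^ 15"
      using block_size[OF eps(1) True[unfolded R_def]] unfolding R_def by blast
    have d0: "0 < dY" "0 < dZ" using dY dZ by auto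
    have Md: "dens (dY * dZ) (M t)" if "t < k" for t unfolding M_def using W[OF that] \<theta> by (rule mix_dens)
    have ed: "dens dY (\<eta> t)" and zd: "dens dZ (\<zeta> t)" if "t < k" for t
      unfolding \<eta>_def \<zeta>_def by (rule dens_ptr_last[OF Md[OF that]], rule dens_ptr_first[OF Md[OF that]])
    obtain \<rho>Z \<sigma> where Z: "\<rho>Z \<in> sball (eps / 8) (k * dZ) (cq_state k dZ P \<zeta>)" "dens dZ \<sigma>"
      "psd (k * dZ) (complex_of_real (2 powr (- a)) \<cdot>\<^sub>m kron (1\<^sub>m k) \<sigma> - \<rho>Z)"
      using Hmin_s_witness[OF a d0(2)] by blast
    obtain \<rho>Y where Y: "\<rho>Y \<in> sball (eps / 8) (k * dY) (cq_state k dY P \<eta>)"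
      "\<And>\<tau>. dens dY \<tau> \<Longrightarrow> fid \<rho>Y (kron (1\<^sub>m k) \<tau>) \<le> 2 powr (b / 2)"
      using Hmax_s_witness[OF b] by blast
    have "\<exists>B \<Lambda>. (\<forall>m. B m \<subseteq> {..<k}) \<and> (\<forall>m n. m \<noteq> n \<longrightarrow> B m \<inter> B n = {}) \<and> (\<forall>t<k. psd dY (\<Lambda> t)) \<and>
      (\<forall>m. \<forall>t\<in>B m. rtr (\<Lambda> t * \<eta> t) \<le> 1) \<and>
      psd dY (1\<^sub>m dY - mix dY (\<lambda>t. if \<exists>m<8 * N. t \<in> B m then 1 else 0) \<Lambda> k) \<and>
      (\<Sum>m<8 * N. bin_val k dZ P \<eta> \<zeta> \<Lambda> 1 (B m)) \<le> (7 / 8 + 2 * 1) * eps * real (8 * N)"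
    proof (rule binning[where \<sigma> = \<sigma> and l = "2 powr (- a)" and f = "2 powr (b / 2)"])
      show "subdens (k * dZ) \<rho>Z" "pdist (cq_state k dZ P \<zeta>) \<rho>Z \<le> eps / 8"
        using Z(1) by (auto simp: sball_def)
      show "subdens (k * dY) \<rho>Y" "pdist (cq_state k dY P \<eta>) \<rho>Y \<le> eps / 8"
        using Y(1) by (auto simp: sball_def)
      show "psd (k * dZ) (complex_of_real (2 powr (- a)) \<cdot>\<^sub>m kron (1\<^sub>m k) \<sigma> - \<rho>Z)" by fact
      show "eps \<le> 1" using eps by simp
    qed (use P ed zd d0 eps Z(2) Y(2) N in auto)
    then obtain B \<Lambda> where B: "\<And>m. B m \<subseteq> {..<k}" "\<And>m n. m \<noteq> n \<Longrightarrow> B m \<inter> B n = {}" and \<Lambda>: "\<And>t. t < k \<Longrightarrow> psd dY (\<Lambda> t)"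
      and \<Lambda>1: "\<And>m t. t \<in> B m \<Longrightarrow> rtr (\<Lambda> t * \<eta> t) \<le> 1"
      and sub: "psd dY (1\<^sub>m dY - mix dY (\<lambda>t. if \<exists>m<8 * N. t \<in> B m then 1 else 0) \<Lambda> k)"
      and val: "(\<Sum>m<8 * N. bin_val k dZ P \<eta> \<zeta> \<Lambda> 1 (B m)) \<le> (7 / 8 + 2 * 1) * eps * real (8 * N)"
      by blast
    \<comment> \<open>For w = 1 the mean value of a bin is at most 23/8 eps, which is 7/8 of c. The
      doubling in \<open>secrecy_of_average\<close> gives 46/7 eps, still below 8 eps.\<close>
    define c where "c = 23 / 7 * eps"
    have c: "0 < c" "2 * c \<le> 8 * eps" "c < 1 + 1" using eps by (auto simp: c_def)
    have P0: "0 \<le> P t" if "t < k" for t using P that by (simp add: pdistr_def)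
    have nn: "0 \<le> bin_val k dZ P \<eta> \<zeta> \<Lambda> 1 (B m)" for m
      by (rule bin_val_nonneg) (use B(1) \<Lambda>1 P0 in auto)
    have "(\<Sum>m<8 * N. bin_val k dZ P \<eta> \<zeta> \<Lambda> 1 (B m)) \<le> 7 / 8 * c * real (8 * N)" using val by (simp add: c_def)
    then obtain sel where sel: "inj_on sel {..<N}" "\<And>i. i < N \<Longrightarrow> sel i < 8 * N"
      "\<And>i. i < N \<Longrightarrow> bin_val k dZ P \<eta> \<zeta> \<Lambda> 1 (B (sel i)) \<le> c"
      using select_below_threshold[of N "\<lambda>m. bin_val k dZ P \<eta> \<zeta> \<Lambda> 1 (B m)" c] nn c(1) by blast
    obtain E where E: "povm dY N E"
      and Eg: "\<And>i t \<rho>. i < N \<Longrightarrow> t \<in> B (sel i) \<Longrightarrow> psd dY \<rho> \<Longrightarrow> rtr (\<Lambda> t * \<rho>) \<le> rtr (E i * \<rho>)"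
      using povm_of_bins[of k dY \<Lambda> "8 * N" B sel N, OF \<Lambda> sub B sel(1,2) N(1)] by blast
    define p where "p i = (\<Sum>t\<in>B (sel i). P t)" for i
    \<comment> \<open>Unlike the public encoder, this one keeps the random choice inside the bin:
      what hides the message from the eavesdropper is the average over the bin, not the state of a
      single symbol.\<close>
    define q where "q i t = (if t \<in> B (sel i) then P t / p i else 0)" for i t
    have pB: "p i \<noteq> 0" "(\<Sum>t\<in>B (sel i). P t * (1 - rtr (\<Lambda> t * \<eta> t))) / p i \<le> c"
      "tnorm (mix dZ (q i) \<zeta> k - mix dZ P \<zeta> k) / 2 \<le> c" if i: "i < N" for i
    proof -
      have h: "B (sel i) \<subseteq> {..<k}" "\<And>t. t \<in> B (sel i) \<Longrightarrow> rtr (\<Lambda> t * \<eta> t) \<le> 1" using B(1) \<Lambda>1 by auto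
      note parts = bin_val_parts[OF sel(3)[OF i] c(3) zero_le_one h P0]
      show "p i \<noteq> 0" using parts(1) unfolding p_def by simp
      show "(\<Sum>t\<in>B (sel i). P t * (1 - rtr (\<Lambda> t * \<eta> t))) / p i \<le> c" using parts(2) unfolding p_def by simp
      have "q i = (\<lambda>t. if t \<in> B (sel i) then P t / (\<Sum>t\<in>B (sel i). P t) else 0)" by (rule ext) (simp only: q_def p_def)
      then show "tnorm (mix dZ (q i) \<zeta> k - mix dZ P \<zeta> k) / 2 \<le> c" using parts(3) by simp
    qed
    have p0: "0 \<le> p i" for i unfolding p_def using B(1) P0 by (intro sum_nonneg) auto
    have qB: "(\<Sum>t<k. q i t * x t) = (\<Sum>t\<in>B (sel i). P t * x t) / p i" for i and x :: "nat \<Rightarrow> real"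
    proof -
      have "(\<Sum>t<k. q i t * x t) = (\<Sum>t\<in>B (sel i). P t / p i * x t)"
        using B(1) by (intro sum.mono_neutral_cong_right) (auto simp: q_def)
      then show ?thesis by (simp add: sum_divide_distrib)
    qed
    have q: "pdistr k (q i)" if "i < N" for i
      using qB[of i "\<lambda>_. 1"] pB(1)[OF that] p0[of i] P0 by (auto simp: pdistr_def q_def p_def[symmetric])
    define Enc where "Enc i x = (\<Sum>t<k. q i t * W t x)" for i x
    have av: "avg_out nX dY dZ \<theta> Enc i = mix (dY * dZ) (q i) M k" for i
      unfolding avg_out_def Enc_def M_def by (rule mix_mix)
    have avY: "ptr dY dZ 1 (avg_out nX dY dZ \<theta> Enc i) = mix dY (q i) \<eta> k" for i
      unfolding av \<eta>_def by (rule ptr_last_mix)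
    have avZ: "ptr 1 dY dZ (avg_out nX dY dZ \<theta> Enc i) = mix dZ (q i) \<zeta> k" for i
      unfolding av \<zeta>_def by (rule ptr_first_mix)
    have err: "1 - rtr (E i * mix dY (q i) \<eta> k) \<le> 8 * eps" if i: "i < N" for i
    proof -
      have Ec: "E i \<in> carrier_mat dY dY" using E i by (simp add: povm_def)
      have "rtr (E i * mix dY (q i) \<eta> k) = (\<Sum>t<k. q i t * rtr (E i * \<eta> t))" using Ec densD(3)[OF ed] by (intro rtr_mult_mix) auto
      then have "1 - rtr (E i * mix dY (q i) \<eta> k) = (\<Sum>t<k. q i t * (1 - rtr (E i * \<eta> t)))"
        using q[OF i] by (simp add: right_diff_distrib sum_subtractf pdistr_def)
      also have "\<dots> \<le> (\<Sum>t<k. q i t * (1 - rtr (\<Lambda> t * \<eta> t)))"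
      proof (rule sum_mono)
        fix t assume "t \<in> {..<k}"
        then have t: "t < k" by simp
        show "q i t * (1 - rtr (E i * \<eta> t)) \<le> q i t * (1 - rtr (\<Lambda> t * \<eta> t))"
        proof (cases "t \<in> B (sel i)")
          case True
          then show ?thesis using Eg[OF i True densD(1)[OF ed[OF t]]] q[OF i] t by (intro mult_left_mono) (auto simp: pdistr_def)
        qed (simp add: q_def)
      qed
      also have "\<dots> \<le> c" unfolding qB by (rule pB(2)[OF i])
      finally show ?thesis using c by linarith
    qed
    have sec: "tnorm (mix dZ (q i) \<zeta> k - mix dZ (\<lambda>_. 1 / real N) (\<lambda>j. mix dZ (q j) \<zeta> k) N) / 2 \<le> 8 * eps" if i: "i < N" for i
    proof -
      have "tnorm (mix dZ (q i) \<zeta> k - mix dZ (\<lambda>_. 1 / real N) (\<lambda>j. mix dZ (q j) \<zeta> k) N) / 2 \<le> 2 * c"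
      proof (rule secrecy_of_average[where Z = "\<lambda>j. mix dZ (q j) \<zeta> k"])
        show "dens dZ (mix dZ (q j) \<zeta> k)" if "j < N" for j using q[OF that] zd by (rule mix_dens)
        show "dens dZ (mix dZ P \<zeta> k)" using P zd by (rule mix_dens)
        show "i < N" by fact
        show "tnorm (mix dZ (q j) \<zeta> k - mix dZ P \<zeta> k) / 2 \<le> c" if "j < N" for j by (rule pB(3)[OF that])
      qed
      then show ?thesis using c(2) by linarith
    qed
    have "prv_code nX dY dZ \<theta> (8 * eps) N Enc E"
    proof -
      have "pdistr nX (Enc i)" if "i < N" for i
        unfolding Enc_def using q[OF that] W by (rule pdistr_mixture)
      then show ?thesis unfolding prv_code_def avY avZ using N(1) E err[unfolded rtr_def] sec by blast
    qed
    from C[OF this] have "ereal (log 2 (real N)) \<le> C_prv nX dY dZ \<theta> (8 * eps)" .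
    moreover have "log 2 R \<le> log 2 (real N)" using N(2) R0 by (intro log_mono) auto
    ultimately show ?thesis unfolding Rl[symmetric] by (meson ereal_less_eq(3) order.trans)
  qed
qed

lemma prv_achievability:
  assumes nX: "1 \<le> nX" and dY: "1 \<le> dY" and dZ: "1 \<le> dZ" and \<theta>: "\<And>x. x < nX \<Longrightarrow> dens (dY * dZ) (\<theta> x)" and eps: "0 < eps"
  shows "(SUP (k, PT, W) \<in> {(k, PT, W). k \<ge> 1 \<and> pdistr k PT \<and> (\<forall>t<k. pdistr nX (W t))}.
          Hmin_s (eps / 8) k dZ (ptr k dY dZ (cqq_state nX dY dZ k PT W \<theta>))
          - Hmax_s (eps / 8) k dY (ptr (k * dY) dZ 1 (cqq_state nX dY dZ k PT W \<theta>))
          - ereal (4 * log 2 (1 / eps)) - 16) \<le> C_prv nX dY dZ \<theta> (8 * eps)"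
proof (cases "8 * eps < 1")
  case False
  have "C_prv nX dY dZ \<theta> (8 * eps) = \<infinity>" unfolding C_prv_def
  proof (rule Sup_log_unbounded)
    fix N :: nat assume "1 \<le> N"
    then show "\<exists>Enc E. prv_code nX dY dZ \<theta> (8 * eps) N Enc E"
      using prv_code_const[of nX dY dZ \<theta> "8 * eps" N] nX \<theta> eps False by force
  qed
  then show ?thesis by (simp only: ereal_less_eq)
next
  case True
  show ?thesis
  proof (rule SUP_least)
    fix x assume "x \<in> {(k, PT, W). k \<ge> 1 \<and> pdistr k PT \<and> (\<forall>t<k. pdistr nX (W t))}"
    then obtain k P W where x: "x = (k, P, W)" and k: "1 \<le> k" and P: "pdistr k P" and W: "\<And>t. t < k \<Longrightarrow> pdistr nX (W t)" by auto
    have d0: "0 < dY" "0 < dZ" using dY dZ by auto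
    define M where "M t = mix (dY * dZ) (W t) \<theta> nX" for t
    have Md: "dens (dY * dZ) (M t)" if "t < k" for t unfolding M_def using W[OF that] \<theta> by (rule mix_dens)
    have st: "cqq_state nX dY dZ k P W \<theta> = cq_state k (dY * dZ) P M" by (simp add: cqq_state_def M_def[abs_def])
    have stZ: "ptr k dY dZ (cqq_state nX dY dZ k P W \<theta>) = cq_state k dZ P (\<lambda>t. ptr 1 dY dZ (M t))"
      unfolding st using densD(3)[OF Md] d0 by (intro ptr_cq_state_middle) auto
    have stY: "ptr (k * dY) dZ 1 (cqq_state nX dY dZ k P W \<theta>) = cq_state k dY P (\<lambda>t. ptr dY dZ 1 (M t))"
      unfolding st using densD(3)[OF Md] d0 by (intro ptr_cq_state_last) auto
    have d1: "dens (k * dZ) (cq_state k dZ P (\<lambda>t. ptr 1 dY dZ (M t)))"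
      by (rule cq_state_dens[OF dens_ptr_first[OF Md] P d0(2)])
    have d2: "dens (k * dY) (cq_state k dY P (\<lambda>t. ptr dY dZ 1 (M t)))"
      by (rule cq_state_dens[OF dens_ptr_last[OF Md] P d0(1)])
    have "Hmin_s (eps / 8) k dZ (cq_state k dZ P (\<lambda>t. ptr 1 dY dZ (M t)))
          - Hmax_s (eps / 8) k dY (cq_state k dY P (\<lambda>t. ptr dY dZ 1 (M t)))
          - ereal (4 * log 2 (1 / eps)) - 16 \<le> C_prv nX dY dZ \<theta> (8 * eps)"
    proof (rule ereal_difference_le)
      show "Hmin_s (eps / 8) k dZ (cq_state k dZ P (\<lambda>t. ptr 1 dY dZ (M t))) \<noteq> - \<infinity>"
        using eps d0 by (intro Hmin_s_not_minf[OF d1]) auto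
      show "Hmax_s (eps / 8) k dY (cq_state k dY P (\<lambda>t. ptr dY dZ 1 (M t))) \<noteq> \<infinity>"
        using eps d0 by (intro Hmax_s_not_pinf[OF d2]) auto
    next
      fix a b
      assume "ereal a < Hmin_s (eps / 8) k dZ (cq_state k dZ P (\<lambda>t. ptr 1 dY dZ (M t)))"
        "Hmax_s (eps / 8) k dY (cq_state k dY P (\<lambda>t. ptr dY dZ 1 (M t))) < ereal b"
      then show "ereal (a - b - 4 * log 2 (1 / eps) - 16) \<le> C_prv nX dY dZ \<theta> (8 * eps)"
        unfolding M_def by (intro prv_rate_le[of nX dY dZ \<theta> eps k P W a b] nX dY dZ \<theta> eps True k P W)
    qed
    then show "(case x of (k, PT, W) \<Rightarrow>
          Hmin_s (eps / 8) k dZ (ptr k dY dZ (cqq_state nX dY dZ k PT W \<theta>))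
          - Hmax_s (eps / 8) k dY (ptr (k * dY) dZ 1 (cqq_state nX dY dZ k PT W \<theta>))
          - ereal (4 * log 2 (1 / eps)) - 16) \<le> C_prv nX dY dZ \<theta> (8 * eps)"
      unfolding x prod.case stZ stY .
  qed
qed

theorem theorem1:
  fixes eps :: real
  assumes "eps > 0"
  shows
   "(\<forall>nX dY (\<theta> :: nat \<Rightarrow> complex mat).
       nX \<ge> 1 \<and> dY \<ge> 1 \<and> (\<forall>x<nX. dens dY (\<theta> x)) \<longrightarrow>
       (SUP P \<in> {P. pdistr nX P}.
          Hmin_s (eps / 8) nX 1 (ptr nX dY 1 (cq_state nX dY P \<theta>))
          - Hmax_s (eps / 8) nX dY (cq_state nX dY P \<theta>)
          - ereal (4 * log 2 (1 / eps)) - 16) \<le> C_pub nX dY \<theta> eps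
     \<and> C_pub nX dY \<theta> eps \<le>
       (SUP P \<in> {P. pdistr nX P}.
          Hmin nX 1 (ptr nX dY 1 (cq_state nX dY P \<theta>))
          - Hmax_s (sqrt (2 * eps)) nX dY (cq_state nX dY P \<theta>)))
  \<and> (\<forall>nX dY dZ (\<theta> :: nat \<Rightarrow> complex mat).
       nX \<ge> 1 \<and> dY \<ge> 1 \<and> dZ \<ge> 1 \<and> (\<forall>x<nX. dens (dY * dZ) (\<theta> x)) \<longrightarrow>
       (SUP (k, PT, W) \<in> {(k, PT, W). k \<ge> 1 \<and> pdistr k PT \<and> (\<forall>t<k. pdistr nX (W t))}.
          Hmin_s (eps / 8) k dZ (ptr k dY dZ (cqq_state nX dY dZ k PT W \<theta>))
          - Hmax_s (eps / 8) k dY (ptr (k * dY) dZ 1 (cqq_state nX dY dZ k PT W \<theta>))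
          - ereal (4 * log 2 (1 / eps)) - 16) \<le> C_prv nX dY dZ \<theta> (8 * eps)
     \<and> C_prv nX dY dZ \<theta> eps \<le>
       (SUP (k, PT, W) \<in> {(k, PT, W). k \<ge> 1 \<and> pdistr k PT \<and> (\<forall>t<k. pdistr nX (W t))}.
          Hmin_s (sqrt (2 * eps)) k dZ (ptr k dY dZ (cqq_state nX dY dZ k PT W \<theta>))
          - Hmax_s (sqrt (2 * eps)) k dY (ptr (k * dY) dZ 1 (cqq_state nX dY dZ k PT W \<theta>))))"
proof (intro conjI allI impI; elim conjE)
  fix nX dY :: nat and \<theta> :: "nat \<Rightarrow> complex mat"
  assume "1 \<le> nX" "1 \<le> dY" "\<forall>x<nX. dens dY (\<theta> x)"
  note h = this(1,2) this(3)[rule_format] assms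
  show "(SUP P \<in> {P. pdistr nX P}.
          Hmin_s (eps / 8) nX 1 (ptr nX dY 1 (cq_state nX dY P \<theta>))
          - Hmax_s (eps / 8) nX dY (cq_state nX dY P \<theta>)
          - ereal (4 * log 2 (1 / eps)) - 16) \<le> C_pub nX dY \<theta> eps"
    by (rule pub_achievability) (fact h)+
  show "C_pub nX dY \<theta> eps \<le>
       (SUP P \<in> {P. pdistr nX P}.
          Hmin nX 1 (ptr nX dY 1 (cq_state nX dY P \<theta>))
          - Hmax_s (sqrt (2 * eps)) nX dY (cq_state nX dY P \<theta>))"
    by (rule pub_converse) (fact h)+
next
  fix nX dY dZ :: nat and \<theta> :: "nat \<Rightarrow> complex mat"
  assume "1 \<le> nX" "1 \<le> dY" "1 \<le> dZ" "\<forall>x<nX. dens (dY * dZ) (\<theta> x)"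
  note h = this(1,2,3) this(4)[rule_format] assms
  show "(SUP (k, PT, W) \<in> {(k, PT, W). k \<ge> 1 \<and> pdistr k PT \<and> (\<forall>t<k. pdistr nX (W t))}.
          Hmin_s (eps / 8) k dZ (ptr k dY dZ (cqq_state nX dY dZ k PT W \<theta>))
          - Hmax_s (eps / 8) k dY (ptr (k * dY) dZ 1 (cqq_state nX dY dZ k PT W \<theta>))
          - ereal (4 * log 2 (1 / eps)) - 16) \<le> C_prv nX dY dZ \<theta> (8 * eps)"
    by (rule prv_achievability) (fact h)+
  show "C_prv nX dY dZ \<theta> eps \<le>
       (SUP (k, PT, W) \<in> {(k, PT, W). k \<ge> 1 \<and> pdistr k PT \<and> (\<forall>t<k. pdistr nX (W t))}.
          Hmin_s (sqrt (2 * eps)) k dZ (ptr k dY dZ (cqq_state nX dY dZ k PT W \<theta>))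
          - Hmax_s (sqrt (2 * eps)) k dY (ptr (k * dY) dZ 1 (cqq_state nX dY dZ k PT W \<theta>)))"
    by (rule prv_converse) (fact h)+
qed

end
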